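(* Let $F_\ell$ (resp. $H_\ell$) be the generating series of ordinary (resp. fully simple) planar disks with boundary of length $\ell\ge 1$, for any of the following types of maps: usual maps, maps with loops, stuffed maps. Put $$W(x)=\frac1x+\sum_{\ell\ge1}\frac{F_\ell}{x^{\ell+1}},\qquad X(w)=\frac1w+\sum_{\ell\ge1}H_\ell\,w^{\ell-1}.$$ Then $X(W(x))=x$, as an identity of formal series in $x\to\infty$ (i.e. of formal Laurent series in $x^{-1}$, with coefficients formal power series in the weights).
   Context: Stuffed maps. A stuffed map with $n\ge1$ boundaries of lengths $\ell_1,\dots,\ell_n\ge 1$ is given by: a finite set $H$ of half-edges; permutations $\sigma,\alpha,\varphi$ of $H$ with $\sigma\circ\alpha\circ\varphi=\mathrm{id}$ and $\alpha$ a fixed-point-free involution (cycles of $\sigma$ are vertices, cycles of $\alpha$ are edges); a choice of $n$ cycles of $\varphi$, labelled $1,\dots,n$ and called boundaries, the $i$-th of length $\ell_i$ and equipped with a distinguished half-edge (root); a partition of the set of remaining cycles of $\varphi$ into nonempty blocks $f_1,\dots,f_F$ (the inner cells); and integers $h_1,\dots,h_F\ge0$ (genera of the cells: $f_p$ represents a surface of genus $h_p$ with $|f_p|$ boundary components). $H^\partial\subset H$ is the set of half-edges in boundaries. It is connected if the equivalence relation generated by $h\sim\sigma(h)$, $h\sim\alpha(h)$, and $h\sim h'$ whenever $h,h'$ lie in cycles belonging to the same block $f_p$, has a single class. The genus $g$ of a connected stuffed map is defined by $2-2g=|\mathcal C(\sigma)|-|\mathcal C(\alpha)|+n+\sum_p(2-2h_p-|f_p|)$,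 where $\mathcal C(\cdot)$ denotes the set of cycles. Isomorphisms are bijections of half-edges transporting all the data (including labels of boundaries and roots); automorphisms fix $H^\partial$ pointwise. Weights: to each $h\ge0$, $k\ge1$ and $m_1,\dots,m_k\ge1$ is associated a formal variable $t^h_{m_1,\dots,m_k}$, symmetric in $m_1,\dots,m_k$. A stuffed map has weight $\frac{1}{|\mathrm{Aut}|}\prod_p t^{h_p}_{(\text{lengths of the cycles in } f_p)}$, and generating series are sums of weights over isomorphism classes of connected stuffed maps; they are formal power series in the $t$'s with rational coefficients. Usual maps: only cells with $h_p=0$, $|f_p|=1$ are allowed (all other $t$'s set to $0$). Maps with loops: only cells with $h_p=0$ and $|f_p|\in\{1,2\}$ are allowed. A disk is a connected map of genus $0$ with one boundary. "Ordinary" means that no restriction is imposed. A map is fully simple if the half-edges of $H^\partial$ belong to pairwise distinct cycles of $\sigma$ (each vertex is visited at most once, in total, by the boundaries). *)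

theory Defs
  imports
    "HOL-Library.Multiset"
    "HOL-Library.Disjoint_Sets"
    "HOL-Combinatorics.Orbits"
    "HOL-Computational_Algebra.Formal_Laurent_Series"
begin

section \<open>Formal power series in an arbitrary set of variables\<close>

text \<open>
  A monomial in the variables \<open>'v\<close> is a finite multiset of variables, and a power series is
  an arbitrary assignment of coefficients to monomials.
\<close>

typedef ('v, 'a) mpower_series = "UNIV :: ('v multiset \<Rightarrow> 'a) set"
  morphisms mcoeff Abs_mpower_series ..

setup_lifting type_definition_mpower_series

lemma mpower_series_eqI: "(\<And>m. mcoeff f m = mcoeff g m) \<Longrightarrow> f = g"
  by transfer auto

lemma finite_submultisets: "finite {a. a \<subseteq># (m :: 'v multiset)}"
proof (rule finite_subset)
  show "{a. a \<subseteq># m} \<subseteq> (\<Union>n\<le>size m. {a. set_mset a \<subseteq> set_mset m \<and> size a = n})"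
    by (auto dest: size_mset_mono set_mset_mono)
  show "finite (\<Union>n\<le>size m. {a. set_mset a \<subseteq> set_mset m \<and> size a = n})"
    using finite_multisets_of_size[of "set_mset m"] by (simp add: multisets_of_size_def)
qed

lemma finite_mset_splittings: "finite {(a, b). a + b = (m :: 'v multiset)}"
proof (rule finite_subset)
  show "{(a, b). a + b = m} \<subseteq> {a. a \<subseteq># m} \<times> {b. b \<subseteq># m}"
    by auto
qed (simp add: finite_submultisets)

instantiation mpower_series :: (type, comm_ring_1) comm_ring_1
begin

lift_definition zero_mpower_series :: "('a, 'b) mpower_series" is "\<lambda>_. 0" .

lift_definition one_mpower_series :: "('a, 'b) mpower_series"
  is "\<lambda>m. if m = {#} then 1 else 0" .

lift_definition plus_mpower_series ::
  "('a, 'b) mpower_series \<Rightarrow> ('a, 'b) mpower_series \<Rightarrow> ('a, 'b) mpower_series"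
  is "\<lambda>f g m. f m + g m" .

lift_definition minus_mpower_series ::
  "('a, 'b) mpower_series \<Rightarrow> ('a, 'b) mpower_series \<Rightarrow> ('a, 'b) mpower_series"
  is "\<lambda>f g m. f m - g m" .

lift_definition uminus_mpower_series ::
  "('a, 'b) mpower_series \<Rightarrow> ('a, 'b) mpower_series"
  is "\<lambda>f m. - f m" .

lift_definition times_mpower_series ::
  "('a, 'b) mpower_series \<Rightarrow> ('a, 'b) mpower_series \<Rightarrow> ('a, 'b) mpower_series"
  is "\<lambda>f g m. \<Sum>(a, b)\<in>{(a, b). a + b = m}. f a * g b" .

instance
proof
  fix f g h :: "('a, 'b) mpower_series"
  show "f * g * h = f * (g * h)"
  proof (transfer, rule ext)
    fix f g h :: "'a multiset \<Rightarrow> 'b" and m :: "'a multiset"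
    let ?S = "\<lambda>m :: 'a multiset. {(a, b). a + b = m}"
    have "(\<Sum>(a, b)\<in>?S m. (\<Sum>(c, d)\<in>?S a. f c * g d) * h b) =
          (\<Sum>p\<in>?S m. \<Sum>q\<in>?S (fst p). f (fst q) * g (snd q) * h (snd p))"
      by (simp add: case_prod_unfold sum_distrib_right)
    also have "\<dots> = (\<Sum>x\<in>Sigma (?S m) (\<lambda>p. ?S (fst p)).
                      f (fst (snd x)) * g (snd (snd x)) * h (snd (fst x)))"
      by (subst sum.Sigma) (auto simp: finite_mset_splittings[unfolded case_prod_unfold] case_prod_unfold)
    also have "\<dots> = (\<Sum>x\<in>Sigma (?S m) (\<lambda>p. ?S (snd p)).
                      f (fst (fst x)) * (g (fst (snd x)) * h (snd (snd x))))"
      by (rule sum.reindex_bij_witness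
            [where i = "\<lambda>((a, b), (c, d)). ((a + c, d), (a, c))"
               and j = "\<lambda>((a, b), (c, d)). ((c, d + b), (d, b))"])
         (auto simp: algebra_simps)
    also have "\<dots> = (\<Sum>p\<in>?S m. \<Sum>q\<in>?S (snd p). f (fst p) * (g (fst q) * h (snd q)))"
      by (subst sum.Sigma) (auto simp: finite_mset_splittings[unfolded case_prod_unfold] case_prod_unfold)
    also have "\<dots> = (\<Sum>(a, b)\<in>?S m. f a * (\<Sum>(c, d)\<in>?S b. g c * h d))"
      by (simp add: case_prod_unfold sum_distrib_left)
    finally show "(\<Sum>(a, b)\<in>?S m. (\<Sum>(c, d)\<in>?S a. f c * g d) * h b) =
                  (\<Sum>(a, b)\<in>?S m. f a * (\<Sum>(c, d)\<in>?S b. g c * h d))" .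
  qed
  show "f * g = g * f"
  proof (transfer, rule ext)
    fix f g :: "'a multiset \<Rightarrow> 'b" and m :: "'a multiset"
    show "(\<Sum>(a, b)\<in>{(a, b). a + b = m}. f a * g b) = (\<Sum>(a, b)\<in>{(a, b). a + b = m}. g a * f b)"
      by (rule sum.reindex_bij_witness[where i = prod.swap and j = prod.swap])
         (auto simp: algebra_simps)
  qed
  show "1 * f = f"
  proof (transfer, rule ext)
    fix f :: "'a multiset \<Rightarrow> 'b" and m :: "'a multiset"
    have "(\<Sum>(a, b)\<in>{(a, b). a + b = m}. (if a = {#} then 1 else 0) * f b) =
          (\<Sum>(a, b)\<in>{({#} :: 'a multiset, m)}. (if a = {#} then 1 else 0) * f b)"
      by (rule sum.mono_neutral_right) (auto simp: finite_mset_splittings split: if_splits)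
    then show "(\<Sum>(a, b)\<in>{(a, b). a + b = m}. (if a = {#} then 1 else 0) * f b) = f m"
      by simp
  qed
  show "(f + g) * h = f * h + g * h"
    by (transfer, rule ext) (simp add: case_prod_unfold algebra_simps sum.distrib)
  show "f + g + h = f + (g + h)" "f + g = g + f" "0 + f = f" "- f + f = 0" "f - g = f + - g"
    by (transfer; simp add: algebra_simps fun_eq_iff)+
  show "(0 :: ('a, 'b) mpower_series) \<noteq> 1"
    by transfer (auto simp: fun_eq_iff)
qed

end


section \<open>Composition of Laurent series over a commutative ring\<close>

text \<open>
  This is \<^const>\<open>fls_compose_fps\<close>, which is only available over fields, for an inner
  series with leading coefficient 1; the inverse of the inner series then exists over any
  commutative ring.
\<close>

definition fls_compose_monic :: "'a :: comm_ring_1 fls \<Rightarrow> 'a fps \<Rightarrow> 'a fls" where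
  "fls_compose_monic F G =
     fps_to_fls (fls_base_factor_to_fps F oo G) *
     (if fls_subdegree F \<ge> 0 then fps_to_fls G ^ nat (fls_subdegree F)
      else fls_right_inverse (fps_to_fls G) 1 ^ nat (- fls_subdegree F))"

lemma fls_right_inverse_monic:
  fixes G :: "'a :: comm_ring_1 fps"
  assumes "fps_nth G (subdegree G) = 1"
  shows "fps_to_fls G * fls_right_inverse (fps_to_fls G) 1 = 1"
  using assms by (intro fls_right_inverse) (simp add: fls_subdegree_fls_to_fps)

lemma fls_compose_monic_eq_fls_compose_fps:
  fixes G :: "'a :: field fps"
  assumes "fps_nth G (subdegree G) = 1"
  shows "fls_compose_monic F G = fls_compose_fps F G"
proof -
  have "fls_right_inverse (fps_to_fls G) 1 = inverse (fps_to_fls G)"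
    using fls_right_inverse_monic[OF assms] by (metis inverse_unique)
  then show ?thesis
    by (simp add: fls_compose_monic_def fls_compose_fps_def power_int_def power_inverse)
qed


section \<open>Stuffed maps\<close>

definition cycles_of :: "('a \<Rightarrow> 'a) \<Rightarrow> 'a set \<Rightarrow> 'a set set" where
  "cycles_of p H = orbit p ` H"

text \<open>
  The boundaries are given by the list of their roots: the i-th boundary is the cycle of
  \<open>map_phi\<close> through the i-th root.  The values of \<open>cell_genus\<close> matter only on \<open>cells\<close>.
\<close>

record 'a stuffed_map =
  half_edges :: "'a set"
  map_sigma :: "'a \<Rightarrow> 'a"
  map_alpha :: "'a \<Rightarrow> 'a"
  map_phi :: "'a \<Rightarrow> 'a"
  roots :: "'a list"
  cells :: "'a set set set"
  cell_genus :: "'a set set \<Rightarrow> nat"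

definition boundaries :: "('a, 'b) stuffed_map_scheme \<Rightarrow> 'a set list" where
  "boundaries M = map (orbit (map_phi M)) (roots M)"

definition boundary_half_edges :: "('a, 'b) stuffed_map_scheme \<Rightarrow> 'a set" where
  "boundary_half_edges M = \<Union> (set (boundaries M))"

definition boundary_lengths :: "('a, 'b) stuffed_map_scheme \<Rightarrow> nat list" where
  "boundary_lengths M = map card (boundaries M)"

definition is_stuffed_map :: "('a, 'b) stuffed_map_scheme \<Rightarrow> bool" where
  "is_stuffed_map M \<longleftrightarrow>
     finite (half_edges M) \<and>
     map_sigma M permutes half_edges M \<and>
     map_alpha M permutes half_edges M \<and>
     map_phi M permutes half_edges M \<and>
     map_sigma M \<circ> map_alpha M \<circ> map_phi M = id \<and>
     (\<forall>h\<in>half_edges M. map_alpha M (map_alpha M h) = h \<and> map_alpha M h \<noteq> h) \<and>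
     roots M \<noteq> [] \<and>
     set (roots M) \<subseteq> half_edges M \<and>
     distinct (boundaries M) \<and>
     partition_on (cycles_of (map_phi M) (half_edges M) - set (boundaries M)) (cells M)"

definition adjacent :: "('a, 'b) stuffed_map_scheme \<Rightarrow> 'a \<Rightarrow> 'a \<Rightarrow> bool" where
  "adjacent M h h' \<longleftrightarrow> h \<in> half_edges M \<and> h' \<in> half_edges M \<and>
     (h' = map_sigma M h \<or> h' = map_alpha M h \<or> (\<exists>f\<in>cells M. h \<in> \<Union> f \<and> h' \<in> \<Union> f))"

definition connected_map :: "('a, 'b) stuffed_map_scheme \<Rightarrow> bool" where
  "connected_map M \<longleftrightarrow> half_edges M \<noteq> {} \<and>
     (\<forall>h\<in>half_edges M. \<forall>h'\<in>half_edges M. equivclp (adjacent M) h h')"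

definition has_genus :: "('a, 'b) stuffed_map_scheme \<Rightarrow> int \<Rightarrow> bool" where
  "has_genus M g \<longleftrightarrow>
     2 - 2 * g =
       int (card (cycles_of (map_sigma M) (half_edges M)))
       - int (card (cycles_of (map_alpha M) (half_edges M)))
       + int (length (roots M))
       + (\<Sum>f\<in>cells M. 2 - 2 * int (cell_genus M f) - int (card f))"

definition is_disk :: "('a, 'b) stuffed_map_scheme \<Rightarrow> bool" where
  "is_disk M \<longleftrightarrow>
     is_stuffed_map M \<and> connected_map M \<and> has_genus M 0 \<and> length (roots M) = 1"

definition fully_simple :: "('a, 'b) stuffed_map_scheme \<Rightarrow> bool" where
  "fully_simple M \<longleftrightarrow> inj_on (orbit (map_sigma M)) (boundary_half_edges M)"

datatype map_kind = Usual_Maps | Maps_With_Loops | Stuffed_Maps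

fun of_kind :: "map_kind \<Rightarrow> ('a, 'b) stuffed_map_scheme \<Rightarrow> bool" where
  "of_kind Usual_Maps M \<longleftrightarrow> (\<forall>f\<in>cells M. cell_genus M f = 0 \<and> card f = 1)"
| "of_kind Maps_With_Loops M \<longleftrightarrow> (\<forall>f\<in>cells M. cell_genus M f = 0 \<and> card f \<in> {1, 2})"
| "of_kind Stuffed_Maps M \<longleftrightarrow> True"


section \<open>Isomorphisms\<close>

definition map_iso ::
  "('a, 'c) stuffed_map_scheme \<Rightarrow> ('b, 'd) stuffed_map_scheme \<Rightarrow> ('a \<Rightarrow> 'b) \<Rightarrow> bool" where
  "map_iso M M' \<theta> \<longleftrightarrow>
     bij_betw \<theta> (half_edges M) (half_edges M') \<and>
     (\<forall>h\<in>half_edges M.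
        \<theta> (map_sigma M h) = map_sigma M' (\<theta> h) \<and>
        \<theta> (map_alpha M h) = map_alpha M' (\<theta> h) \<and>
        \<theta> (map_phi M h) = map_phi M' (\<theta> h)) \<and>
     map \<theta> (roots M) = roots M' \<and>
     (`) ((`) \<theta>) ` cells M = cells M' \<and>
     (\<forall>f\<in>cells M. cell_genus M' ((`) \<theta> ` f) = cell_genus M f)"

definition map_iso_rel :: "('a stuffed_map \<times> 'a stuffed_map) set" where
  "map_iso_rel =
     {(M, M'). is_stuffed_map M \<and> is_stuffed_map M' \<and> (\<exists>\<theta>. map_iso M M' \<theta>)}"

text \<open>
  Requiring \<open>\<theta>\<close> to be the identity outside the half-edges makes automorphisms, as total
  functions, correspond one-to-one to bijections of the half-edges.
\<close>

definition automorphisms :: "('a, 'b) stuffed_map_scheme \<Rightarrow> ('a \<Rightarrow> 'a) set" where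
  "automorphisms M =
     {\<theta>. \<theta> permutes half_edges M \<and> map_iso M M \<theta> \<and>
         (\<forall>h\<in>boundary_half_edges M. \<theta> h = h)}"


section \<open>Generating series\<close>

text \<open>
  The variable \<open>t\<close> with upper index h and lower indices \<open>m\<^sub>1, \<dots>, m\<^sub>k\<close>, symmetric in the latter,
  is \<open>(h, {#m\<^sub>1, \<dots>, m\<^sub>k#})\<close>.  Pairs whose multiset is empty or contains 0 are additional
  variables that do not occur in the weight of any map.
\<close>

type_synonym weight_var = "nat \<times> nat multiset"

definition weight_monomial :: "('a, 'b) stuffed_map_scheme \<Rightarrow> weight_var multiset" where
  "weight_monomial M =
     image_mset (\<lambda>f. (cell_genus M f, image_mset card (mset_set f))) (mset_set (cells M))"

text \<open>
  Every finite map is isomorphic to one whose half-edges are natural numbers.  For connected maps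
  with prescribed boundary lengths, a monomial determines the number of half-edges (the sum of all
  lengths), so only finitely many isomorphism classes contribute to a coefficient.
\<close>

definition generating_series :: "nat stuffed_map set \<Rightarrow> (weight_var, rat) mpower_series" where
  "generating_series A =
     Abs_mpower_series (\<lambda>m.
       \<Sum>C \<in> {M \<in> A. weight_monomial M = m} // map_iso_rel.
         1 / of_nat (card (automorphisms (SOME M. M \<in> C))))"

definition ordinary_disk_series :: "map_kind \<Rightarrow> nat \<Rightarrow> (weight_var, rat) mpower_series" where
  "ordinary_disk_series \<kappa> l =
     generating_series {M. is_disk M \<and> of_kind \<kappa> M \<and> boundary_lengths M = [l]}"

definition fully_simple_disk_series :: "map_kind \<Rightarrow> nat \<Rightarrow> (weight_var, rat) mpower_series" where
  "fully_simple_disk_series \<kappa> l =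
     generating_series
       {M. is_disk M \<and> of_kind \<kappa> M \<and> boundary_lengths M = [l] \<and> fully_simple M}"

text \<open>W(x), as a power series in the indeterminate \<open>1/x\<close>.\<close>

definition W_series :: "map_kind \<Rightarrow> (weight_var, rat) mpower_series fps" where
  "W_series \<kappa> =
     fps_X + Abs_fps (\<lambda>n. if n \<ge> 2 then ordinary_disk_series \<kappa> (n - 1) else 0)"

text \<open>X(w), as a Laurent series in the indeterminate \<open>w\<close>.\<close>

definition X_series :: "map_kind \<Rightarrow> (weight_var, rat) mpower_series fls" where
  "X_series \<kappa> =
     fls_X_inv + fps_to_fls (Abs_fps (\<lambda>n. fully_simple_disk_series \<kappa> (n + 1)))"

end

theory Submission imports Defs begin

text \<open>
  Number the boundary half-edges of a disk from its root, and let \<open>D k l\<close> be the series of the disks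
  of boundary length \<open>l\<close> in which the boundary visits the vertices of its first \<open>k\<close> half-edges only
  once, so that \<open>D 0 l = F\<^sub>l\<close> and \<open>D l l = H\<^sub>l\<close>.  If the vertex of the next half-edge \<open>a\<close> is visited
  again, let \<open>b\<close> be its last visit.  Cutting there replaces \<open>\<phi>\<close> by \<open>\<phi> \<circ> (a b)\<close> and \<open>\<sigma>\<close> by
  \<open>(a b) \<circ> \<sigma>\<close>, which raises the Euler characteristic by 2; as that of a connected map is at most 2,
  the map falls apart into two disks.  This gives
  \<open>D k l = D (k + 1) l + (\<Sum>0 < i < l - k. F\<^sub>i * D (k + 1) (l - i))\<close>, that is,
  \<open>E\<^sub>k = H\<^sub>k + W * E\<^bsub>k+1\<^esub>\<close> for \<open>E\<^sub>k = (\<Sum>j. D k (k + j) / x\<^sup>j)\<close>.  Iterating from \<open>E\<^sub>0 = x * W\<close>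
  yields \<open>x * W = (\<Sum>k. H\<^sub>k * W\<^sup>k)\<close> with \<open>H\<^sub>0 = 1\<close>, which is \<open>X(W(x)) = x\<close> multiplied by \<open>W\<close>.
  The weights 1/|Aut| are handled by counting maps whose half-edges are a fixed finite set.
\<close>

section \<open>Permutations multiplied by a transposition\<close>

text \<open>Why the last visit: if \<open>b\<close> has index \<open>k + i\<close>, the cut sends
  \<open>a\<close> to the successor of \<open>b\<close>. The piece with the root keeps the indices
  up to \<open>k\<close> and those after \<open>k + i\<close>, so it has length \<open>l - i\<close>
  and meets the vertex of \<open>a\<close> only once. All intermediate visits fall to the other
  piece, which is therefore an arbitrary disk of length \<open>i\<close>, rooted at
  \<open>b\<close>. Conversely \<open>b\<close> can be read off the glued boundary as the last
  visit, which makes glueing injective. The term \<open>D (k + 1) l\<close> is the case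
  \<open>i = 0\<close>, an empty second piece; this matches the term 1/x of W. The bound on the
  Euler characteristic has to cover cells with any number of boundary cycles. Each cell
  \<open>f\<close> joins at most \<open>card f\<close> components of the graph given by \<sigma> and
  \<alpha>, and the 2 - |f| in its contribution pays for that. Nontrivial automorphisms do occur: a
  part attached only through a cell with several cycles may be symmetric. Labelled counts divided by
  n! absorb them and turn the splitting of the labels into a product. This needs n to be fixed by
  the boundary length and the monomial, and both to be additive under glueing.\<close>

lemma orbit_eq_orbit_iff:
  assumes "permutation p"
  shows "orbit p x = orbit p y \<longleftrightarrow> x \<in> orbit p y"
  using assms by (metis cyclic_on_orbit' orbit_cyclic_eq3 permutation_self_in_orbit)

lemma permutation_comp_transpose:
  assumes "permutation p"
  shows "permutation (p \<circ> Transposition.transpose a b)"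
  using assms by (simp add: permutation_compose permutation_swap_id)

text \<open>From \<open>a\<close> the new permutation jumps to \<open>p b\<close> and then follows
  the old cycle of \<open>b\<close>, which avoids \<open>a\<close>, until it reaches
  \<open>b\<close>.\<close>

lemma orbit_subset_comp_transpose:
  assumes p: "permutation p" and ab: "b \<notin> orbit p a"
  shows "orbit p b \<subseteq> orbit (p \<circ> Transposition.transpose a b) a"
proof
  fix x assume "x \<in> orbit p b"
  then show "x \<in> orbit (p \<circ> Transposition.transpose a b) a"
  proof (induction)
    case base
    show ?case by (metis comp_apply orbit.base transpose_apply_first)
  next
    case (step y)
    show ?case
    proof (cases "y = b")
      case True then show ?thesis
        by (metis comp_apply orbit.base transpose_apply_first)
    next
      case False
      have "y \<noteq> a" using step.hyps ab p by (metis orbit_eq_orbit_iff permutation_self_in_orbit)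
      then have "p y = (p \<circ> Transposition.transpose a b) y" using False by simp
      then show ?thesis using step.IH by (metis orbit.step)
    qed
  qed
qed

lemma orbit_comp_transpose_merge:
  assumes p: "permutation p" and ab: "b \<notin> orbit p a"
  shows "orbit (p \<circ> Transposition.transpose a b) a = orbit p a \<union> orbit p b" (is "orbit ?q a = _")
proof
  have q: "permutation ?q" by (rule permutation_comp_transpose[OF p])
  have b: "orbit p b \<subseteq> orbit ?q a" by (rule orbit_subset_comp_transpose[OF assms])
  then have "b \<in> orbit ?q a" using permutation_self_in_orbit[OF p] by blast
  then have eq: "orbit ?q a = orbit ?q b" using orbit_eq_orbit_iff[OF q] by metis
  have "a \<notin> orbit p b" using ab p by (metis orbit_eq_orbit_iff permutation_self_in_orbit)
  then have "orbit p a \<subseteq> orbit ?q b"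
    using orbit_subset_comp_transpose[OF p, of a b] by (simp add: transpose_commute)
  with b eq show "orbit p a \<union> orbit p b \<subseteq> orbit ?q a" by simp
  show "orbit ?q a \<subseteq> orbit p a \<union> orbit p b"
  proof
    fix x assume "x \<in> orbit ?q a"
    then show "x \<in> orbit p a \<union> orbit p b"
      by induction (auto simp: Transposition.transpose_def intro: orbit.intros)
  qed
qed

lemma orbit_comp_transpose_other:
  assumes p: "permutation p" and "a \<notin> orbit p x" "b \<notin> orbit p x"
  shows "orbit (p \<circ> Transposition.transpose a b) x = orbit p x"
  using assms(2,3)
  by (intro orbit_cong permutation_self_in_orbit[OF p])
     (auto simp: Transposition.transpose_def)

text \<open>The new cycle of \<open>a\<close> stays in the arc \<open>T\<close> of the old cycle
  that starts just after \<open>b\<close> and ends at the return to \<open>a\<close>; this arc does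
  not contain \<open>b\<close>.\<close>

lemma orbit_comp_transpose_split:
  assumes p: "permutation p" and ab: "a \<noteq> b" "b \<in> orbit p a"
  shows "b \<notin> orbit (p \<circ> Transposition.transpose a b) a"
proof -
  let ?q = "p \<circ> Transposition.transpose a b"
  define n where "n = funpow_dist1 p a b"
  define N where "N = funpow_dist1 p a a"
  have n: "(p ^^ n) a = b" "0 < n" using funpow_dist1_prop[OF ab(2)] by (auto simp: n_def)
  have N: "(p ^^ N) a = a" "0 < N"
    using funpow_dist1_prop[OF permutation_self_in_orbit[OF p]] by (auto simp: N_def)
  have inj: "inj_on (\<lambda>n. (p ^^ n) a) {0..<N}"
    unfolding N_def by (rule inj_on_funpow_dist1[OF permutation_self_in_orbit[OF p]])
  have "b \<in> (\<lambda>n. (p ^^ n) a) ` {0..<N}"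
    using ab(2) orbit_conv_funpow_dist1[OF permutation_self_in_orbit[OF p], of a] by (simp add: N_def)
  then obtain m where m: "m < N" "(p ^^ m) a = b" by auto
  with ab(1) have m0: "m > 0" by (cases m) auto
  define T where "T = (\<lambda>j. (p ^^ j) a) ` {m<..N}"
  have bT: "b \<notin> T"
  proof
    assume "b \<in> T"
    then obtain j where j: "m < j" "j \<le> N" "(p ^^ j) a = b" by (auto simp: T_def)
    with N ab(1) have "j < N" by (metis le_neq_implies_less)
    with inj j m show False by (auto dest!: inj_onD[where x = j and y = m])
  qed
  have aT: "a \<in> T" using N(1) m(1) unfolding T_def by (intro image_eqI[where x = N]) auto
  have "x \<in> T" if "x \<in> orbit ?q a" for x using that
  proof induction
    case base
    have "?q a = (p ^^ Suc m) a" using m by simp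
    then show ?case using m(1) unfolding T_def by (intro image_eqI[where x = "Suc m"]) auto
  next
    case (step y)
    show ?case
    proof (cases "y = a")
      case True
      have "?q a = (p ^^ Suc m) a" using m by simp
      then show ?thesis using m(1) True unfolding T_def by (intro image_eqI[where x = "Suc m"]) auto
    next
      case False
      then obtain j where j: "m < j" "j \<le> N" "y = (p ^^ j) a" using step.IH by (auto simp: T_def)
      with False N have "j < N" by (metis le_neq_implies_less)
      have "y \<noteq> b" using bT step.IH by blast
      with False j have "?q y = (p ^^ Suc j) a" by simp
      then show ?thesis using \<open>j < N\<close> j(1) unfolding T_def by (intro image_eqI[where x = "Suc j"]) auto
    qed
  qed
  with bT show ?thesis by blast
qed

lemma comp_transpose_twice: "p \<circ> Transposition.transpose a b \<circ> Transposition.transpose a b = p"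
  by (simp add: fun_eq_iff)

lemma transpose_comp_twice: "Transposition.transpose a b \<circ> (Transposition.transpose a b \<circ> p) = p"
  by (simp add: fun_eq_iff)

lemma cycles_of_comp_transpose_merge:
  assumes "p permutes H" "finite H" "a \<in> H" "b \<in> H" "b \<notin> orbit p a"
  shows "cycles_of (p \<circ> Transposition.transpose a b) H =
           insert (orbit p a \<union> orbit p b) (cycles_of p H - {orbit p a, orbit p b})"
proof -
  let ?q = "p \<circ> Transposition.transpose a b"
  have p: "permutation p" using assms by (auto simp: permutation_permutes)
  note q = permutation_comp_transpose[OF p, of a b]
  have a: "orbit ?q a = orbit p a \<union> orbit p b" by (rule orbit_comp_transpose_merge[OF p assms(5)])
  have in_a: "orbit ?q x = orbit p a \<union> orbit p b" if "x \<in> orbit p a \<union> orbit p b" for x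
    using that a orbit_eq_orbit_iff[OF q] by metis
  have other: "orbit ?q x = orbit p x" if "x \<notin> orbit p a \<union> orbit p b" for x
    using that orbit_eq_orbit_iff[OF p] permutation_self_in_orbit[OF p]
    by (intro orbit_comp_transpose_other[OF p]) (metis UnCI)+
  show ?thesis
  proof (intro set_eqI iffI)
    fix C assume "C \<in> cycles_of ?q H"
    then obtain x where x: "x \<in> H" "C = orbit ?q x" by (auto simp: cycles_of_def)
    show "C \<in> insert (orbit p a \<union> orbit p b) (cycles_of p H - {orbit p a, orbit p b})"
    proof (cases "x \<in> orbit p a \<union> orbit p b")
      case False
      then have "orbit p x \<noteq> orbit p a" "orbit p x \<noteq> orbit p b"
        using permutation_self_in_orbit[OF p] by blast+
      then show ?thesis using x other[OF False] by (auto simp: cycles_of_def)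
    qed (use in_a x in auto)
  next
    fix C assume "C \<in> insert (orbit p a \<union> orbit p b) (cycles_of p H - {orbit p a, orbit p b})"
    then consider "C = orbit p a \<union> orbit p b" | x where "x \<in> H" "C = orbit p x" "C \<noteq> orbit p a" "C \<noteq> orbit p b"
      by (auto simp: cycles_of_def)
    then show "C \<in> cycles_of ?q H"
    proof cases
      case 1
      then show ?thesis using a assms(3) by (auto simp: cycles_of_def)
    next
      case 2
      then have "x \<notin> orbit p a \<union> orbit p b" using orbit_eq_orbit_iff[OF p] by auto
      from other[OF this] 2 show ?thesis by (auto simp: cycles_of_def)
    qed
  qed
qed

lemma finite_cycles_of: "finite H \<Longrightarrow> finite (cycles_of p H)"
  by (simp add: cycles_of_def)

lemma partition_on_cycles_of:
  assumes "p permutes H" "finite H"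
  shows "partition_on H (cycles_of p H)"
proof (rule partition_onI)
  have p: "permutation p" using assms by (auto simp: permutation_permutes)
  show "\<Union> (cycles_of p H) = H"
    using permutes_orbit_subset[OF assms(1)] permutation_self_in_orbit[OF p]
    by (fastforce simp: cycles_of_def)
  show "disjnt C D" if CD: "C \<in> cycles_of p H" "D \<in> cycles_of p H" "C \<noteq> D" for C D
  proof -
    obtain x y where xy: "C = orbit p x" "D = orbit p y" using CD by (auto simp: cycles_of_def)
    have "orbit p z = C" "orbit p z = D" if "z \<in> C" "z \<in> D" for z
      using that orbit_eq_orbit_iff[OF p] unfolding xy by blast+
    then show ?thesis using CD(3) by (auto simp: disjnt_def)
  qed
  show "{} \<notin> cycles_of p H"
    using orbit_nonempty[of p] by (auto simp: cycles_of_def)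
qed

lemma card_cycles_of_comp_transpose_merge:
  assumes "p permutes H" "finite H" "a \<in> H" "b \<in> H" "b \<notin> orbit p a"
  shows "card (cycles_of (p \<circ> Transposition.transpose a b) H) + 1 = card (cycles_of p H)"
proof -
  have p: "permutation p" using assms by (auto simp: permutation_permutes)
  have ne: "orbit p a \<noteq> orbit p b" using assms(5) permutation_self_in_orbit[OF p] by blast
  have mem: "{orbit p a, orbit p b} \<subseteq> cycles_of p H" using assms by (auto simp: cycles_of_def)
  have notin: "orbit p a \<union> orbit p b \<notin> cycles_of p H"
  proof
    assume *: "orbit p a \<union> orbit p b \<in> cycles_of p H"
    then obtain x where x: "orbit p a \<union> orbit p b = orbit p x" by (auto simp: cycles_of_def)
    then have "a \<in> orbit p x" "b \<in> orbit p x" using permutation_self_in_orbit[OF p] by blast+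
    then show False using ne orbit_eq_orbit_iff[OF p] by metis
  qed
  have "card {orbit p a, orbit p b} \<le> card (cycles_of p H)"
    using mem finite_cycles_of[OF assms(2)] by (rule card_mono[rotated])
  then have "2 \<le> card (cycles_of p H)" using ne by simp
  moreover have "card (cycles_of p H - {orbit p a, orbit p b}) = card (cycles_of p H) - 2"
    using mem ne by (subst card_Diff_subset) auto
  ultimately show ?thesis
    unfolding cycles_of_comp_transpose_merge[OF assms]
    using notin by (subst card_insert_disjoint) (auto simp: finite_cycles_of assms)
qed

lemma permutes_comp_transpose:
  assumes "p permutes H" "a \<in> H" "b \<in> H"
  shows "p \<circ> Transposition.transpose a b permutes H"
  using assms by (intro permutes_compose permutes_swap_id)

text \<open>The merging count read backwards: a second multiplication by the same transposition
  restores \<open>p\<close>.\<close>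

lemma card_cycles_of_comp_transpose_split:
  assumes "p permutes H" "finite H" "a \<in> H" "b \<in> H" "a \<noteq> b" "b \<in> orbit p a"
  shows "card (cycles_of (p \<circ> Transposition.transpose a b) H) = card (cycles_of p H) + 1"
proof -
  let ?q = "p \<circ> Transposition.transpose a b"
  have p: "permutation p" using assms by (auto simp: permutation_permutes)
  have "b \<notin> orbit ?q a" by (rule orbit_comp_transpose_split[OF p assms(5,6)])
  from card_cycles_of_comp_transpose_merge[OF permutes_comp_transpose[OF assms(1,3,4)] assms(2-4) this]
  show ?thesis by (simp add: comp_transpose_twice)
qed

lemma cycles_of_inv:
  assumes "p permutes H" "finite H"
  shows "cycles_of (inv p) H = cycles_of p H"
proof -
  have "permutation p" using assms by (auto simp: permutation_permutes)
  then show ?thesis by (simp add: cycles_of_def orbit_inv_eq)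
qed

text \<open>A permutation and its inverse have the same cycles, and inversion moves the
  transposition from the left to the right. This carries the results on \<phi>, which is multiplied
  on the right, over to \<sigma>, which is multiplied on the left.\<close>

lemma orbit_transpose_comp:
  assumes "permutation p"
  shows "orbit (Transposition.transpose a b \<circ> p) x = orbit (inv p \<circ> Transposition.transpose a b) x"
proof -
  have "bij p" using assms by (rule permutation_bijective)
  then have eq: "inv (inv p \<circ> Transposition.transpose a b) = Transposition.transpose a b \<circ> p"
    by (subst o_inv_distrib) (auto simp: bij_imp_bij_inv inv_inv_eq)
  have "permutation (inv p \<circ> Transposition.transpose a b)"
    using assms by (intro permutation_comp_transpose permutation_inverse)
  from orbit_inv_eq[OF this] show ?thesis by (simp add: eq)
qed

lemma orbit_transpose_comp_merge:
  assumes "permutation p" "b \<notin> orbit p a"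
  shows "orbit (Transposition.transpose a b \<circ> p) a = orbit p a \<union> orbit p b"
  using assms orbit_comp_transpose_merge[OF permutation_inverse[OF assms(1)], of b a]
  by (simp add: orbit_transpose_comp orbit_inv_eq)

lemma orbit_transpose_comp_other:
  assumes "permutation p" "a \<notin> orbit p x" "b \<notin> orbit p x"
  shows "orbit (Transposition.transpose a b \<circ> p) x = orbit p x"
  using assms orbit_comp_transpose_other[OF permutation_inverse[OF assms(1)], of a x b]
  by (simp add: orbit_transpose_comp orbit_inv_eq)

lemma orbit_transpose_comp_split:
  assumes "permutation p" "a \<noteq> b" "b \<in> orbit p a"
  shows "b \<notin> orbit (Transposition.transpose a b \<circ> p) a"
  using assms orbit_comp_transpose_split[OF permutation_inverse[OF assms(1)], of a b]
  by (simp add: orbit_transpose_comp orbit_inv_eq)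

lemma permutes_transpose_comp:
  assumes "p permutes H" "a \<in> H" "b \<in> H"
  shows "Transposition.transpose a b \<circ> p permutes H"
  using assms by (intro permutes_compose permutes_swap_id)

lemma card_cycles_of_transpose_comp_merge:
  assumes "p permutes H" "finite H" "a \<in> H" "b \<in> H" "b \<notin> orbit p a"
  shows "card (cycles_of (Transposition.transpose a b \<circ> p) H) + 1 = card (cycles_of p H)"
proof -
  have p: "permutation p" using assms by (auto simp: permutation_permutes)
  have "cycles_of (Transposition.transpose a b \<circ> p) H = cycles_of (inv p \<circ> Transposition.transpose a b) H"
    by (simp add: cycles_of_def orbit_transpose_comp[OF p])
  moreover have "b \<notin> orbit (inv p) a" using assms(5) by (simp add: orbit_inv_eq[OF p])
  ultimately show ?thesis
    using card_cycles_of_comp_transpose_merge[OF permutes_inv[OF assms(1)] assms(2-4)] cycles_of_inv[OF assms(1,2)]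
    by simp
qed

section \<open>The Euler characteristic\<close>

lemma partition_on_eqI:
  assumes "partition_on H P" "A \<in> P" "B \<in> P" "x \<in> A" "x \<in> B"
  shows "A = B"
  using assms disjointD[OF partition_onD2] by fastforce

lemma partition_on_merge:
  assumes "partition_on H P" "Q \<subseteq> P" "Q \<noteq> {}"
  shows "partition_on H (insert (\<Union>Q) (P - Q))"
proof (rule partition_onI)
  show "\<Union> (insert (\<Union> Q) (P - Q)) = H"
    using assms by (auto simp: partition_on_def)
  show "disjnt A B" if AB: "A \<in> insert (\<Union> Q) (P - Q)" "B \<in> insert (\<Union> Q) (P - Q)" "A \<noteq> B" for A B
  proof -
    have d: "C \<inter> D = {}" if "C \<in> P" "D \<in> P" "C \<noteq> D" for C D
      using assms that by (auto simp: partition_on_def disjoint_def)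
    have d': "\<Union>Q \<inter> C = {}" if "C \<in> P - Q" for C
      using d that assms(2) by blast
    from AB consider "A = \<Union>Q" "B \<in> P - Q" | "B = \<Union>Q" "A \<in> P - Q" | "A \<in> P" "B \<in> P" by auto
    then show ?thesis
    proof cases
      case 1 then show ?thesis using d'[of B] by (auto simp: disjnt_def)
    next
      case 2 then show ?thesis using d'[of A] by (auto simp: disjnt_def)
    next
      case 3 then show ?thesis using d[of A B] AB by (auto simp: disjnt_def)
    qed
  qed
  show "{} \<notin> insert (\<Union> Q) (P - Q)"
    using assms by (auto simp: partition_on_def) (metis Union_empty_conv subsetD subsetI subset_singletonD)
qed

lemma card_partition_merge:
  assumes "partition_on H P" "finite P" "Q \<subseteq> P" "Q \<noteq> {}"
  shows "card (insert (\<Union>Q) (P - Q)) + card Q = card P + 1"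
proof -
  have "\<Union>Q \<notin> P - Q"
  proof
    assume *: "\<Union>Q \<in> P - Q"
    obtain B where B: "B \<in> Q" using assms by blast
    then have "B \<inter> \<Union>Q = B" "B \<noteq> {}" using assms by (auto simp: partition_on_def)
    moreover have "B \<inter> \<Union>Q = {}"
      using * B assms by (intro disjointD[of P]) (auto simp: partition_on_def)
    ultimately show False by simp
  qed
  moreover have "card (P - Q) = card P - card Q" "card Q \<le> card P"
    using assms by (auto intro: card_Diff_subset card_mono finite_subset)
  ultimately show ?thesis using assms by (subst card_insert_disjoint) auto
qed

text \<open>
  The genus of a hypermap is nonnegative: \<open>\<alpha>\<close> is reduced to the identity by removing one of its
  moved points at a time, which multiplies both \<open>\<alpha>\<close> and \<open>\<sigma> \<circ> \<alpha>\<close> by a transposition.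
\<close>

lemma hypermap_euler_inequality:
  assumes s: "\<sigma> permutes H" and fin: "finite H" and "\<alpha> permutes H"
  shows "\<exists>P. partition_on H P \<and> (\<forall>B\<in>P. \<sigma> ` B \<subseteq> B \<and> \<alpha> ` B \<subseteq> B) \<and>
    card (cycles_of \<sigma> H) + card (cycles_of \<alpha> H) + card (cycles_of (\<sigma> \<circ> \<alpha>) H) \<le> card H + 2 * card P"
  using assms(3)
proof (induction "card {x \<in> H. \<alpha> x \<noteq> x}" arbitrary: \<alpha> rule: less_induct)
  case less
  have psig: "permutation \<sigma>" using s fin by (auto simp: permutation_permutes)
  show ?case
  proof (cases "\<exists>b\<in>H. \<alpha> b \<noteq> b")
    case False
    then have id: "\<alpha> = id" using less.prems by (auto simp: permutes_def fun_eq_iff)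
    have "orbit id x = {x}" for x :: 'a by (simp add: orbit_eq_singleton_iff)
    then have "card (cycles_of id H) = card H"
      by (simp add: cycles_of_def card_image)
    moreover have "\<sigma> ` B \<subseteq> B" if "B \<in> cycles_of \<sigma> H" for B
      using that by (auto simp: cycles_of_def intro: orbit.step)
    \<comment> \<open>For the identity the cycles of \<sigma> themselves serve as blocks, and the
      inequality is an equality.\<close>
    ultimately show ?thesis
      using partition_on_cycles_of[OF s fin] unfolding id
      by (intro exI[of _ "cycles_of \<sigma> H"]) auto
  next
    case True
    then obtain b where b: "b \<in> H" "\<alpha> b \<noteq> b" by blast
    \<comment> \<open>With this choice the product \<alpha>' fixes \<open>a\<close> and every point
      that \<alpha> fixes, so fewer points are moved.\<close>
    define a where "a = \<alpha> b"
    have a: "a \<in> H" "a \<noteq> b" using b less.prems by (auto simp: a_def permutes_in_image)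
    have pal: "permutation \<alpha>" using less.prems fin by (auto simp: permutation_permutes)
    let ?t = "Transposition.transpose a b"
    define \<alpha>' where "\<alpha>' = \<alpha> \<circ> ?t"
    have al: "\<alpha> = \<alpha>' \<circ> ?t" by (simp add: \<alpha>'_def comp_transpose_twice)
    have al': "\<alpha>' permutes H"
      unfolding \<alpha>'_def using less.prems a(1) b(1) by (rule permutes_comp_transpose)
    have fixa: "\<alpha>' a = a" by (simp add: \<alpha>'_def a_def)
    have "\<alpha> a \<noteq> a" using a(2) pal unfolding a_def
      by (metis bij_pointE permutation_bijective)
    have fx: "\<alpha>' x = x" if "\<alpha> x = x" for x
      using that b(2) \<open>\<alpha> a \<noteq> a\<close> by (auto simp: \<alpha>'_def Transposition.transpose_def)
    have "{x \<in> H. \<alpha>' x \<noteq> x} \<subset> {x \<in> H. \<alpha> x \<noteq> x}"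
      using fx fixa a \<open>\<alpha> a \<noteq> a\<close> by blast
    then have "card {x \<in> H. \<alpha>' x \<noteq> x} < card {x \<in> H. \<alpha> x \<noteq> x}"
      using fin by (intro psubset_card_mono) auto
    from less.hyps[OF this al'] obtain P where "partition_on H P \<and> (\<forall>B\<in>P. \<sigma> ` B \<subseteq> B \<and> \<alpha>' ` B \<subseteq> B) \<and>
      card (cycles_of \<sigma> H) + card (cycles_of \<alpha>' H) + card (cycles_of (\<sigma> \<circ> \<alpha>') H) \<le> card H + 2 * card P"
      by (rule exE)
    then have P: "partition_on H P"
      "\<And>B. B \<in> P \<Longrightarrow> \<sigma> ` B \<subseteq> B" "\<And>B. B \<in> P \<Longrightarrow> \<alpha>' ` B \<subseteq> B"
      "card (cycles_of \<sigma> H) + card (cycles_of \<alpha>' H) + card (cycles_of (\<sigma> \<circ> \<alpha>') H) \<le> card H + 2 * card P"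
      by auto
    have "a \<in> orbit \<alpha> b" unfolding a_def by (rule orbit.base)
    then have "b \<in> orbit \<alpha> a"
      using orbit_eq_orbit_iff[OF pal, of a b] permutation_self_in_orbit[OF pal, of b] by blast
    then have ca: "card (cycles_of \<alpha>' H) = card (cycles_of \<alpha> H) + 1"
      unfolding \<alpha>'_def using card_cycles_of_comp_transpose_split[OF less.prems fin a(1) b(1) a(2)] by simp
    define \<phi> where "\<phi> = \<sigma> \<circ> \<alpha>'"
    have ph: "\<phi> permutes H" unfolding \<phi>_def by (rule permutes_compose[OF al' s])
    have pph: "permutation \<phi>" using ph fin by (auto simp: permutation_permutes)
    have sa: "\<sigma> \<circ> \<alpha> = \<phi> \<circ> ?t" by (simp add: al \<phi>_def comp_assoc)
    obtain A B where AB: "A \<in> P" "B \<in> P" "a \<in> A" "b \<in> B"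
      using P(1) a(1) b(1) by (auto simp: partition_on_def)
    show ?thesis
    proof (cases "A = B")
      case True
      \<comment> \<open>Within one block the partition can stay: \<alpha> has one cycle less than
        \<alpha>', and this pays for the at most one cycle gained by the product.\<close>
      have "card (cycles_of (\<phi> \<circ> ?t) H) \<le> card (cycles_of \<phi> H) + 1"
        using card_cycles_of_comp_transpose_split[OF ph fin a(1) b(1) a(2)]
          card_cycles_of_comp_transpose_merge[OF ph fin a(1) b(1)]
        by (cases "b \<in> orbit \<phi> a") auto
      moreover have "\<alpha> ` C \<subseteq> C" if C: "C \<in> P" for C
      proof -
        have "a \<in> C \<longleftrightarrow> b \<in> C"
          using True AB C partition_on_eqI[OF P(1)] by metis
        then have "?t ` C \<subseteq> C" by (auto simp: Transposition.transpose_def)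
        then show ?thesis using P(3)[OF C] unfolding al by fastforce
      qed
      ultimately show ?thesis
        using P ca unfolding sa \<phi>_def by (intro exI[of _ P]) auto
    next
      case False
      \<comment> \<open>Blocks are unions of cycles of \<phi>, so here the transposition merges two
        of them. The left-hand side drops by 2, once for \<alpha> and once for the product, and
        uniting \<open>A\<close> with \<open>B\<close> lowers the right-hand side by the same
        amount.\<close>
      have "x \<in> A" if "x \<in> orbit \<phi> a" for x
        using that by induction (use P(2,3)[OF AB(1)] AB(3) in \<open>auto simp: \<phi>_def\<close>)
      moreover have "b \<notin> A" using False AB partition_on_eqI[OF P(1)] by metis
      ultimately have "b \<notin> orbit \<phi> a" by blast
      from card_cycles_of_comp_transpose_merge[OF ph fin a(1) b(1) this]
      have cphi: "card (cycles_of (\<phi> \<circ> ?t) H) + 1 = card (cycles_of \<phi> H)" .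
      define P' where "P' = insert (\<Union>{A, B}) (P - {A, B})"
      have P': "partition_on H P'"
        unfolding P'_def using P(1) AB by (intro partition_on_merge) auto
      have finP: "finite P" using P(1) fin by (rule finite_elements[rotated])
      have cP: "card P' + 1 = card P"
        using card_partition_merge[OF P(1) finP, of "{A, B}"] AB False by (simp add: P'_def)
      have "\<sigma> ` C \<subseteq> C \<and> \<alpha> ` C \<subseteq> C" if C: "C \<in> P'" for C
      proof -
        have 1: "\<sigma> ` C \<subseteq> C" "\<alpha>' ` C \<subseteq> C"
        proof -
          have "C = A \<union> B \<or> C \<in> P" using C by (auto simp: P'_def)
          moreover have "\<sigma> x \<in> B'" "\<alpha>' x \<in> B'" if "B' \<in> P" "x \<in> B'" for x B'
            using P(2,3)[OF that(1)] that(2) by blast+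
          ultimately show "\<sigma> ` C \<subseteq> C" "\<alpha>' ` C \<subseteq> C"
            using AB(1,2) by auto
        qed
        have "a \<in> C \<longleftrightarrow> b \<in> C"
          using AB C partition_on_eqI[OF P(1) _ AB(1) _ AB(3), of C] partition_on_eqI[OF P(1) _ AB(2) _ AB(4), of C]
          unfolding P'_def by auto
        then have "?t ` C \<subseteq> C" by (auto simp: Transposition.transpose_def)
        then have "\<alpha>' (?t x) \<in> C" if "x \<in> C" for x using that 1(2) by blast
        with 1 show ?thesis by (auto simp: al)
      qed
      then show ?thesis
        using P' P(4) ca cphi cP unfolding sa \<phi>_def[symmetric] by (intro exI[of _ P'] conjI) (blast, blast, linarith)
    qed
  qed
qed

section \<open>Components of a stuffed map and the bound on its Euler characteristic\<close>

lemma is_stuffed_mapD: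
  assumes "is_stuffed_map M"
  shows "finite (half_edges M)" "map_sigma M permutes half_edges M" "map_alpha M permutes half_edges M"
    "map_phi M permutes half_edges M" "map_sigma M \<circ> map_alpha M \<circ> map_phi M = id"
    "\<And>h. h \<in> half_edges M \<Longrightarrow> map_alpha M (map_alpha M h) = h"
    "\<And>h. h \<in> half_edges M \<Longrightarrow> map_alpha M h \<noteq> h"
    "roots M \<noteq> []" "set (roots M) \<subseteq> half_edges M" "distinct (boundaries M)"
    "partition_on (cycles_of (map_phi M) (half_edges M) - set (boundaries M)) (cells M)"
    "permutation (map_sigma M)" "permutation (map_alpha M)" "permutation (map_phi M)"
  using assms by (auto simp: is_stuffed_map_def permutation_permutes)

lemma cells_subset:
  assumes "is_stuffed_map M" "f \<in> cells M"
  shows "f \<subseteq> cycles_of (map_phi M) (half_edges M)" "\<Union>f \<subseteq> half_edges M" "f \<noteq> {}" "finite f" "\<Union>f \<noteq> {}"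
proof -
  note M = is_stuffed_mapD[OF assms(1)]
  show f: "f \<subseteq> cycles_of (map_phi M) (half_edges M)" "f \<noteq> {}"
    using M(11) assms(2) by (auto simp: partition_on_def)
  then show "finite f" using finite_cycles_of[OF M(1)] finite_subset by blast
  have "\<Union>(cycles_of (map_phi M) (half_edges M)) = half_edges M"
    using partition_on_cycles_of[OF M(4,1)] by (simp add: partition_on_def)
  then show "\<Union>f \<subseteq> half_edges M" using f(1) by blast
  have "{} \<notin> cycles_of (map_phi M) (half_edges M)"
    using partition_on_cycles_of[OF M(4,1)] by (simp add: partition_on_def)
  moreover obtain c where "c \<in> f" "c \<in> cycles_of (map_phi M) (half_edges M)" using f by blast
  ultimately show "\<Union>f \<noteq> {}" by (metis Union_upper subset_empty)
qed

lemma finite_cells: "is_stuffed_map M \<Longrightarrow> finite (cells M)"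
  using is_stuffed_mapD(1,11) finite_elements finite_cycles_of finite_Diff by metis

text \<open>These are the unions of connected components. Closure under \<phi> and under inverses
  follows: a permutation mapping a finite set into itself maps it onto itself, and \<phi> is the
  inverse of \<sigma> \<circ> \<alpha>.\<close>

definition closed_in :: "('a, 'b) stuffed_map_scheme \<Rightarrow> 'a set \<Rightarrow> bool" where
  "closed_in M K \<longleftrightarrow> K \<subseteq> half_edges M \<and> (\<forall>x\<in>K. map_sigma M x \<in> K \<and> map_alpha M x \<in> K) \<and>
     (\<forall>f\<in>cells M. \<Union>f \<inter> K \<noteq> {} \<longrightarrow> \<Union>f \<subseteq> K)"

lemma permutes_closed_iff:
  assumes "p permutes H" "finite H" "K \<subseteq> H" "\<And>x. x \<in> K \<Longrightarrow> p x \<in> K"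
  shows "p x \<in> K \<longleftrightarrow> x \<in> K"
proof
  assume px: "p x \<in> K"
  have inj: "inj p" using assms(1) by (rule permutes_inj)
  have "p ` K = K"
    using assms(2-4) by (intro endo_inj_surj inj_on_subset[OF inj]) (auto intro: finite_subset)
  then obtain y where "y \<in> K" "p y = p x" using px by (metis imageE)
  then show "x \<in> K" using inj by (auto dest: injD)
qed (rule assms(4))

lemma closed_inD:
  assumes "closed_in M K"
  shows "K \<subseteq> half_edges M" "\<And>x. x \<in> K \<Longrightarrow> map_sigma M x \<in> K" "\<And>x. x \<in> K \<Longrightarrow> map_alpha M x \<in> K"
    "\<And>f x y. f \<in> cells M \<Longrightarrow> x \<in> \<Union>f \<Longrightarrow> x \<in> K \<Longrightarrow> y \<in> \<Union>f \<Longrightarrow> y \<in> K"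
proof -
  show "K \<subseteq> half_edges M" "\<And>x. x \<in> K \<Longrightarrow> map_sigma M x \<in> K" "\<And>x. x \<in> K \<Longrightarrow> map_alpha M x \<in> K"
    using assms by (auto simp: closed_in_def)
  fix f x y assume *: "f \<in> cells M" "x \<in> \<Union>f" "x \<in> K" "y \<in> \<Union>f"
  from *(2,3) have "\<Union>f \<inter> K \<noteq> {}" by blast
  with *(1) assms have "\<Union>f \<subseteq> K" by (simp add: closed_in_def)
  with *(4) show "y \<in> K" by (rule subsetD[rotated])
qed

lemma closed_inI:
  assumes "K \<subseteq> half_edges M" "\<And>x. x \<in> K \<Longrightarrow> map_sigma M x \<in> K" "\<And>x. x \<in> K \<Longrightarrow> map_alpha M x \<in> K"
    "\<And>f x y. f \<in> cells M \<Longrightarrow> x \<in> \<Union>f \<Longrightarrow> x \<in> K \<Longrightarrow> y \<in> \<Union>f \<Longrightarrow> y \<in> K"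
  shows "closed_in M K"
  unfolding closed_in_def
proof (intro conjI ballI impI subsetI)
  fix f y assume f: "f \<in> cells M" "\<Union>f \<inter> K \<noteq> {}" "y \<in> \<Union>f"
  then obtain x where "x \<in> \<Union>f" "x \<in> K" by blast
  with f show "y \<in> K" using assms(4) by metis
qed (use assms(1-3) in blast)+

lemma closed_in_iff:
  assumes "is_stuffed_map M" "closed_in M K"
  shows "map_sigma M x \<in> K \<longleftrightarrow> x \<in> K" "map_alpha M x \<in> K \<longleftrightarrow> x \<in> K" "map_phi M x \<in> K \<longleftrightarrow> x \<in> K"
proof -
  note M = is_stuffed_mapD[OF assms(1)] and K = closed_inD[OF assms(2)]
  have s: "map_sigma M x \<in> K \<longleftrightarrow> x \<in> K" for x
    by (rule permutes_closed_iff[OF M(2,1) K(1,2)])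
  have a: "map_alpha M x \<in> K \<longleftrightarrow> x \<in> K" for x
    by (rule permutes_closed_iff[OF M(3,1) K(1,3)])
  show "map_sigma M x \<in> K \<longleftrightarrow> x \<in> K" "map_alpha M x \<in> K \<longleftrightarrow> x \<in> K" by (rule s, rule a)
  have "map_phi M x \<in> K \<longleftrightarrow> map_sigma M (map_alpha M (map_phi M x)) \<in> K" by (simp only: s a)
  also have "map_sigma M (map_alpha M (map_phi M x)) = x" using M(5) by (simp add: fun_eq_iff)
  finally show "map_phi M x \<in> K \<longleftrightarrow> x \<in> K" .
qed

lemma closed_in_Diff:
  assumes "is_stuffed_map M" "closed_in M K" "closed_in M K'"
  shows "closed_in M (K - K')"
proof (rule closed_inI)
  show "K - K' \<subseteq> half_edges M" using closed_inD(1)[OF assms(2)] by blast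
  show "y \<in> K - K'" if "f \<in> cells M" "x \<in> \<Union>f" "x \<in> K - K'" "y \<in> \<Union>f" for f x y
    using closed_inD(4)[OF assms(2), of f x y] closed_inD(4)[OF assms(3), of f y x] that by (metis Diff_iff)
qed (simp_all add: closed_in_iff[OF assms(1,2)] closed_in_iff[OF assms(1,3)])

lemma closed_in_half_edges:
  assumes "is_stuffed_map M"
  shows "closed_in M (half_edges M)"
  using is_stuffed_mapD(2,3)[OF assms] cells_subset(2)[OF assms]
  by (intro closed_inI) (auto simp: permutes_in_image)

lemma closed_in_Int:
  assumes "closed_in M K" "closed_in M K'"
  shows "closed_in M (K \<inter> K')"
proof (rule closed_inI)
  show "y \<in> K \<inter> K'" if "f \<in> cells M" "x \<in> \<Union>f" "x \<in> K \<inter> K'" "y \<in> \<Union>f" for f x y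
    using closed_inD(4)[OF assms(1), of f x y] closed_inD(4)[OF assms(2), of f x y] that by (metis Int_iff)
qed (use closed_inD(1-3)[OF assms(1)] closed_inD(1-3)[OF assms(2)] in auto)

text \<open>The class of a half-edge under the generated equivalence is closed, and a closed set is
  a union of classes. From here on connectedness is used only in this form.\<close>

lemma connected_map_iff:
  assumes "is_stuffed_map M"
  shows "connected_map M \<longleftrightarrow> half_edges M \<noteq> {} \<and> (\<forall>K. closed_in M K \<and> K \<noteq> {} \<longrightarrow> K = half_edges M)"
proof (intro iffI conjI allI impI)
  assume c: "connected_map M"
  then show "half_edges M \<noteq> {}" by (simp add: connected_map_def)
  fix K assume K: "closed_in M K \<and> K \<noteq> {}"
  have adj: "y \<in> K \<longleftrightarrow> x \<in> K" if "adjacent M x y" for x y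
    using that K closed_in_iff[OF assms, of K] closed_inD(4)[of M K] unfolding adjacent_def by metis
  have "y \<in> K \<longleftrightarrow> x \<in> K" if "equivclp (adjacent M) x y" for x y
    using that by (induction rule: equivclp_induct) (use adj in blast)+
  then show "K = half_edges M" using c K closed_inD(1)[of M K] unfolding connected_map_def by blast
next
  assume *: "half_edges M \<noteq> {} \<and> (\<forall>K. closed_in M K \<and> K \<noteq> {} \<longrightarrow> K = half_edges M)"
  show "connected_map M" unfolding connected_map_def
  proof (intro conjI ballI)
    show "half_edges M \<noteq> {}" using * by simp
    fix h h' assume h: "h \<in> half_edges M" "h' \<in> half_edges M"
    define K where "K = {x \<in> half_edges M. equivclp (adjacent M) h x}"
    have adj: "y \<in> K" if "x \<in> K" "adjacent M x y" for x y
    proof -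
      have "y \<in> half_edges M" using that(2) by (simp add: adjacent_def)
      then show ?thesis using that(1) r_into_equivclp[of "adjacent M", OF that(2)]
        by (auto simp: K_def intro: equivclp_trans)
    qed
    have Ks: "K \<subseteq> half_edges M" by (auto simp: K_def)
    have "closed_in M K"
    proof (rule closed_inI)
      show "K \<subseteq> half_edges M" by (rule Ks)
      show "map_sigma M x \<in> K" "map_alpha M x \<in> K" if x: "x \<in> K" for x
        using subsetD[OF Ks x] is_stuffed_mapD(2,3)[OF assms]
        by (auto intro!: adj[OF x] simp: adjacent_def permutes_in_image)
      show "y \<in> K" if "f \<in> cells M" "x \<in> \<Union>f" "x \<in> K" "y \<in> \<Union>f" for f x y
        using that cells_subset(2)[OF assms, of f] unfolding adjacent_def
        by (intro adj[OF that(3)]) (auto simp: adjacent_def)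
    qed
    moreover have "h \<in> K" using h by (simp add: K_def)
    ultimately have "K = half_edges M" using * by blast
    then show "equivclp (adjacent M) h h'" using h by (auto simp: K_def)
  qed
qed

text \<open>The right-hand side of \<open>has_genus\<close>, isolated because it also makes sense
  for disconnected maps, on which it is additive.\<close>

definition euler_char :: "('a, 'b) stuffed_map_scheme \<Rightarrow> int" where
  "euler_char M =
       int (card (cycles_of (map_sigma M) (half_edges M)))
       - int (card (cycles_of (map_alpha M) (half_edges M)))
       + int (length (roots M))
       + (\<Sum>f\<in>cells M. 2 - 2 * int (cell_genus M f) - int (card f))"

text \<open>Blocks are united cell by cell. The cycles of a cell \<open>f\<close> lie in at most
  \<open>card f\<close> blocks, so uniting these loses at most \<open>card f - 1\<close> of them.
  Every new block being a union of old ones keeps it stable under \<sigma> and \<alpha>.\<close>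

lemma partition_on_merge_cells:
  assumes "finite F" "partition_on H P" "finite P" "\<And>f. f \<in> F \<Longrightarrow> finite f \<and> f \<noteq> {} \<and> (\<forall>c\<in>f. \<exists>B\<in>P. c \<subseteq> B)"
  shows "\<exists>P'. partition_on H P' \<and> finite P' \<and> (\<forall>B\<in>P'. \<exists>Q\<subseteq>P. B = \<Union>Q) \<and> (\<forall>f\<in>F. \<exists>B\<in>P'. \<Union>f \<subseteq> B) \<and>
     (\<forall>B\<in>P. \<exists>B'\<in>P'. B \<subseteq> B') \<and> card P + card F \<le> card P' + (\<Sum>f\<in>F. card f)"
  using assms(1,4)
proof (induction F)
  case empty
  show ?case using assms by (intro exI[of _ P]) (auto intro: exI[of _ "{B}" for B])
next
  case (insert f F)
  have "\<exists>P'. partition_on H P' \<and> finite P' \<and> (\<forall>B\<in>P'. \<exists>Q\<subseteq>P. B = \<Union>Q) \<and> (\<forall>f\<in>F. \<exists>B\<in>P'. \<Union>f \<subseteq> B) \<and>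
     (\<forall>B\<in>P. \<exists>B'\<in>P'. B \<subseteq> B') \<and> card P + card F \<le> card P' + (\<Sum>f\<in>F. card f)"
    by (rule insert.IH) (use insert.prems in auto)
  then obtain P' where P': "partition_on H P'" "finite P'" "\<forall>B\<in>P'. \<exists>Q\<subseteq>P. B = \<Union>Q"
    "\<forall>f\<in>F. \<exists>B\<in>P'. \<Union>f \<subseteq> B" "\<forall>B\<in>P. \<exists>B'\<in>P'. B \<subseteq> B'" "card P + card F \<le> card P' + (\<Sum>f\<in>F. card f)"
    by (elim exE conjE)
  have f: "finite f" "f \<noteq> {}" "\<forall>c\<in>f. \<exists>B\<in>P. c \<subseteq> B" using insert.prems by auto
  with P'(5) have "\<forall>c\<in>f. \<exists>B\<in>P'. c \<subseteq> B" by (meson subset_trans)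
  then obtain b where b: "\<And>c. c \<in> f \<Longrightarrow> b c \<in> P' \<and> c \<subseteq> b c" by metis
  define Q where "Q = b ` f"
  have Q: "Q \<subseteq> P'" "Q \<noteq> {}" "card Q \<le> card f" using b f by (auto simp: Q_def card_image_le)
  define P'' where "P'' = insert (\<Union>Q) (P' - Q)"
  have part: "partition_on H P''" unfolding P''_def by (rule partition_on_merge[OF P'(1) Q(1,2)])
  have cP: "card P'' + card Q = card P' + 1"
    unfolding P''_def by (rule card_partition_merge[OF P'(1,2) Q(1,2)])
  have un: "\<exists>R\<subseteq>P. B = \<Union>R" if "B \<in> P''" for B
  proof (cases "B = \<Union>Q")
    case True
    have "\<forall>C\<in>Q. \<exists>R\<subseteq>P. C = \<Union>R" using P'(3) Q(1) by blast
    then obtain r where r: "\<And>C. C \<in> Q \<Longrightarrow> r C \<subseteq> P \<and> C = \<Union>(r C)" by metis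
    have "\<Union>(\<Union>(r ` Q)) = (\<Union>C\<in>Q. \<Union>(r C))" by blast
    also have "\<dots> = (\<Union>C\<in>Q. C)" by (rule SUP_cong) (use r in auto)
    finally have "B = \<Union>(\<Union>(r ` Q))" using True by simp
    moreover have "\<Union>(r ` Q) \<subseteq> P" using r by blast
    ultimately show ?thesis by blast
  next
    case False
    then show ?thesis using that P'(3) by (auto simp: P''_def)
  qed
  have coarse: "\<exists>B'\<in>P''. B \<subseteq> B'" if "B \<in> P'" for B
    using that unfolding P''_def by (cases "B \<in> Q") auto
  have f_in: "\<exists>B\<in>P''. \<Union>f \<subseteq> B"
    using b by (auto simp: P''_def Q_def)
  have F_in: "\<exists>B\<in>P''. \<Union>g \<subseteq> B" if "g \<in> F" for g
    using P'(4) that coarse by (meson subset_trans)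
  have coarse': "\<exists>B'\<in>P''. B \<subseteq> B'" if "B \<in> P" for B
    using P'(5) that coarse by (meson subset_trans)
  have fin: "finite P''" using P'(2) by (simp add: P''_def)
  have card: "card P + card (insert f F) \<le> card P'' + (\<Sum>f\<in>insert f F. card f)"
    using insert.hyps P'(6) cP Q(3) by simp
  show ?case
  proof (rule exI[of _ P''], intro conjI ballI)
    fix g assume "g \<in> insert f F"
    then show "\<exists>B\<in>P''. \<Union>g \<subseteq> B" using f_in F_in by (elim insertE) simp_all
  qed (fact part fin un coarse' card)+
qed

lemma card_cycles_of_alpha:
  assumes "is_stuffed_map M"
  shows "2 * card (cycles_of (map_alpha M) (half_edges M)) = card (half_edges M)"
proof -
  note M = is_stuffed_mapD[OF assms]
  have orb: "orbit (map_alpha M) h = {h, map_alpha M h}" if "h \<in> half_edges M" for h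
  proof
    show "orbit (map_alpha M) h \<subseteq> {h, map_alpha M h}"
    proof
      fix x assume "x \<in> orbit (map_alpha M) h"
      then show "x \<in> {h, map_alpha M h}" by induction (use M(6)[OF that] in auto)
    qed
    show "{h, map_alpha M h} \<subseteq> orbit (map_alpha M) h"
      using permutation_self_in_orbit[OF M(13)] by (auto intro: orbit.base)
  qed
  have "card C = 2" if "C \<in> cycles_of (map_alpha M) (half_edges M)" for C
    using that orb M(7) by (fastforce simp: cycles_of_def card_2_iff)
  moreover have "card (half_edges M) = (\<Sum>C\<in>cycles_of (map_alpha M) (half_edges M). card C)"
    by (rule product_partition[OF partition_on_cycles_of[OF M(3,1)]])
       (use M(1) in \<open>auto simp: cycles_of_def orb\<close>)
  ultimately show ?thesis by simp
qed

lemma partition_on_diff_disjnt: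
  assumes "partition_on A P" "f \<in> P" "g \<in> P" "f \<noteq> g"
  shows "f \<inter> g = {}"
  using assms by (auto simp: partition_on_def dest: disjointD)

lemma card_cycles_of_phi:
  assumes "is_stuffed_map M"
  shows "card (cycles_of (map_phi M) (half_edges M)) = length (roots M) + (\<Sum>f\<in>cells M. card f)"
proof -
  note M = is_stuffed_mapD[OF assms]
  let ?C = "cycles_of (map_phi M) (half_edges M)" and ?B = "set (boundaries M)"
  have fin: "finite ?C" using M(1) by (rule finite_cycles_of)
  have "?B \<subseteq> ?C" using M(9) by (auto simp: boundaries_def cycles_of_def)
  moreover have "card ?B = length (roots M)"
    using M(10) by (simp add: distinct_card) (simp add: boundaries_def)
  moreover have "card (?C - ?B) = (\<Sum>f\<in>cells M. card f)"
    by (rule product_partition[OF M(11)]) (use cells_subset(4)[OF assms] in auto)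
  ultimately show ?thesis
    using fin by (metis card_Diff_subset card_mono finite_set le_add_diff_inverse)
qed

text \<open>Write V, E, F for the numbers of vertices, edges and cells, n for the number of
  boundaries, and c for the number of blocks in the hypermap inequality. Since there are 2E
  half-edges, it reads V + n + \<Sum>|f| \<le> E + 2c. Uniting the blocks along the cells leaves a
  single one by connectedness, so c + F \<le> 1 + \<Sum>|f|. Eliminating c gives the bound for cells
  of genus 0, and positive genera only lower the left-hand side.\<close>

theorem euler_char_le_2:
  assumes "is_stuffed_map M" "connected_map M"
  shows "euler_char M \<le> 2"
proof -
  note M = is_stuffed_mapD[OF assms(1)]
  let ?H = "half_edges M"
  have inv: "inv (map_phi M) = map_sigma M \<circ> map_alpha M"
  proof -
    have "map_sigma M \<circ> map_alpha M \<circ> map_phi M \<circ> inv (map_phi M) = map_sigma M \<circ> map_alpha M"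
      by (simp only: comp_assoc permutes_inv_o(1)[OF M(4)] comp_id)
    then show ?thesis by (simp add: M(5))
  qed
  obtain P where P0: "partition_on ?H P \<and> (\<forall>B\<in>P. map_sigma M ` B \<subseteq> B \<and> map_alpha M ` B \<subseteq> B) \<and>
    card (cycles_of (map_sigma M) ?H) + card (cycles_of (map_alpha M) ?H) +
    card (cycles_of (map_sigma M \<circ> map_alpha M) ?H) \<le> card ?H + 2 * card P"
    using hypermap_euler_inequality[OF M(2,1,3)] by (rule exE)
  then have P: "partition_on ?H P" "\<And>B x. B \<in> P \<Longrightarrow> x \<in> B \<Longrightarrow> map_sigma M x \<in> B"
    "\<And>B x. B \<in> P \<Longrightarrow> x \<in> B \<Longrightarrow> map_alpha M x \<in> B"
    by auto
  have P4: "card (cycles_of (map_sigma M) ?H) + card (cycles_of (map_phi M) ?H)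
     \<le> card (cycles_of (map_alpha M) ?H) + 2 * card P"
    using P0 cycles_of_inv[OF M(4,1)] card_cycles_of_alpha[OF assms(1)] unfolding inv by simp
  have finP: "finite P" using P(1) M(1) by (rule finite_elements[rotated])
  have phi: "x \<in> B" if B: "B \<in> P" and x: "x \<in> orbit (map_phi M) y" and y: "y \<in> B" for B x y
  proof -
    have Bs: "B \<subseteq> ?H" using P(1) B by (auto simp: partition_on_def)
    have "map_phi M z \<in> B" if "z \<in> B" for z
    proof -
      have "map_sigma M (map_alpha M (map_phi M z)) \<in> B" using M(5) that by (simp add: fun_eq_iff)
      then show ?thesis
        using permutes_closed_iff[OF M(2,1) Bs] permutes_closed_iff[OF M(3,1) Bs] P(2,3) B by blast
    qed
    with x y show ?thesis by induction auto
  qed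
  have cyc: "\<exists>B\<in>P. c \<subseteq> B" if c: "c \<in> cycles_of (map_phi M) ?H" for c
  proof -
    obtain h where h: "h \<in> ?H" "c = orbit (map_phi M) h" using c unfolding cycles_of_def by blast
    then obtain B where "B \<in> P" "h \<in> B" using P(1) by (auto simp: partition_on_def)
    then show ?thesis using h phi by blast
  qed
  have "\<exists>P'. partition_on ?H P' \<and> finite P' \<and> (\<forall>B\<in>P'. \<exists>Q\<subseteq>P. B = \<Union>Q) \<and> (\<forall>f\<in>cells M. \<exists>B\<in>P'. \<Union>f \<subseteq> B) \<and>
     (\<forall>B\<in>P. \<exists>B'\<in>P'. B \<subseteq> B') \<and> card P + card (cells M) \<le> card P' + (\<Sum>f\<in>cells M. card f)"
    by (rule partition_on_merge_cells[OF finite_cells[OF assms(1)] P(1) finP])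
       (intro conjI ballI cyc; use cells_subset(1,3,4)[OF assms(1)] in \<open>simp add: subset_iff\<close>)
  then obtain P' where P': "partition_on ?H P'" "\<forall>B\<in>P'. \<exists>Q\<subseteq>P. B = \<Union>Q" "\<forall>f\<in>cells M. \<exists>B\<in>P'. \<Union>f \<subseteq> B"
     "card P + card (cells M) \<le> card P' + (\<Sum>f\<in>cells M. card f)"
    by (elim exE conjE)
  have "B = ?H" if B: "B \<in> P'" for B
  proof -
    obtain Q where Q: "Q \<subseteq> P" "B = \<Union>Q" using P'(2) B by blast
    have "closed_in M B"
    proof (rule closed_inI)
      show "B \<subseteq> ?H" using P'(1) B by (auto simp: partition_on_def)
      show "map_sigma M x \<in> B" "map_alpha M x \<in> B" if "x \<in> B" for x
        using that P(2,3) Q by blast+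
      show "y \<in> B" if f: "f \<in> cells M" "x \<in> \<Union>f" "x \<in> B" "y \<in> \<Union>f" for f x y
      proof -
        obtain B' where B': "B' \<in> P'" "\<Union>f \<subseteq> B'" using f(1) P'(3) by blast
        then have "B' = B" using partition_on_eqI[OF P'(1) B'(1) B, of x] f(2,3) by blast
        then show ?thesis using B' f(4) by blast
      qed
    qed
    moreover have "B \<noteq> {}" using P'(1) B by (auto simp: partition_on_def)
    ultimately show ?thesis using connected_map_iff[OF assms(1)] assms(2) by blast
  qed
  then have "P' \<subseteq> {?H}" by blast
  then have "card P' \<le> 1" by (metis card.empty card_mono finite.emptyI finite.insertI is_singletonI is_singleton_altdef)
  then have "int (card (cycles_of (map_sigma M) ?H)) + int (length (roots M)) + 2 * int (card (cells M))
    \<le> int (card (cycles_of (map_alpha M) ?H)) + int (\<Sum>f\<in>cells M. card f) + 2"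
    using P4 P'(4) card_cycles_of_phi[OF assms(1)] by linarith
  moreover have "(\<Sum>f\<in>cells M. 2 - 2 * int (cell_genus M f) - int (card f)) \<le> (\<Sum>f\<in>cells M. 2 - int (card f))"
    by (rule sum_mono) simp
  moreover have "(\<Sum>f\<in>cells M. 2 - int (card f)) = 2 * int (card (cells M)) - int (\<Sum>f\<in>cells M. card f)"
    by (simp add: sum_subtractf)
  ultimately show ?thesis unfolding euler_char_def by linarith
qed

section \<open>Surgery on stuffed maps\<close>

text \<open>
  The transpositions cancel in \<open>\<sigma> \<circ> \<alpha> \<circ> \<phi>\<close>.  Depending on the relative position of \<open>a\<close> and \<open>b\<close>,
  the operation identifies two vertices of the boundary or cuts the surface at a vertex.
\<close>

definition swap_map :: "'a \<Rightarrow> 'a \<Rightarrow> 'a list \<Rightarrow> 'a stuffed_map \<Rightarrow> 'a stuffed_map" where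
  "swap_map a b rs M = M\<lparr>map_sigma := Transposition.transpose a b \<circ> map_sigma M,
     map_phi := map_phi M \<circ> Transposition.transpose a b, roots := rs\<rparr>"

lemma swap_map_simps [simp]:
  "half_edges (swap_map a b rs M) = half_edges M"
  "map_sigma (swap_map a b rs M) = Transposition.transpose a b \<circ> map_sigma M"
  "map_alpha (swap_map a b rs M) = map_alpha M"
  "map_phi (swap_map a b rs M) = map_phi M \<circ> Transposition.transpose a b"
  "roots (swap_map a b rs M) = rs"
  "cells (swap_map a b rs M) = cells M"
  "cell_genus (swap_map a b rs M) = cell_genus M"
  by (simp_all add: swap_map_def)

text \<open>Cutting and glueing are the same operation, up to the list of roots.\<close>

lemma swap_map_swap_map: "swap_map a b rs (swap_map a b rs' M) = M\<lparr>roots := rs\<rparr>"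
  by (simp add: swap_map_def comp_transpose_twice transpose_comp_twice)

lemma permutes_transpose_comp_iff:
  assumes "a \<in> H" "b \<in> H"
  shows "Transposition.transpose a b \<circ> p permutes H \<longleftrightarrow> p permutes H"
  using permutes_transpose_comp[OF _ assms, of p] permutes_transpose_comp[OF _ assms, of "Transposition.transpose a b \<circ> p"]
  by (auto simp: transpose_comp_twice)

lemma permutes_comp_transpose_iff:
  assumes "a \<in> H" "b \<in> H"
  shows "p \<circ> Transposition.transpose a b permutes H \<longleftrightarrow> p permutes H"
  using permutes_comp_transpose[OF _ assms, of p] permutes_comp_transpose[OF _ assms, of "p \<circ> Transposition.transpose a b"]
  by (auto simp: comp_transpose_twice)

text \<open>Seen as glueing: two boundary cycles become one, and every other cycle of \<phi>
  survives, so the cells need no change.\<close>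

lemma swap_map_orbits:
  assumes fin: "finite (half_edges N)" and phi: "map_phi N permutes half_edges N"
    and H: "a \<in> half_edges N" "b \<in> half_edges N" and ar: "a \<in> orbit (map_phi N) r"
    and b: "b \<notin> orbit (map_phi N) a"
  shows "orbit (map_phi (swap_map a b rs N)) r = orbit (map_phi N) r \<union> orbit (map_phi N) b"
    "cycles_of (map_phi (swap_map a b rs N)) (half_edges N) - {orbit (map_phi (swap_map a b rs N)) r}
      = cycles_of (map_phi N) (half_edges N) - {orbit (map_phi N) r, orbit (map_phi N) b}"
    "orbit (map_phi N) r \<noteq> orbit (map_phi N) b"
proof -
  have p: "permutation (map_phi N)" using fin phi by (auto simp: permutation_permutes)
  have p': "permutation (map_phi N \<circ> Transposition.transpose a b)"
    by (rule permutation_comp_transpose[OF p])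
  have ra: "orbit (map_phi N) r = orbit (map_phi N) a"
    using ar orbit_eq_orbit_iff[OF p] by metis
  have eq: "orbit (map_phi N \<circ> Transposition.transpose a b) a = orbit (map_phi N) r \<union> orbit (map_phi N) b"
    using orbit_comp_transpose_merge[OF p b] ra by simp
  then have "r \<in> orbit (map_phi N \<circ> Transposition.transpose a b) a"
    using permutation_self_in_orbit[OF p] by blast
  then show r: "orbit (map_phi (swap_map a b rs N)) r = orbit (map_phi N) r \<union> orbit (map_phi N) b"
    using orbit_eq_orbit_iff[OF p', of r a] eq by simp
  show ne: "orbit (map_phi N) r \<noteq> orbit (map_phi N) b"
    using b ra permutation_self_in_orbit[OF p] by blast
  have "orbit (map_phi N) r \<union> orbit (map_phi N) b \<notin> cycles_of (map_phi N) (half_edges N)"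
  proof
    assume "orbit (map_phi N) r \<union> orbit (map_phi N) b \<in> cycles_of (map_phi N) (half_edges N)"
    then obtain x where x: "orbit (map_phi N) r \<union> orbit (map_phi N) b = orbit (map_phi N) x"
      unfolding cycles_of_def by blast
    then have "r \<in> orbit (map_phi N) x" "b \<in> orbit (map_phi N) x"
      using permutation_self_in_orbit[OF p] by blast+
    then show False using ne orbit_eq_orbit_iff[OF p] by metis
  qed
  then show "cycles_of (map_phi (swap_map a b rs N)) (half_edges N) - {orbit (map_phi (swap_map a b rs N)) r}
      = cycles_of (map_phi N) (half_edges N) - {orbit (map_phi N) r, orbit (map_phi N) b}"
    unfolding swap_map_simps r[unfolded swap_map_simps] cycles_of_comp_transpose_merge[OF phi fin H b] ra[symmetric] by blast
qed

text \<open>Stated as an equivalence because glueing uses one direction and cutting the other. The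
  two transpositions conjugate \<sigma> \<circ> \<alpha> \<circ> \<phi>, and a conjugate is the
  identity exactly when the original is.\<close>

lemma swap_map_iff:
  assumes "finite (half_edges N)" "map_phi N permutes half_edges N"
    and H: "a \<in> half_edges N" "b \<in> half_edges N" and "a \<in> orbit (map_phi N) r"
    and "b \<notin> orbit (map_phi N) a" and r: "r \<in> half_edges N" "roots N = [r, b]"
  shows "is_stuffed_map (swap_map a b [r] N) \<longleftrightarrow> is_stuffed_map N"
proof -
  note orb = swap_map_orbits(1,2)[OF assms(1-6), where rs = "[r]"] swap_map_orbits(3)[OF assms(1-6)]
  let ?t = "Transposition.transpose a b"
  let ?c = "map_sigma N \<circ> map_alpha N \<circ> map_phi N"
  have "?t \<circ> map_sigma N \<circ> map_alpha N \<circ> (map_phi N \<circ> ?t) = ?t \<circ> ?c \<circ> ?t"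
    by (simp add: fun_eq_iff)
  moreover have "?t \<circ> ?c \<circ> ?t = id \<longleftrightarrow> ?c = id"
  proof
    assume *: "?t \<circ> ?c \<circ> ?t = id"
    have "?c = ?t \<circ> (?t \<circ> ?c \<circ> ?t) \<circ> ?t" by (simp add: fun_eq_iff)
    then show "?c = id" unfolding * by (simp add: fun_eq_iff)
  qed (simp add: fun_eq_iff)
  ultimately have comp: "map_sigma (swap_map a b [r] N) \<circ> map_alpha (swap_map a b [r] N) \<circ> map_phi (swap_map a b [r] N) = id
    \<longleftrightarrow> ?c = id" by simp
  have bd: "boundaries N = [orbit (map_phi N) r, orbit (map_phi N) b]"
    "boundaries (swap_map a b [r] N) = [orbit (map_phi (swap_map a b [r] N)) r]"
    by (simp_all add: boundaries_def r)
  have "partition_on (cycles_of (map_phi (swap_map a b [r] N)) (half_edges (swap_map a b [r] N)) -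
      set (boundaries (swap_map a b [r] N))) (cells (swap_map a b [r] N)) \<longleftrightarrow>
    partition_on (cycles_of (map_phi N) (half_edges N) - set (boundaries N)) (cells N)"
    using orb(2) by (simp add: bd)
  with comp show ?thesis
    unfolding is_stuffed_map_def bd using orb(3) r H
    by (simp add: permutes_transpose_comp_iff permutes_comp_transpose_iff)
qed

text \<open>One vertex and one boundary are lost.\<close>

lemma swap_map_euler_char:
  assumes "finite (half_edges N)" "map_sigma N permutes half_edges N"
    "a \<in> half_edges N" "b \<in> half_edges N" "b \<notin> orbit (map_sigma N) a" "length (roots N) = Suc (length rs)"
  shows "euler_char (swap_map a b rs N) = euler_char N - 2"
  using card_cycles_of_transpose_comp_merge[OF assms(2,1,3-5)] assms(6)
  by (simp add: euler_char_def)

section \<open>Disjoint unions of maps\<close>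

definition perm_union :: "'a set \<Rightarrow> ('a \<Rightarrow> 'a) \<Rightarrow> ('a \<Rightarrow> 'a) \<Rightarrow> 'a \<Rightarrow> 'a" where
  "perm_union A p q x = (if x \<in> A then p x else q x)"

lemma perm_union_permutes:
  assumes "p permutes A" "q permutes B" "A \<inter> B = {}"
  shows "perm_union A p q permutes A \<union> B"
proof -
  have "perm_union A p q x = (p \<circ> q) x" for x
  proof -
    consider "x \<in> A" | "x \<in> B" "x \<notin> A" | "x \<notin> A" "x \<notin> B" by blast
    then show ?thesis
    proof cases
      case 1
      then have "x \<notin> B" using assms(3) by blast
      then show ?thesis using 1 assms(2) by (simp add: perm_union_def permutes_not_in)
    next
      case 2
      then have "q x \<notin> A" using assms by (metis disjoint_iff permutes_in_image)
      then show ?thesis using 2 assms(1) by (simp add: perm_union_def permutes_not_in)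
    next
      case 3
      then show ?thesis using assms(1,2) by (simp add: perm_union_def permutes_not_in)
    qed
  qed
  then have "perm_union A p q = p \<circ> q" by (simp add: fun_eq_iff)
  moreover have "p \<circ> q permutes A \<union> B"
    using assms by (intro permutes_compose) (auto intro: permutes_subset)
  ultimately show ?thesis by simp
qed

lemma orbit_perm_union:
  assumes "p permutes A" "q permutes B" "A \<inter> B = {}"
  shows "x \<in> A \<Longrightarrow> orbit (perm_union A p q) x = orbit p x"
    "x \<in> B \<Longrightarrow> orbit (perm_union A p q) x = orbit q x"
proof -
  show "orbit (perm_union A p q) x = orbit p x" if "x \<in> A"
    by (rule orbit_cong0[symmetric, OF that]) (use assms in \<open>auto simp: perm_union_def permutes_in_image\<close>)
  show "orbit (perm_union A p q) x = orbit q x" if "x \<in> B"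
    by (rule orbit_cong0[symmetric, OF that]) (use assms in \<open>auto simp: perm_union_def permutes_in_image\<close>)
qed

lemma cycles_of_perm_union:
  assumes "p permutes A" "q permutes B" "A \<inter> B = {}"
  shows "cycles_of (perm_union A p q) (A \<union> B) = cycles_of p A \<union> cycles_of q B"
    "cycles_of p A \<inter> cycles_of q B = {}"
proof -
  show "cycles_of (perm_union A p q) (A \<union> B) = cycles_of p A \<union> cycles_of q B"
    unfolding cycles_of_def image_Un using orbit_perm_union[OF assms] by simp
  have "orbit p x \<noteq> orbit q y" if "x \<in> A" "y \<in> B" for x y
    using permutes_orbit_subset[OF assms(1) that(1)] permutes_orbit_subset[OF assms(2) that(2)]
      orbit_nonempty[of p x] assms(3) by (metis Int_greatest subset_empty)
  then show "cycles_of p A \<inter> cycles_of q B = {}" unfolding cycles_of_def by blast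
qed

lemma card_cycles_of_perm_union:
  assumes "p permutes A" "q permutes B" "A \<inter> B = {}" "finite A" "finite B"
  shows "card (cycles_of (perm_union A p q) (A \<union> B)) = card (cycles_of p A) + card (cycles_of q B)"
  using cycles_of_perm_union[OF assms(1-3)] assms(4,5) by (simp add: card_Un_disjoint finite_cycles_of)

definition union_map :: "'a stuffed_map \<Rightarrow> 'a stuffed_map \<Rightarrow> 'a stuffed_map" where
  "union_map M N = \<lparr>half_edges = half_edges M \<union> half_edges N,
     map_sigma = perm_union (half_edges M) (map_sigma M) (map_sigma N),
     map_alpha = perm_union (half_edges M) (map_alpha M) (map_alpha N),
     map_phi = perm_union (half_edges M) (map_phi M) (map_phi N),
     roots = roots M @ roots N,
     cells = cells M \<union> cells N,
     cell_genus = (\<lambda>f. if f \<in> cells M then cell_genus M f else cell_genus N f)\<rparr>"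

lemma union_map_simps [simp]:
  "half_edges (union_map M N) = half_edges M \<union> half_edges N"
  "map_sigma (union_map M N) = perm_union (half_edges M) (map_sigma M) (map_sigma N)"
  "map_alpha (union_map M N) = perm_union (half_edges M) (map_alpha M) (map_alpha N)"
  "map_phi (union_map M N) = perm_union (half_edges M) (map_phi M) (map_phi N)"
  "roots (union_map M N) = roots M @ roots N"
  "cells (union_map M N) = cells M \<union> cells N"
  "cell_genus (union_map M N) f = (if f \<in> cells M then cell_genus M f else cell_genus N f)"
  by (simp_all add: union_map_def)

lemma cells_disjoint:
  assumes "is_stuffed_map M" "is_stuffed_map N" "half_edges M \<inter> half_edges N = {}"
  shows "cells M \<inter> cells N = {}"
proof -
  have False if f: "f \<in> cells M" "f \<in> cells N" for f
    using cells_subset(2,5)[OF assms(1) f(1)] cells_subset(2)[OF assms(2) f(2)] assms(3) by blast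
  then show ?thesis by blast
qed

lemma partition_on_Un:
  assumes "partition_on A P" "partition_on B Q" "A \<inter> B = {}"
  shows "partition_on (A \<union> B) (P \<union> Q)"
proof (rule partition_onI)
  show "\<Union> (P \<union> Q) = A \<union> B" "{} \<notin> P \<union> Q" using assms by (auto simp: partition_on_def)
  have PQ: "disjnt p q" if "p \<in> P" "q \<in> Q" for p q
    using that assms unfolding partition_on_def disjnt_def by blast
  have "disjnt p q" if "p \<in> P" "q \<in> P" "p \<noteq> q" for p q
    using partition_on_diff_disjnt[OF assms(1) that] by (simp add: disjnt_def)
  moreover have "disjnt p q" if "p \<in> Q" "q \<in> Q" "p \<noteq> q" for p q
    using partition_on_diff_disjnt[OF assms(2) that] by (simp add: disjnt_def)
  ultimately show "disjnt p q" if "p \<in> P \<union> Q" "q \<in> P \<union> Q" "p \<noteq> q" for p q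
    using that PQ by (metis UnE disjnt_sym)
qed

lemma boundaries_subset: "is_stuffed_map M \<Longrightarrow> set (boundaries M) \<subseteq> cycles_of (map_phi M) (half_edges M)"
  using is_stuffed_mapD(9)[of M] by (auto simp: boundaries_def cycles_of_def)

lemma boundaries_union_map:
  assumes "is_stuffed_map M" "is_stuffed_map N" "half_edges M \<inter> half_edges N = {}"
  shows "boundaries (union_map M N) = boundaries M @ boundaries N"
  using orbit_perm_union[OF is_stuffed_mapD(4)[OF assms(1)] is_stuffed_mapD(4)[OF assms(2)] assms(3)]
    is_stuffed_mapD(9)[OF assms(1)] is_stuffed_mapD(9)[OF assms(2)]
  by (simp add: boundaries_def subset_iff)

lemma is_stuffed_map_union:
  assumes "is_stuffed_map M" "is_stuffed_map N" "half_edges M \<inter> half_edges N = {}"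
  shows "is_stuffed_map (union_map M N)"
proof -
  note M = is_stuffed_mapD[OF assms(1)] and N = is_stuffed_mapD[OF assms(2)]
  let ?U = "union_map M N"
  have inM: "map_sigma M x \<in> half_edges M \<longleftrightarrow> x \<in> half_edges M" "map_alpha M x \<in> half_edges M \<longleftrightarrow> x \<in> half_edges M"
    "map_phi M x \<in> half_edges M \<longleftrightarrow> x \<in> half_edges M" for x
    using M(2-4) by (simp_all add: permutes_in_image)
  have notM: "map_alpha N x \<notin> half_edges M \<and> map_phi N x \<notin> half_edges M" if "x \<notin> half_edges M" for x
  proof (cases "x \<in> half_edges N")
    case True
    then have "map_alpha N x \<in> half_edges N" "map_phi N x \<in> half_edges N"
      using N(3,4) by (simp_all add: permutes_in_image)
    then show ?thesis using assms(3) by blast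
  qed (use that N(3,4) in \<open>simp add: permutes_not_in\<close>)
  have "map_sigma ?U (map_alpha ?U (map_phi ?U x)) = x" for x
    using M(5) N(5) notM[of x] notM[of "map_phi N x"] by (cases "x \<in> half_edges M") (simp_all add: perm_union_def inM fun_eq_iff)
  then have comp: "map_sigma ?U \<circ> map_alpha ?U \<circ> map_phi ?U = id" by (simp add: fun_eq_iff)
  have al: "map_alpha ?U (map_alpha ?U x) = x \<and> map_alpha ?U x \<noteq> x" if "x \<in> half_edges ?U" for x
    using that M(6,7) N(6,7) inM notM[of x] by (cases "x \<in> half_edges M") (simp_all add: perm_union_def)
  note cyc = cycles_of_perm_union[OF M(4) N(4) assms(3)]
  have cycU: "cycles_of (map_phi ?U) (half_edges ?U) - set (boundaries ?U) =
     (cycles_of (map_phi M) (half_edges M) - set (boundaries M)) \<union> (cycles_of (map_phi N) (half_edges N) - set (boundaries N))"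
    using cyc boundaries_subset[OF assms(1)] boundaries_subset[OF assms(2)]
    unfolding union_map_simps boundaries_union_map[OF assms] set_append by blast
  have "partition_on (cycles_of (map_phi ?U) (half_edges ?U) - set (boundaries ?U)) (cells ?U)"
    unfolding cycU unfolding union_map_simps(6)
    by (rule partition_on_Un[OF M(11) N(11)]) (use cyc in blast)
  moreover have "distinct (boundaries ?U)"
    using M(10) N(10) boundaries_subset[OF assms(1)] boundaries_subset[OF assms(2)] cyc(2)
    unfolding boundaries_union_map[OF assms] distinct_append by blast
  ultimately show ?thesis
    unfolding is_stuffed_map_def using comp al M N
    by (intro conjI) (auto intro!: perm_union_permutes assms(3))
qed

lemma euler_char_union:
  assumes "is_stuffed_map M" "is_stuffed_map N" "half_edges M \<inter> half_edges N = {}"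
  shows "euler_char (union_map M N) = euler_char M + euler_char N"
proof -
  note M = is_stuffed_mapD[OF assms(1)] and N = is_stuffed_mapD[OF assms(2)]
  have "(\<Sum>f\<in>cells N. 2 - 2 * int (cell_genus (union_map M N) f) - int (card f)) =
    (\<Sum>f\<in>cells N. 2 - 2 * int (cell_genus N f) - int (card f))"
    using cells_disjoint[OF assms] by (intro sum.cong) auto
  then have "(\<Sum>f\<in>cells M \<union> cells N. 2 - 2 * int (cell_genus (union_map M N) f) - int (card f)) =
    (\<Sum>f\<in>cells M. 2 - 2 * int (cell_genus M f) - int (card f)) +
    (\<Sum>f\<in>cells N. 2 - 2 * int (cell_genus N f) - int (card f))"
    using cells_disjoint[OF assms] finite_cells[OF assms(1)] finite_cells[OF assms(2)]
    by (subst sum.union_disjoint) auto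
  then show ?thesis
    using card_cycles_of_perm_union[OF M(2) N(2) assms(3) M(1) N(1)] card_cycles_of_perm_union[OF M(3) N(3) assms(3) M(1) N(1)]
    unfolding euler_char_def by simp
qed

section \<open>Restriction of a map to a union of components\<close>

definition restrict_map_to :: "'a set \<Rightarrow> 'a list \<Rightarrow> 'a stuffed_map \<Rightarrow> 'a stuffed_map" where
  "restrict_map_to K rs M = \<lparr>half_edges = K,
     map_sigma = perm_restrict (map_sigma M) K,
     map_alpha = perm_restrict (map_alpha M) K,
     map_phi = perm_restrict (map_phi M) K,
     roots = rs,
     cells = {f \<in> cells M. \<Union>f \<subseteq> K},
     cell_genus = (\<lambda>f. if f \<in> cells M \<and> \<Union>f \<subseteq> K then cell_genus M f else 0)\<rparr>"

lemma restrict_map_to_simps [simp]: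
  "half_edges (restrict_map_to K rs M) = K"
  "map_sigma (restrict_map_to K rs M) = perm_restrict (map_sigma M) K"
  "map_alpha (restrict_map_to K rs M) = perm_restrict (map_alpha M) K"
  "map_phi (restrict_map_to K rs M) = perm_restrict (map_phi M) K"
  "roots (restrict_map_to K rs M) = rs"
  "cells (restrict_map_to K rs M) = {f \<in> cells M. \<Union>f \<subseteq> K}"
  "cell_genus (restrict_map_to K rs M) f = (if f \<in> cells M \<and> \<Union>f \<subseteq> K then cell_genus M f else 0)"
  by (simp_all add: restrict_map_to_def)

lemma perm_restrict_permutes:
  assumes "p permutes H" "finite H" "K \<subseteq> H" "\<And>x. x \<in> K \<Longrightarrow> p x \<in> K"
  shows "perm_restrict p K permutes K"
proof (rule bij_imp_permutes)
  have "inj_on p K" using permutes_inj[OF assms(1)] by (rule inj_on_subset) simp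
  moreover have "p ` K = K"
    using assms(2-4) \<open>inj_on p K\<close> by (intro endo_inj_surj) (auto intro: finite_subset)
  ultimately have "bij_betw p K K" by (simp add: bij_betw_def)
  then show "bij_betw (perm_restrict p K) K K"
    by (subst bij_betw_cong[where g = p]) (auto simp: perm_restrict_def)
qed (simp add: perm_restrict_def)

lemma orbit_perm_restrict:
  assumes "x \<in> K" "\<And>x. x \<in> K \<Longrightarrow> p x \<in> K"
  shows "orbit (perm_restrict p K) x = orbit p x"
  by (rule orbit_cong0[OF assms(1)]) (use assms(2) in \<open>auto simp: perm_restrict_def\<close>)

text \<open>A closed set consists of whole cycles and whole cells, so each of them is either kept or
  dropped. The only root inside becomes the root of the single boundary.\<close>

lemma is_stuffed_map_restrict:
  assumes M: "is_stuffed_map M" and K: "closed_in M K" and r: "set (roots M) \<inter> K = {r}"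
  shows "is_stuffed_map (restrict_map_to K [r] M)"
proof -
  note D = is_stuffed_mapD[OF M] and KD = closed_inD[OF K] and iff = closed_in_iff[OF M K]
  let ?R = "restrict_map_to K [r] M"
  have phiK: "\<And>x. x \<in> K \<Longrightarrow> map_phi M x \<in> K" by (simp add: iff)
  have finK: "finite K" using KD(1) D(1) by (rule finite_subset)
  have "map_sigma ?R (map_alpha ?R (map_phi ?R x)) = x" for x
    using D(5) by (cases "x \<in> K") (simp_all add: perm_restrict_def iff fun_eq_iff)
  then have comp: "map_sigma ?R \<circ> map_alpha ?R \<circ> map_phi ?R = id" by (simp add: fun_eq_iff)
  have orb: "orbit (map_phi ?R) x = orbit (map_phi M) x" if "x \<in> K" for x
    using orbit_perm_restrict[OF that phiK] by simp
  have orbK: "orbit (map_phi M) x \<subseteq> K \<longleftrightarrow> x \<in> K" for x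
  proof
    show "orbit (map_phi M) x \<subseteq> K \<Longrightarrow> x \<in> K" using permutation_self_in_orbit[OF D(14)] by blast
    show "orbit (map_phi M) x \<subseteq> K" if "x \<in> K"
    proof
      fix y assume "y \<in> orbit (map_phi M) x"
      then show "y \<in> K" by induction (use that phiK in auto)
    qed
  qed
  have cyc: "cycles_of (map_phi ?R) K = {c \<in> cycles_of (map_phi M) (half_edges M). c \<subseteq> K}"
    using orb orbK KD(1) unfolding cycles_of_def by auto
  have rK: "r \<in> K" using r by blast
  have bd: "set (boundaries ?R) = {c \<in> set (boundaries M). c \<subseteq> K}"
  proof (intro equalityI subsetI)
    fix c assume "c \<in> set (boundaries ?R)"
    then have "c = orbit (map_phi M) r" using orb[OF rK] by (simp add: boundaries_def)
    then show "c \<in> {c \<in> set (boundaries M). c \<subseteq> K}" using r rK orbK by (auto simp: boundaries_def)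
  next
    fix c assume "c \<in> {c \<in> set (boundaries M). c \<subseteq> K}"
    then obtain x where x: "x \<in> set (roots M)" "c = orbit (map_phi M) x" "x \<in> K"
      using orbK by (auto simp: boundaries_def)
    then have "x = r" using r by blast
    then show "c \<in> set (boundaries ?R)" using x orb by (simp add: boundaries_def)
  qed
  have Cs: "cycles_of (map_phi ?R) K - set (boundaries ?R)
    = {c \<in> cycles_of (map_phi M) (half_edges M) - set (boundaries M). c \<subseteq> K}"
    unfolding cyc bd by blast
  have "partition_on {c \<in> cycles_of (map_phi M) (half_edges M) - set (boundaries M). c \<subseteq> K} {f \<in> cells M. \<Union>f \<subseteq> K}"
  proof (rule partition_onI)
    show "disjnt f g" if "f \<in> {f \<in> cells M. \<Union>f \<subseteq> K}" "g \<in> {f \<in> cells M. \<Union>f \<subseteq> K}" "f \<noteq> g" for f g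
      using partition_on_diff_disjnt[OF D(11), of f g] that by (simp add: disjnt_def)
    show "{} \<notin> {f \<in> cells M. \<Union>f \<subseteq> K}" using D(11) by (simp add: partition_on_def)
    show "\<Union>{f \<in> cells M. \<Union>f \<subseteq> K} = {c \<in> cycles_of (map_phi M) (half_edges M) - set (boundaries M). c \<subseteq> K}"
    proof (intro equalityI subsetI)
      fix c assume "c \<in> \<Union>{f \<in> cells M. \<Union>f \<subseteq> K}"
      then obtain f where f: "f \<in> cells M" "\<Union>f \<subseteq> K" "c \<in> f" by blast
      then have "c \<in> cycles_of (map_phi M) (half_edges M) - set (boundaries M)"
        using D(11) unfolding partition_on_def by blast
      then show "c \<in> {c \<in> cycles_of (map_phi M) (half_edges M) - set (boundaries M). c \<subseteq> K}"
        using f by blast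
    next
      fix c assume c: "c \<in> {c \<in> cycles_of (map_phi M) (half_edges M) - set (boundaries M). c \<subseteq> K}"
      then obtain f where f: "f \<in> cells M" "c \<in> f" using D(11) unfolding partition_on_def by blast
      obtain h where "c = orbit (map_phi M) h" using c unfolding cycles_of_def by blast
      then have x: "map_phi M h \<in> c" by (simp add: orbit.base)
      have "\<Union>f \<subseteq> K" using KD(4)[OF f(1), of "map_phi M h"] x f(2) c by blast
      then show "c \<in> \<Union>{f \<in> cells M. \<Union>f \<subseteq> K}" using f by blast
    qed
  qed
  then have "partition_on (cycles_of (map_phi ?R) K - set (boundaries ?R)) (cells ?R)"
    unfolding Cs by simp
  moreover have "map_sigma ?R permutes K" "map_alpha ?R permutes K" "map_phi ?R permutes K"
    using perm_restrict_permutes[OF D(2,1) KD(1)] perm_restrict_permutes[OF D(3,1) KD(1)]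
      perm_restrict_permutes[OF D(4,1) KD(1)] KD(2,3) phiK by simp_all
  moreover have "map_alpha ?R (map_alpha ?R h) = h \<and> map_alpha ?R h \<noteq> h" if "h \<in> K" for h
    using that D(6,7)[of h] KD(1) by (auto simp: perm_restrict_def iff)
  moreover have "distinct (boundaries ?R)" by (simp add: boundaries_def)
  ultimately show ?thesis
    unfolding is_stuffed_map_def using finK comp rK by simp
qed

lemma closed_in_restrict:
  assumes M: "is_stuffed_map M" and K: "closed_in M K" and K': "K' \<subseteq> K"
  shows "closed_in (restrict_map_to K rs M) K' \<longleftrightarrow> closed_in M K'"
proof
  assume c: "closed_in M K'"
  show "closed_in (restrict_map_to K rs M) K'"
  proof (rule closed_inI)
    show "y \<in> K'" if "f \<in> cells (restrict_map_to K rs M)" "x \<in> \<Union>f" "x \<in> K'" "y \<in> \<Union>f" for f x y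
      using closed_inD(4)[OF c _ that(2-4)] that(1) by simp
  qed (use K' closed_inD(2,3)[OF c] in \<open>auto simp: perm_restrict_def\<close>)
next
  assume c: "closed_in (restrict_map_to K rs M) K'"
  have [simp]: "x \<in> K" if "x \<in> K'" for x using that K' by blast
  show "closed_in M K'"
  proof (rule closed_inI)
    show "K' \<subseteq> half_edges M" using K' closed_inD(1)[OF K] by simp
    show "map_sigma M x \<in> K'" "map_alpha M x \<in> K'" if "x \<in> K'" for x
      using closed_inD(2,3)[OF c that] that by (simp_all add: perm_restrict_def)
    show "y \<in> K'" if f: "f \<in> cells M" "x \<in> \<Union>f" "x \<in> K'" "y \<in> \<Union>f" for f x y
    proof -
      have "\<Union>f \<subseteq> K" using closed_inD(4)[OF K f(1,2)] f(3) by (metis K' subsetD subsetI)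
      then show ?thesis using closed_inD(4)[OF c _ f(2-4)] f(1) by simp
    qed
  qed
qed

text \<open>The genus function is a total function whose values off the cells carry no meaning.
  Pinning them to 0 makes equality of records the equality of maps, as needed for finite sets of
  labelled maps and for exact inverses of glueing.\<close>

definition normalized_map :: "('a, 'b) stuffed_map_scheme \<Rightarrow> bool" where
  "normalized_map M \<longleftrightarrow> (\<forall>f. f \<notin> cells M \<longrightarrow> cell_genus M f = 0)"

text \<open>This, its counterpart for the second summand and \<open>union_restrict_map\<close> show
  that disjoint union and restriction to complementary closed sets undo each other on normalized
  maps.\<close>

lemma restrict_union_map:
  assumes "is_stuffed_map M" "is_stuffed_map N" "half_edges M \<inter> half_edges N = {}" "normalized_map M"
  shows "restrict_map_to (half_edges M) (roots M) (union_map M N) = M"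
proof -
  note M = is_stuffed_mapD[OF assms(1)]
  have cells: "{f \<in> cells M \<union> cells N. \<Union>f \<subseteq> half_edges M} = cells M"
  proof -
    have "\<not> \<Union>f \<subseteq> half_edges M" if "f \<in> cells N" for f
      using cells_subset(2,5)[OF assms(2) that] assms(3) by blast
    then show ?thesis using cells_subset(2)[OF assms(1)] by blast
  qed
  have perm: "perm_restrict (perm_union (half_edges M) p q) (half_edges M) = p" if "p permutes half_edges M" for p q
    using that by (auto simp: fun_eq_iff perm_restrict_def perm_union_def permutes_not_in)
  show ?thesis
  proof (rule stuffed_map.equality)
    show "cell_genus (restrict_map_to (half_edges M) (roots M) (union_map M N)) = cell_genus M"
      using cells assms(4) by (auto simp: fun_eq_iff normalized_map_def)
  qed (use cells perm M(2-4) in simp_all)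
qed

lemma restrict_union_map2:
  assumes "is_stuffed_map M" "is_stuffed_map N" "half_edges M \<inter> half_edges N = {}" "normalized_map N"
  shows "restrict_map_to (half_edges N) (roots N) (union_map M N) = N"
proof -
  note N = is_stuffed_mapD[OF assms(2)]
  have cells: "{f \<in> cells M \<union> cells N. \<Union>f \<subseteq> half_edges N} = cells N"
  proof -
    have "\<not> \<Union>f \<subseteq> half_edges N" if "f \<in> cells M" for f
      using cells_subset(2,5)[OF assms(1) that] assms(3) by blast
    then show ?thesis using cells_subset(2)[OF assms(2)] by blast
  qed
  have perm: "perm_restrict (perm_union (half_edges M) p q) (half_edges N) = q" if "q permutes half_edges N" for p q
    using that assms(3) by (auto simp: fun_eq_iff perm_restrict_def perm_union_def permutes_not_in)
  show ?thesis
  proof (rule stuffed_map.equality)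
    show "cell_genus (restrict_map_to (half_edges N) (roots N) (union_map M N)) = cell_genus N"
    proof
      fix f
      have "f \<in> cells N \<Longrightarrow> \<Union>f \<subseteq> half_edges N \<and> f \<notin> cells M"
        using cells_subset(2)[OF assms(2)] cells_disjoint[OF assms(1-3)] by blast
      then show "cell_genus (restrict_map_to (half_edges N) (roots N) (union_map M N)) f = cell_genus N f"
        using cells assms(4) by (cases "f \<in> cells N") (auto simp: normalized_map_def)
    qed
  qed (use cells perm N(2-4) in simp_all)
qed

lemma union_restrict_map:
  assumes M: "is_stuffed_map M" and K: "closed_in M K" and n: "normalized_map M" and r: "roots M = rs @ rs'"
  shows "union_map (restrict_map_to K rs M) (restrict_map_to (half_edges M - K) rs' M) = M"
proof -
  note D = is_stuffed_mapD[OF M] and KD = closed_inD[OF K]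
  have cells: "{f \<in> cells M. \<Union>f \<subseteq> K} \<union> {f \<in> cells M. \<Union>f \<subseteq> half_edges M - K} = cells M"
  proof -
    have "\<Union>f \<subseteq> K \<or> \<Union>f \<subseteq> half_edges M - K" if "f \<in> cells M" for f
      using KD(4)[OF that] cells_subset(2)[OF M that] by (metis DiffI subset_iff)
    then show ?thesis by blast
  qed
  have perm: "perm_union K (perm_restrict p K) (perm_restrict p (half_edges M - K)) = p"
    if "p permutes half_edges M" for p
    using that KD(1) by (auto simp: fun_eq_iff perm_restrict_def perm_union_def permutes_not_in)
  show ?thesis
  proof (rule stuffed_map.equality)
    show "cell_genus (union_map (restrict_map_to K rs M) (restrict_map_to (half_edges M - K) rs' M)) = cell_genus M"
    proof
      fix f
      show "cell_genus (union_map (restrict_map_to K rs M) (restrict_map_to (half_edges M - K) rs' M)) f = cell_genus M f"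
      proof (cases "f \<in> cells M")
        case True
        then have "\<Union>f \<subseteq> K \<or> \<Union>f \<subseteq> half_edges M - K" using cells by blast
        then show ?thesis using True by auto
      qed (use n in \<open>simp add: normalized_map_def\<close>)
    qed
  qed (use KD(1) cells perm D(2-4) r in auto)
qed

lemma closed_in_union_map:
  assumes "is_stuffed_map M" "is_stuffed_map N" "half_edges M \<inter> half_edges N = {}"
  shows "closed_in (union_map M N) (half_edges M)"
proof (rule closed_inI)
  show "y \<in> half_edges M" if "f \<in> cells (union_map M N)" "x \<in> \<Union>f" "x \<in> half_edges M" "y \<in> \<Union>f" for f x y
    using that cells_subset(2)[OF assms(1), of f] cells_subset(2)[OF assms(2), of f] assms(3) by auto
qed (use is_stuffed_mapD(2,3)[OF assms(1)] in \<open>auto simp: perm_union_def permutes_in_image\<close>)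

section \<open>Cutting and glueing disks\<close>

lemma has_genus_0_iff: "has_genus M 0 \<longleftrightarrow> euler_char M = 2"
  by (auto simp: has_genus_def euler_char_def)

text \<open>Indices start at 0, the root. The first \<open>k\<close> vertices are compared with the
  whole boundary, not just with each other; so no later half-edge returns to them, and a cut at
  index \<open>k\<close> leaves them in the piece with the root.\<close>

definition simple_upto :: "nat \<Rightarrow> ('a, 'b) stuffed_map_scheme \<Rightarrow> bool" where
  "simple_upto k M \<longleftrightarrow> (\<forall>j<k. \<forall>x\<in>boundary_half_edges M.
     x \<in> orbit (map_sigma M) ((map_phi M ^^ j) (hd (roots M))) \<longrightarrow> x = (map_phi M ^^ j) (hd (roots M)))"

text \<open>Its generating series is the \<open>D k l\<close> of the overview.\<close>

definition partial_disks :: "map_kind \<Rightarrow> nat \<Rightarrow> nat \<Rightarrow> 'a stuffed_map set" where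
  "partial_disks \<kappa> k l = {M. is_disk M \<and> of_kind \<kappa> M \<and> boundary_lengths M = [l] \<and> simple_upto k M}"

text \<open>All three kinds are conditions on single cells; in this form they pass to unions,
  restrictions and isomorphic copies without a case distinction.\<close>

fun cell_allowed :: "map_kind \<Rightarrow> nat \<Rightarrow> nat \<Rightarrow> bool" where
  "cell_allowed Usual_Maps h k \<longleftrightarrow> h = 0 \<and> k = 1"
| "cell_allowed Maps_With_Loops h k \<longleftrightarrow> h = 0 \<and> k \<in> {1, 2}"
| "cell_allowed Stuffed_Maps h k \<longleftrightarrow> True"

lemma of_kind_iff: "of_kind \<kappa> M \<longleftrightarrow> (\<forall>f\<in>cells M. cell_allowed \<kappa> (cell_genus M f) (card f))"
  by (cases \<kappa>) auto

lemma boundary_half_edges_root: "roots M = [r] \<Longrightarrow> boundary_half_edges M = orbit (map_phi M) r"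
  by (simp add: boundary_half_edges_def boundaries_def)

lemma partial_disks_iff:
  "M \<in> partial_disks \<kappa> k l \<longleftrightarrow> is_stuffed_map M \<and> connected_map M \<and> euler_char M = 2 \<and> of_kind \<kappa> M \<and>
     (\<exists>r. roots M = [r] \<and> card (orbit (map_phi M) r) = l) \<and> simple_upto k M"
proof -
  have "length (roots M) = 1 \<and> boundary_lengths M = [l] \<longleftrightarrow> (\<exists>r. roots M = [r] \<and> card (orbit (map_phi M) r) = l)"
    by (auto simp: boundary_lengths_def boundaries_def length_Suc_conv)
  then show ?thesis
    unfolding partial_disks_def is_disk_def has_genus_0_iff by blast
qed

lemma card_orbit_funpow:
  assumes "permutation p"
  shows "bij_betw (\<lambda>j. (p ^^ j) x) {..<card (orbit p x)} (orbit p x)" "(p ^^ card (orbit p x)) x = x"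
    "0 < card (orbit p x)"
proof -
  have x: "x \<in> orbit p x" by (rule permutation_self_in_orbit[OF assms])
  let ?n = "funpow_dist1 p x x"
  have bij: "bij_betw (\<lambda>j. (p ^^ j) x) {..<?n} (orbit p x)"
    using inj_on_funpow_dist1[OF x] orbit_conv_funpow_dist1[OF x]
    by (simp only: bij_betw_def lessThan_atLeast0)
  then have "card (orbit p x) = ?n" by (metis bij_betw_same_card card_lessThan)
  with bij funpow_dist1_prop[OF x] show "bij_betw (\<lambda>j. (p ^^ j) x) {..<card (orbit p x)} (orbit p x)"
    "(p ^^ card (orbit p x)) x = x" "0 < card (orbit p x)" by simp_all
qed

lemma funpow_in_orbit_self:
  assumes "permutation p"
  shows "(p ^^ n) x \<in> orbit p x"
  by (rule funpow_in_orbit[OF permutation_self_in_orbit[OF assms]])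

text \<open>Merging only enlarges cycles: half-edges at a common vertex before glueing stay at a
  common vertex.\<close>

lemma orbit_subset_transpose_comp:
  assumes p: "permutation p" and ab: "b \<notin> orbit p a"
  shows "orbit p x \<subseteq> orbit (Transposition.transpose a b \<circ> p) x"
proof -
  let ?q = "Transposition.transpose a b \<circ> p"
  have q: "permutation ?q" using p by (simp add: permutation_compose permutation_swap_id)
  have m: "orbit ?q a = orbit p a \<union> orbit p b" by (rule orbit_transpose_comp_merge[OF p ab])
  have m': "orbit ?q x = orbit p a \<union> orbit p b" if "x \<in> orbit p a \<union> orbit p b"
    using that m orbit_eq_orbit_iff[OF q, of x a] by simp
  consider "x \<in> orbit p a" | "x \<in> orbit p b" | "x \<notin> orbit p a" "x \<notin> orbit p b" by blast
  then show ?thesis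
  proof cases
    case 1
    then show ?thesis using m' orbit_eq_orbit_iff[OF p, of x a] by simp
  next
    case 2
    then show ?thesis using m' orbit_eq_orbit_iff[OF p, of x b] by simp
  next
    case 3
    then have "a \<notin> orbit p x" "b \<notin> orbit p x"
      using orbit_eq_orbit_iff[OF p] permutation_self_in_orbit[OF p] by metis+
    then show ?thesis using orbit_transpose_comp_other[OF p] by simp
  qed
qed

text \<open>The vertex of the half-edge with index \<open>k\<close> on the boundary of
  \<open>M\<close> is identified with the root vertex of \<open>N\<close>. The new boundary follows
  \<open>M\<close> up to index \<open>k\<close>, runs once round \<open>N\<close>, and returns to
  \<open>M\<close>.\<close>

definition glue_maps :: "nat \<Rightarrow> 'a stuffed_map \<Rightarrow> 'a stuffed_map \<Rightarrow> 'a stuffed_map" where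
  "glue_maps k M N = swap_map ((map_phi M ^^ k) (hd (roots M))) (hd (roots N)) (roots M) (union_map M N)"

text \<open>The place where a glued map has to be cut to recover its two pieces.\<close>

definition last_visit :: "nat \<Rightarrow> 'a stuffed_map \<Rightarrow> nat" where
  "last_visit k M = Max {j. j < card (orbit (map_phi M) (hd (roots M))) \<and>
     (map_phi M ^^ j) (hd (roots M)) \<in> orbit (map_sigma M) ((map_phi M ^^ k) (hd (roots M)))}"

lemma weight_monomial_union:
  assumes "is_stuffed_map M" "is_stuffed_map N" "half_edges M \<inter> half_edges N = {}"
  shows "weight_monomial (union_map M N) = weight_monomial M + weight_monomial N"
proof -
  let ?w = "\<lambda>M f. (cell_genus M f, image_mset card (mset_set f))"
  have dis: "cells M \<inter> cells N = {}" by (rule cells_disjoint[OF assms])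
  have fin: "finite (cells M)" "finite (cells N)" using finite_cells assms by auto
  have "image_mset (?w (union_map M N)) (mset_set (cells M)) = image_mset (?w M) (mset_set (cells M))"
    using fin by (intro image_mset_cong) simp
  moreover have "image_mset (?w (union_map M N)) (mset_set (cells N)) = image_mset (?w N) (mset_set (cells N))"
    using fin dis by (intro image_mset_cong) auto
  ultimately show ?thesis
    unfolding weight_monomial_def union_map_simps mset_set_Union[OF fin dis] image_mset_union
    by (simp only:)
qed

lemma weight_monomial_swap: "weight_monomial (swap_map a b rs M) = weight_monomial M"
  by (simp add: weight_monomial_def)

text \<open>Away from \<open>x\<close> and \<open>y\<close> the swap changes nothing. Since swapping
  is an involution this serves both the glued map and the cut one.\<close>

lemma closed_in_swap:
  assumes "closed_in (swap_map x y rs L) K" "x \<notin> K" "y \<notin> K"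
  shows "closed_in L K"
proof (rule closed_inI)
  show "K \<subseteq> half_edges L" using closed_inD(1)[OF assms(1)] by simp
  show "map_sigma L z \<in> K" if "z \<in> K" for z
    using closed_inD(2)[OF assms(1) that] assms(2,3) by (auto simp: Transposition.transpose_def split: if_splits)
  show "map_alpha L z \<in> K" if "z \<in> K" for z
    using closed_inD(3)[OF assms(1) that] by simp
  show "v \<in> K" if "f \<in> cells L" "u \<in> \<Union>f" "u \<in> K" "v \<in> \<Union>f" for f u v
    using closed_inD(4)[OF assms(1) _ that(2-4)] that(1) by simp
qed

lemma connected_mapD:
  assumes "is_stuffed_map M" "connected_map M" "closed_in M K" "K \<noteq> {}"
  shows "K = half_edges M"
  using assms connected_map_iff by blast

section \<open>The glueing of two disks\<close>

locale glueing =
  fixes M N :: "'a stuffed_map" and r b :: 'a and k :: nat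
  assumes stuffed: "is_stuffed_map M" "is_stuffed_map N"
    and connected: "connected_map M" "connected_map N"
    and euler: "euler_char M = 2" "euler_char N = 2"
    and roots: "roots M = [r]" "roots N = [b]"
    and disjoint: "half_edges M \<inter> half_edges N = {}"
    and k: "k < card (orbit (map_phi M) r)"
begin

abbreviation "a \<equiv> (map_phi M ^^ k) r"
abbreviation "U \<equiv> union_map M N"
abbreviation "G \<equiv> glue_maps k M N"

lemmas MD = is_stuffed_mapD[OF stuffed(1)]
lemmas ND = is_stuffed_mapD[OF stuffed(2)]
lemmas U = is_stuffed_map_union[OF stuffed disjoint]
lemmas UD = is_stuffed_mapD[OF U]

lemma G_def: "G = swap_map a b [r] U"
  by (simp add: glue_maps_def roots)

lemma in_H: "r \<in> half_edges M" "b \<in> half_edges N" "a \<in> half_edges M" "a \<noteq> b"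
proof -
  show r: "r \<in> half_edges M" and b: "b \<in> half_edges N" using MD(9) ND(9) by (simp_all add: roots)
  have "a \<in> orbit (map_phi M) r" by (rule funpow_in_orbit_self[OF MD(14)])
  then show "a \<in> half_edges M" using permutes_orbit_subset[OF MD(4) r] by blast
  then show "a \<noteq> b" using b disjoint by blast
qed

lemma orbit_U:
  "x \<in> half_edges M \<Longrightarrow> orbit (map_phi U) x = orbit (map_phi M) x"
  "x \<in> half_edges N \<Longrightarrow> orbit (map_phi U) x = orbit (map_phi N) x"
  "x \<in> half_edges M \<Longrightarrow> orbit (map_sigma U) x = orbit (map_sigma M) x"
  "x \<in> half_edges N \<Longrightarrow> orbit (map_sigma U) x = orbit (map_sigma N) x"
  using orbit_perm_union[OF MD(4) ND(4) disjoint] orbit_perm_union[OF MD(2) ND(2) disjoint] by simp_all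

lemma orbit_subset_H:
  "x \<in> half_edges M \<Longrightarrow> orbit (map_phi M) x \<subseteq> half_edges M"
  "x \<in> half_edges N \<Longrightarrow> orbit (map_phi N) x \<subseteq> half_edges N"
  "x \<in> half_edges M \<Longrightarrow> orbit (map_sigma M) x \<subseteq> half_edges M"
  "x \<in> half_edges N \<Longrightarrow> orbit (map_sigma N) x \<subseteq> half_edges N"
  using permutes_orbit_subset[OF MD(4)] permutes_orbit_subset[OF ND(4)]
    permutes_orbit_subset[OF MD(2)] permutes_orbit_subset[OF ND(2)] by blast+

lemma b_notin: "b \<notin> orbit (map_phi U) a" "b \<notin> orbit (map_sigma U) a"
  using orbit_U(1,3)[OF in_H(3)] orbit_subset_H(1,3)[OF in_H(3)] in_H(2) disjoint by blast+

lemma a_in: "a \<in> orbit (map_phi U) r"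
  using orbit_U(1)[OF in_H(1)] funpow_in_orbit_self[OF MD(14)] by simp

lemma in_U: "a \<in> half_edges U" "b \<in> half_edges U" "r \<in> half_edges U" "roots U = [r, b]"
  using in_H by (simp_all add: roots)

lemma stuffed_G: "is_stuffed_map G"
  unfolding G_def using swap_map_iff[OF UD(1,4) in_U(1,2) a_in b_notin(1) in_U(3,4)] U by simp

lemma euler_G: "euler_char G = 2"
proof -
  have "length (roots U) = Suc (length [r])" by (simp add: roots)
  from swap_map_euler_char[OF UD(1,2) in_U(1,2) b_notin(2) this]
  show ?thesis unfolding G_def using euler_char_union[OF stuffed disjoint] euler by simp
qed

lemma closed_in_M:
  assumes "closed_in U K"
  shows "closed_in M (K \<inter> half_edges M)"
proof (rule closed_inI)
  show "map_sigma M x \<in> K \<inter> half_edges M" "map_alpha M x \<in> K \<inter> half_edges M" if "x \<in> K \<inter> half_edges M" for x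
    using closed_inD(2,3)[OF assms, of x] that MD(2,3) by (auto simp: perm_union_def permutes_in_image)
  show "y \<in> K \<inter> half_edges M" if "f \<in> cells M" "x \<in> \<Union>f" "x \<in> K \<inter> half_edges M" "y \<in> \<Union>f" for f x y
    using closed_inD(4)[OF assms, of f x y] that cells_subset(2)[OF stuffed(1), of f] by auto
qed simp

lemma closed_in_N:
  assumes "closed_in U K"
  shows "closed_in N (K \<inter> half_edges N)"
proof (rule closed_inI)
  have notM: "x \<notin> half_edges M" if "x \<in> half_edges N" for x using that disjoint by blast
  show "map_sigma N x \<in> K \<inter> half_edges N" "map_alpha N x \<in> K \<inter> half_edges N" if "x \<in> K \<inter> half_edges N" for x
    using closed_inD(2,3)[OF assms, of x] that ND(2,3) notM[of x] by (auto simp: perm_union_def permutes_in_image)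
  show "y \<in> K \<inter> half_edges N" if "f \<in> cells N" "x \<in> \<Union>f" "x \<in> K \<inter> half_edges N" "y \<in> \<Union>f" for f x y
    using closed_inD(4)[OF assms, of f x y] that cells_subset(2)[OF stuffed(2), of f] by auto
qed simp

text \<open>A closed set avoiding both points would be closed in the disjoint union, hence a union
  of whole pieces; but \<open>a\<close> lies in one piece and \<open>b\<close> in the other.\<close>

lemma closed_meets:
  assumes "closed_in G K" "K \<noteq> {}"
  shows "a \<in> K \<or> b \<in> K"
proof (rule ccontr)
  assume "\<not> (a \<in> K \<or> b \<in> K)"
  then have *: "a \<notin> K" "b \<notin> K" by auto
  have c: "closed_in U K" by (rule closed_in_swap[OF assms(1)[unfolded G_def] *])
  have "K \<inter> half_edges M = {}"
    using connected_mapD[OF stuffed(1) connected(1) closed_in_M[OF c]] * in_H(3) by blast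
  moreover have "K \<inter> half_edges N = {}"
    using connected_mapD[OF stuffed(2) connected(2) closed_in_N[OF c]] * in_H(2) by blast
  ultimately show False using closed_inD(1)[OF c] assms(2) by auto
qed

lemma orbit_sigma_G: "orbit (map_sigma G) a = orbit (map_sigma M) a \<union> orbit (map_sigma N) b"
  using orbit_transpose_comp_merge[OF UD(12) b_notin(2)] orbit_U(3)[OF in_H(3)] orbit_U(4)[OF in_H(2)]
  unfolding G_def by simp

text \<open>\<open>a\<close> and \<open>b\<close> now share a vertex, so a nonempty closed set
  contains both. Its complement is closed and contains neither, hence is empty.\<close>

lemma connected_G: "connected_map G"
  unfolding connected_map_iff[OF stuffed_G]
proof (intro conjI allI impI)
  show "half_edges G \<noteq> {}" using in_U unfolding G_def by auto
  fix K assume K: "closed_in G K \<and> K \<noteq> {}"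
  have "b \<in> orbit (map_sigma G) a"
    using orbit_sigma_G permutation_self_in_orbit[OF ND(12)] by simp
  then have ab: "a \<in> K \<longleftrightarrow> b \<in> K"
    by induction (use closed_in_iff[OF stuffed_G, of K] K in auto)
  have K': "closed_in G (half_edges G - K)"
    using closed_in_Diff[OF stuffed_G closed_in_half_edges[OF stuffed_G]] K by blast
  have "a \<in> K" "b \<in> K" using closed_meets[of K] K ab by blast+
  then have "half_edges G - K = {}" using closed_meets[OF K'] by blast
  then show "K = half_edges G" using K closed_inD(1)[of G K] by blast
qed

lemma orbit_phi_G: "orbit (map_phi G) r = orbit (map_phi M) r \<union> orbit (map_phi N) b"
  using swap_map_orbits(1)[OF UD(1,4) in_U(1,2) a_in b_notin(1), of "[r]"] orbit_U(1)[OF in_H(1)] orbit_U(2)[OF in_H(2)]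
  unfolding G_def by simp

lemma orbit_disjoint: "orbit (map_phi M) r \<inter> orbit (map_phi N) b = {}"
  using orbit_subset_H(1)[OF in_H(1)] orbit_subset_H(2)[OF in_H(2)] disjoint by blast

lemma finite_orbits: "finite (orbit (map_phi M) r)" "finite (orbit (map_phi N) b)"
  by (rule finite_orbit[OF permutation_self_in_orbit], rule MD ND)+

lemma card_orbit_G: "card (orbit (map_phi G) r) = card (orbit (map_phi M) r) + card (orbit (map_phi N) b)"
  unfolding orbit_phi_G using finite_orbits orbit_disjoint by (rule card_Un_disjoint)

lemma roots_G: "roots G = [r]"
  by (simp add: G_def)

lemma phi_G: "map_phi G x = map_phi U (Transposition.transpose a b x)"
  by (simp add: G_def)

lemma index_M:
  assumes "j < k"
  shows "(map_phi M ^^ j) r \<noteq> a"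
proof
  assume eq: "(map_phi M ^^ j) r = a"
  have "inj_on (\<lambda>j. (map_phi M ^^ j) r) {..<card (orbit (map_phi M) r)}"
    using card_orbit_funpow(1)[OF MD(14), of r] by (simp add: bij_betw_def)
  from inj_onD[OF this eq] show False using assms k by simp
qed

lemma M_orbit_in: "(map_phi M ^^ j) r \<in> half_edges M"
  using funpow_in_orbit_self[OF MD(14), of j r] orbit_subset_H(1)[OF in_H(1)] by blast

lemma N_orbit_in: "(map_phi N ^^ j) b \<in> half_edges N"
  using funpow_in_orbit_self[OF ND(14), of j b] orbit_subset_H(2)[OF in_H(2)] by blast

lemma funpow_phi_G_le:
  assumes "j \<le> k"
  shows "(map_phi G ^^ j) r = (map_phi M ^^ j) r"
  using assms
proof (induction j)
  case (Suc j)
  have "(map_phi M ^^ j) r \<noteq> a" using index_M[of j] Suc.prems by simp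
  moreover have "(map_phi M ^^ j) r \<noteq> b" using M_orbit_in[of j] in_H(2) disjoint by blast
  ultimately show ?case using Suc M_orbit_in[of j] by (simp add: phi_G perm_union_def)
qed simp

text \<open>The boundary leaves \<open>a\<close> towards \<open>map_phi N b\<close>. So the root
  \<open>b\<close> of \<open>N\<close> is reached at the end of the round trip, at \<open>j\<close>
  equal to the length of the boundary of \<open>N\<close>, rather than at \<open>j = 0\<close>,
  which is the place of \<open>a\<close>.\<close>

lemma funpow_phi_G_gt:
  assumes "0 < j" "j \<le> card (orbit (map_phi N) b)"
  shows "(map_phi G ^^ (k + j)) r = (map_phi N ^^ j) b"
  using assms
proof (induction j)
  case (Suc j)
  have notM: "x \<notin> half_edges M" if "x \<in> half_edges N" for x using that disjoint by blast
  show ?case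
  proof (cases "j = 0")
    case True
    have "map_phi G a = map_phi N b" using notM[OF in_H(2)] by (simp add: phi_G perm_union_def)
    then show ?thesis using funpow_phi_G_le[of k] True by simp
  next
    case False
    have inj: "inj_on (\<lambda>j. (map_phi N ^^ j) b) {..<card (orbit (map_phi N) b)}"
      using card_orbit_funpow(1)[OF ND(14), of b] by (simp add: bij_betw_def)
    have "(map_phi N ^^ j) b \<noteq> b"
    proof
      assume "(map_phi N ^^ j) b = b"
      then have "(map_phi N ^^ j) b = (map_phi N ^^ 0) b" by simp
      from inj_onD[OF inj this] show False using False Suc.prems by simp
    qed
    moreover have "(map_phi N ^^ j) b \<noteq> a" using notM[OF N_orbit_in[of j]] in_H(3) by metis
    ultimately have "map_phi G ((map_phi N ^^ j) b) = map_phi N ((map_phi N ^^ j) b)"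
      using notM[OF N_orbit_in[of j]] by (simp add: phi_G perm_union_def)
    moreover have "(map_phi G ^^ (k + j)) r = (map_phi N ^^ j) b" using Suc False by simp
    ultimately show ?thesis by simp
  qed
qed simp

lemma half_edges_G: "half_edges G = half_edges M \<union> half_edges N"
  by (simp add: G_def)

lemma of_kind_G: "of_kind \<kappa> G \<longleftrightarrow> of_kind \<kappa> M \<and> of_kind \<kappa> N"
  unfolding of_kind_iff G_def using cells_disjoint[OF stuffed disjoint]
  by (auto simp: ball_Un)

lemma weight_G: "weight_monomial G = weight_monomial M + weight_monomial N"
  unfolding G_def weight_monomial_swap by (rule weight_monomial_union[OF stuffed disjoint])

lemma normalized_G:
  assumes "normalized_map M" "normalized_map N"
  shows "normalized_map G"
  using assms unfolding G_def by (simp add: normalized_map_def)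

text \<open>The merged vertex consists of the vertex of \<open>a\<close> in \<open>M\<close> and
  that of \<open>b\<close> in \<open>N\<close>; the boundary of \<open>M\<close> meets the former
  only at \<open>a\<close>.\<close>

lemma visits_a:
  assumes "simple_upto (Suc k) M" "x \<in> orbit (map_phi M) r" "x \<in> orbit (map_sigma G) a"
  shows "x = a"
proof -
  have x: "x \<in> half_edges M" using assms(2) orbit_subset_H(1)[OF in_H(1)] by blast
  then have "x \<in> orbit (map_sigma M) a"
    using assms(3) orbit_sigma_G orbit_subset_H(4)[OF in_H(2)] disjoint by blast
  then show ?thesis using assms(1,2) unfolding simple_upto_def boundary_half_edges_root[OF roots(1)]
    by (simp add: roots)
qed

text \<open>By simplicity of \<open>M\<close> the half-edge \<open>a\<close> is at none of the first
  \<open>k\<close> vertices, and \<open>b\<close> lies in \<open>N\<close>, so these vertices are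
  unchanged. At index \<open>k\<close> simplicity fails because \<open>b\<close> has joined the
  vertex of \<open>a\<close>.\<close>

lemma simple_G:
  assumes s: "simple_upto (Suc k) M"
  shows "simple_upto k G" "\<not> simple_upto (Suc k) G"
proof -
  show "simple_upto k G"
    unfolding simple_upto_def boundary_half_edges_root[OF roots_G] roots_G list.sel
  proof (intro allI impI ballI)
    fix j x
    assume j: "j < k" and x: "x \<in> orbit (map_phi G) r" "x \<in> orbit (map_sigma G) ((map_phi G ^^ j) r)"
    let ?y = "(map_phi M ^^ j) r"
    have y: "(map_phi G ^^ j) r = ?y" using funpow_phi_G_le[of j] j by simp
    have sy: "z = ?y" if "z \<in> orbit (map_phi M) r" "z \<in> orbit (map_sigma M) ?y" for z
      using s that j unfolding simple_upto_def boundary_half_edges_root[OF roots(1)] by (simp add: roots)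
    have "a \<notin> orbit (map_sigma M) ?y"
      using sy[of a] funpow_in_orbit_self[OF MD(14)] index_M[OF j] by auto
    then have "a \<notin> orbit (map_sigma U) ?y" using orbit_U(3)[OF M_orbit_in] by simp
    moreover have "b \<notin> orbit (map_sigma U) ?y"
      using orbit_U(3)[OF M_orbit_in] orbit_subset_H(3)[OF M_orbit_in] in_H(2) disjoint by blast
    ultimately have "orbit (map_sigma G) ?y = orbit (map_sigma M) ?y"
      using orbit_transpose_comp_other[OF UD(12)] orbit_U(3)[OF M_orbit_in] unfolding G_def by simp
    then have xM: "x \<in> orbit (map_sigma M) ?y" using x(2) y by simp
    then have "x \<in> half_edges M" using orbit_subset_H(3)[OF M_orbit_in] by blast
    then have "x \<in> orbit (map_phi M) r"
      using x(1) orbit_phi_G orbit_subset_H(2)[OF in_H(2)] disjoint by blast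
    then show "x = (map_phi G ^^ j) r" using sy xM y by simp
  qed
  show "\<not> simple_upto (Suc k) G"
  proof
    assume "simple_upto (Suc k) G"
    moreover have "b \<in> orbit (map_phi G) r" "b \<in> orbit (map_sigma G) a"
      using orbit_phi_G orbit_sigma_G permutation_self_in_orbit[OF ND(14)] permutation_self_in_orbit[OF ND(12)] by simp_all
    ultimately have "b = a"
      unfolding simple_upto_def boundary_half_edges_root[OF roots_G] roots_G list.sel
      using funpow_phi_G_le[of k] by auto
    then show False using in_H(4) by simp
  qed
qed

text \<open>Beyond the index of \<open>b\<close> the boundary is back in \<open>M\<close>, where it
  meets the merged vertex only at \<open>a\<close>, whose index is \<open>k\<close>.\<close>

lemma last_visit_G:
  assumes "simple_upto (Suc k) M"
  shows "last_visit k G = k + card (orbit (map_phi N) b)" "(map_phi G ^^ last_visit k G) r = b"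
proof -
  let ?n = "card (orbit (map_phi N) b)"
  note n = card_orbit_funpow(2,3)[OF ND(14), of b]
  have a: "(map_phi G ^^ k) r = a" by (rule funpow_phi_G_le) simp
  have bk: "(map_phi G ^^ (k + ?n)) r = b" using funpow_phi_G_gt[of ?n] n by simp
  let ?L = "{j. j < card (orbit (map_phi G) r) \<and> (map_phi G ^^ j) r \<in> orbit (map_sigma G) a}"
  have "Max ?L = k + ?n"
  proof (rule Max_eqI)
    show "finite ?L" by (rule finite_subset[of _ "{..<card (orbit (map_phi G) r)}"]) auto
    show "k + ?n \<in> ?L"
      using k orbit_sigma_G permutation_self_in_orbit[OF ND(12)] by (simp add: card_orbit_G bk)
    fix j assume j: "j \<in> ?L"
    show "j \<le> k + ?n"
    proof (rule ccontr)
      assume gt: "\<not> j \<le> k + ?n"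
      have inj: "inj_on (\<lambda>j. (map_phi G ^^ j) r) {..<card (orbit (map_phi G) r)}"
        using card_orbit_funpow(1)[OF is_stuffed_mapD(14)[OF stuffed_G], of r] by (simp add: bij_betw_def)
      have "(map_phi G ^^ j) r \<notin> orbit (map_phi N) b"
      proof
        assume "(map_phi G ^^ j) r \<in> orbit (map_phi N) b"
        then obtain i where i: "i < ?n" "(map_phi G ^^ j) r = (map_phi N ^^ i) b"
          using card_orbit_funpow(1)[OF ND(14), of b] unfolding bij_betw_def by blast
        \<comment> \<open>On the glued boundary \<open>b\<close> has offset \<open>?n\<close>, not
          0, so the index 0 on \<open>N\<close> is replaced by the full length.\<close>
        define i' where "i' = (if i = 0 then ?n else i)"
        have "(map_phi N ^^ i') b = (map_phi N ^^ i) b" "0 < i'" "i' \<le> ?n"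
          using n i by (auto simp: i'_def)
        then have "(map_phi G ^^ j) r = (map_phi G ^^ (k + i')) r" using funpow_phi_G_gt[of i'] i by simp
        from inj_onD[OF inj this] have "j = k + i'" using j k \<open>i' \<le> ?n\<close> by (simp add: card_orbit_G)
        then show False using gt \<open>i' \<le> ?n\<close> by simp
      qed
      then have "(map_phi G ^^ j) r \<in> orbit (map_phi M) r"
        using funpow_in_orbit_self[OF is_stuffed_mapD(14)[OF stuffed_G], of j r] orbit_phi_G by blast
      with j have "(map_phi G ^^ j) r = a" using visits_a[OF assms] by blast
      then have "(map_phi G ^^ j) r = (map_phi G ^^ k) r" using a by simp
      from inj_onD[OF inj this] show False using j k gt by (simp add: card_orbit_G)
    qed
  qed
  then show "last_visit k G = k + ?n" unfolding last_visit_def roots_G list.sel a .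
  then show "(map_phi G ^^ last_visit k G) r = b" using bk by simp
qed

text \<open>The right-hand side involves only \<open>G\<close> and \<open>k\<close>: the glued map
  determines the disjoint union of its pieces.\<close>

lemma unglue:
  assumes "simple_upto (Suc k) M"
  shows "U = swap_map ((map_phi G ^^ k) (hd (roots G))) ((map_phi G ^^ last_visit k G) (hd (roots G)))
     [hd (roots G), (map_phi G ^^ last_visit k G) (hd (roots G))] G"
proof -
  have "swap_map a b [r, b] G = U\<lparr>roots := [r, b]\<rparr>" unfolding G_def by (rule swap_map_swap_map)
  also have "\<dots> = U" using roots by (intro stuffed_map.equality) simp_all
  finally show ?thesis using last_visit_G(2)[OF assms] funpow_phi_G_le[of k] by (simp add: roots_G)
qed

end

text \<open>The bound \<open>i < l - k\<close> says that the boundary of \<open>M\<close>, of length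
  \<open>l - i\<close>, still has a half-edge of index \<open>k\<close> to glue at.\<close>

definition glue_pairs :: "map_kind \<Rightarrow> nat \<Rightarrow> nat \<Rightarrow> ('a stuffed_map \<times> 'a stuffed_map) set" where
  "glue_pairs \<kappa> k l = {(M, N). (\<exists>i. 0 < i \<and> i < l - k \<and> M \<in> partial_disks \<kappa> (Suc k) (l - i) \<and> N \<in> partial_disks \<kappa> 0 i) \<and>
     normalized_map M \<and> normalized_map N \<and> half_edges M \<inter> half_edges N = {}}"

lemma glue_pairsE:
  assumes "(M, N) \<in> glue_pairs \<kappa> k l"
  obtains r b where "glueing M N r b k" "simple_upto (Suc k) M" "of_kind \<kappa> M" "of_kind \<kappa> N"
    "normalized_map M" "normalized_map N"
    "card (orbit (map_phi M) r) + card (orbit (map_phi N) b) = l"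
proof -
  obtain i where i: "0 < i" "i < l - k" and M: "M \<in> partial_disks \<kappa> (Suc k) (l - i)" and N: "N \<in> partial_disks \<kappa> 0 i"
    and nd: "normalized_map M" "normalized_map N" "half_edges M \<inter> half_edges N = {}"
    using assms unfolding glue_pairs_def by blast
  obtain r where r: "roots M = [r]" "card (orbit (map_phi M) r) = l - i" using M unfolding partial_disks_iff by blast
  obtain b where b: "roots N = [b]" "card (orbit (map_phi N) b) = i" using N unfolding partial_disks_iff by blast
  have "glueing M N r b k"
    using M N i r b nd(3) unfolding partial_disks_iff by unfold_locales auto
  then show ?thesis
    using that[of r b] M N i r b nd unfolding partial_disks_iff by auto
qed

lemma glue_maps_in:
  assumes "(M, N) \<in> glue_pairs \<kappa> k l"
  shows "glue_maps k M N \<in> partial_disks \<kappa> k l - partial_disks \<kappa> (Suc k) l" "normalized_map (glue_maps k M N)"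
    "half_edges (glue_maps k M N) = half_edges M \<union> half_edges N"
    "weight_monomial (glue_maps k M N) = weight_monomial M + weight_monomial N"
proof -
  obtain r b where g: "glueing M N r b k" and *: "simple_upto (Suc k) M" "of_kind \<kappa> M" "of_kind \<kappa> N"
    "normalized_map M" "normalized_map N"
    "card (orbit (map_phi M) r) + card (orbit (map_phi N) b) = l"
    using glue_pairsE[OF assms] by metis
  interpret glueing M N r b k by fact
  show "glue_maps k M N \<in> partial_disks \<kappa> k l - partial_disks \<kappa> (Suc k) l"
    using stuffed_G connected_G euler_G roots_G card_orbit_G simple_G[OF *(1)] of_kind_G *
    by (simp add: partial_disks_iff)
  show "normalized_map (glue_maps k M N)" by (rule normalized_G) fact+
  show "half_edges (glue_maps k M N) = half_edges M \<union> half_edges N" by (rule half_edges_G)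
  show "weight_monomial (glue_maps k M N) = weight_monomial M + weight_monomial N" by (rule weight_G)
qed

text \<open>\<open>M\<close> is the connected component of \<open>r\<close> in the union.\<close>

lemma union_map_half_edges_eq:
  assumes "is_stuffed_map M" "is_stuffed_map N" "half_edges M \<inter> half_edges N = {}" "normalized_map M"
    and "is_stuffed_map M'" "is_stuffed_map N'" "half_edges M' \<inter> half_edges N' = {}"
    and "connected_map M" "union_map M N = union_map M' N'" "r \<in> half_edges M" "r \<in> half_edges M'"
  shows "half_edges M \<subseteq> half_edges M'"
proof -
  let ?U = "union_map M N"
  have U: "is_stuffed_map ?U" by (rule is_stuffed_map_union) fact+
  have c: "closed_in ?U (half_edges M)" by (rule closed_in_union_map) fact+
  have "closed_in ?U (half_edges M')" unfolding assms(9) by (rule closed_in_union_map) fact+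
  with c have "closed_in ?U (half_edges M \<inter> half_edges M')" by (rule closed_in_Int)
  then have "closed_in (restrict_map_to (half_edges M) (roots M) ?U) (half_edges M \<inter> half_edges M')"
    by (subst closed_in_restrict[OF U c]) auto
  then have "closed_in M (half_edges M \<inter> half_edges M')"
    by (subst (asm) restrict_union_map) (use assms in auto)
  then show ?thesis using connected_mapD[OF assms(1,8)] assms(10,11) by blast
qed

text \<open>By \<open>unglue\<close> equal glued maps come from equal disjoint unions. The component
  of the common root fixes both sets of half-edges, and restriction then returns both
  pieces.\<close>

lemma inj_on_glue_maps: "inj_on (\<lambda>(M, N). glue_maps k M N) (glue_pairs \<kappa> k l)"
proof (rule inj_onI, clarify)
  fix M N M' N' assume MN: "(M, N) \<in> glue_pairs \<kappa> k l" "(M', N') \<in> glue_pairs \<kappa> k l"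
    and eq: "glue_maps k M N = glue_maps k M' N'"
  obtain r b where g: "glueing M N r b k" and s: "simple_upto (Suc k) M" and n: "normalized_map M" "normalized_map N"
    using glue_pairsE[OF MN(1)] by metis
  obtain r' b' where g': "glueing M' N' r' b' k" and s': "simple_upto (Suc k) M'" and n': "normalized_map M'" "normalized_map N'"
    using glue_pairsE[OF MN(2)] by metis
  note D = glueing.stuffed[OF g] glueing.disjoint[OF g] and D' = glueing.stuffed[OF g'] glueing.disjoint[OF g']
  have U: "union_map M N = union_map M' N'"
    using glueing.unglue[OF g s] glueing.unglue[OF g' s'] eq by simp
  have r: "r = r'" using glueing.roots_G[OF g] glueing.roots_G[OF g'] eq by simp
  have in_H: "r \<in> half_edges M" "r \<in> half_edges M'" using glueing.in_H(1)[OF g] glueing.in_H(1)[OF g'] r by simp_all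
  have "half_edges M \<subseteq> half_edges M'"
    by (rule union_map_half_edges_eq[OF D n(1) D' glueing.connected(1)[OF g] U in_H])
  moreover have "half_edges M' \<subseteq> half_edges M"
    by (rule union_map_half_edges_eq[OF D' n'(1) D glueing.connected(1)[OF g'] U[symmetric] in_H(2,1)])
  ultimately have H: "half_edges M = half_edges M'" by blast
  have "half_edges M \<union> half_edges N = half_edges M' \<union> half_edges N'"
    using arg_cong[OF U, of half_edges] by simp
  then have H': "half_edges N = half_edges N'" using H D(3) D'(3) by blast
  have roots: "roots M = roots M'" "roots N = roots N'"
    using arg_cong[OF U, of roots] glueing.roots[OF g] glueing.roots[OF g'] by simp_all
  have "M = restrict_map_to (half_edges M) (roots M) (union_map M N)" using restrict_union_map[OF D n(1)] by simp
  also have "\<dots> = M'" unfolding U H roots by (rule restrict_union_map[OF D' n'(1)])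
  finally have "M = M'" .
  have "N = restrict_map_to (half_edges N) (roots N) (union_map M N)" using restrict_union_map2[OF D n(2)] by simp
  also have "\<dots> = N'" unfolding U H' roots by (rule restrict_union_map2[OF D' n'(2)])
  finally show "M = M' \<and> N = N'" using \<open>M = M'\<close> by simp
qed

text \<open>Surjectivity of glueing. The cut map has Euler characteristic 4 and must fall apart;
  connectedness of \<open>M\<close> forces exactly two components, one containing \<open>a\<close>
  and one containing \<open>b\<close>.\<close>

lemma cut_map:
  fixes M :: "'a stuffed_map"
  assumes M: "M \<in> partial_disks \<kappa> k l" "M \<notin> partial_disks \<kappa> (Suc k) l" and norm: "normalized_map M" and kl: "k < l"
  shows "\<exists>(M1, M2) \<in> glue_pairs \<kappa> k l. M = glue_maps k M1 M2"
proof -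
  have stuffed: "is_stuffed_map M" and conn: "connected_map M" and euler: "euler_char M = 2"
    and kind: "of_kind \<kappa> M" and simple: "simple_upto k M" and nsimple: "\<not> simple_upto (Suc k) M"
    using M unfolding partial_disks_iff by auto
  obtain r where r: "roots M = [r]" "card (orbit (map_phi M) r) = l" using M unfolding partial_disks_iff by blast
  note MD = is_stuffed_mapD[OF stuffed]
  define B where "B j = (map_phi M ^^ j) r" for j
  have bij: "bij_betw B {..<l} (orbit (map_phi M) r)"
    using card_orbit_funpow(1)[OF MD(14), of r] unfolding r(2) B_def .
  have Binj: "i = j" if "B i = B j" "i < l" "j < l" for i j
    using bij that unfolding bij_betw_def by (auto dest: inj_onD)
  have B_in: "B j \<in> orbit (map_phi M) r" for j unfolding B_def by (rule funpow_in_orbit_self[OF MD(14)])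
  have rH: "r \<in> half_edges M" using MD(9) r by simp
  have BH: "B j \<in> half_edges M" for j using B_in permutes_orbit_subset[OF MD(4) rH] by blast
  have sD: "x = B j" if "j < k" "x \<in> orbit (map_phi M) r" "x \<in> orbit (map_sigma M) (B j)" for x j
    using simple that unfolding simple_upto_def boundary_half_edges_root[OF r(1)] by (simp add: r B_def)
  define L where "L = {j. j < l \<and> B j \<in> orbit (map_sigma M) (B k)}"
  define i where "i = Max L"
  have finL: "finite L" unfolding L_def by simp
  have kL: "k \<in> L" using kl permutation_self_in_orbit[OF MD(12)] by (simp add: L_def)
  have iL: "i \<in> L" unfolding i_def using finL kL by (intro Max_in) auto
  have max: "j \<le> i" if "j \<in> L" for j unfolding i_def using finL that by simp
  \<comment> \<open>A visit before index \<open>k\<close> would make one of the first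
    \<open>k\<close> vertices be visited again by \<open>B k\<close>.\<close>
  have L_ge: "k \<le> j" if "j \<in> L" for j
  proof (rule ccontr)
    assume "\<not> k \<le> j"
    moreover have "B k \<in> orbit (map_sigma M) (B j)"
      using that orbit_eq_orbit_iff[OF MD(12)] permutation_self_in_orbit[OF MD(12)] unfolding L_def by blast
    ultimately have "B k = B j" using sD B_in by simp
    then show False using Binj[of k j] kl that \<open>\<not> k \<le> j\<close> by (simp add: L_def)
  qed
  obtain x where x: "x \<in> orbit (map_phi M) r" "x \<in> orbit (map_sigma M) (B k)" "x \<noteq> B k"
  proof -
    obtain j x where "j < Suc k" "x \<in> orbit (map_phi M) r" "x \<in> orbit (map_sigma M) (B j)" "x \<noteq> B j"
      using nsimple unfolding simple_upto_def boundary_half_edges_root[OF r(1)] by (auto simp: r B_def)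
    moreover from this have "j = k" using sD[of j x] by (metis less_Suc_eq)
    ultimately show ?thesis using that by blast
  qed
  obtain j where j: "j < l" "x = B j" using x(1) bij unfolding bij_betw_def by blast
  then have "j \<in> L" "j \<noteq> k" using x by (auto simp: L_def)
  then have ki: "k < i" using max L_ge le_neq_implies_less order.strict_trans2 by metis
  have il: "i < l" using iL by (simp add: L_def)
  let ?a = "B k" and ?b = "B i"
  have ab: "?a \<noteq> ?b" using Binj[of k i] kl il ki by auto
  define N where "N = swap_map ?a ?b [r, ?b] M"
  have ND: "half_edges N = half_edges M" "roots N = [r, ?b]" "cells N = cells M"
    "map_phi N = map_phi M \<circ> Transposition.transpose ?a ?b" "map_sigma N = Transposition.transpose ?a ?b \<circ> map_sigma M"
    "map_alpha N = map_alpha M" "cell_genus N = cell_genus M"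
    by (simp_all add: N_def)
  have finN: "finite (half_edges N)" unfolding ND by (rule MD(1))
  have phiN: "map_phi N permutes half_edges N" unfolding ND by (rule permutes_comp_transpose[OF MD(4) BH BH])
  have sigN: "map_sigma N permutes half_edges N" unfolding ND by (rule permutes_transpose_comp[OF MD(2) BH BH])
  have pN: "permutation (map_phi N)" "permutation (map_sigma N)" using finN phiN sigN by (auto simp: permutation_permutes)
  have aN: "?a \<in> half_edges N" "?b \<in> half_edges N" "r \<in> half_edges N" using BH rH ND by simp_all
  have "?b \<in> orbit (map_phi M) ?a"
    using B_in orbit_eq_orbit_iff[OF MD(14)] by blast
  then have bphi: "?b \<notin> orbit (map_phi N) ?a"
    unfolding ND by (rule orbit_comp_transpose_split[OF MD(14) ab])
  have "?b \<in> orbit (map_sigma M) ?a" using iL by (simp add: L_def)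
  then have bsig: "?b \<notin> orbit (map_sigma N) ?a"
    unfolding ND by (rule orbit_transpose_comp_split[OF MD(12) ab])
  have pow: "(map_phi N ^^ j) r = B j" if "j \<le> k" for j
    using that
  proof (induction j)
    case 0 show ?case by (simp add: B_def)
  next
    case (Suc j)
    have "B j \<noteq> ?a" "B j \<noteq> ?b" using Binj[of j k] Binj[of j i] Suc.prems kl il ki by auto
    then have "map_phi N (B j) = map_phi M (B j)" by (simp add: ND)
    then show ?case using Suc by (simp add: B_def)
  qed
  have ar: "?a \<in> orbit (map_phi N) r" using pow[of k] funpow_in_orbit_self[OF pN(1), of k r] by simp
  \<comment> \<open>The second boundary of the cut map consists of the indices \<open>k + 1\<close>
    to \<open>i\<close>, and \<open>B i\<close> is its root.\<close>
  have pow2: "(map_phi N ^^ j) ?b = B (k + j)" if "0 < j" "k + j \<le> i" for j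
    using that
  proof (induction j)
    case (Suc j)
    show ?case
    proof (cases "j = 0")
      case True
      then show ?thesis by (simp add: ND B_def)
    next
      case False
      have "B (k + j) \<noteq> ?a" "B (k + j) \<noteq> ?b"
        using Binj[of "k + j" k] Binj[of "k + j" i] Suc.prems kl il ki False by auto
      then have "map_phi N (B (k + j)) = map_phi M (B (k + j))" by (simp add: ND)
      then show ?thesis using Suc False by (simp add: B_def)
    qed
  qed simp
  have "swap_map ?a ?b [r] N = M"
    unfolding N_def swap_map_swap_map using r(1) by (intro stuffed_map.equality) simp_all
  then have MN: "M = swap_map ?a ?b [r] N" ..
  have stuffedN: "is_stuffed_map N"
    using swap_map_iff[OF finN phiN aN(1,2) ar bphi aN(3) ND(2)] stuffed MN by simp
  have "length (roots N) = Suc (length [r])" by (simp add: ND)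
  from swap_map_euler_char[OF finN sigN aN(1,2) bsig this] have eulerN: "euler_char N = 4"
    using euler MN by simp
  \<comment> \<open>Only the vertex of \<open>a\<close> and \<open>b\<close> was cut, so every
    component of \<open>N\<close> contains one of the two: at most two components arise.\<close>
  have meets: "?a \<in> K \<or> ?b \<in> K" if K: "closed_in N K" "K \<noteq> {}" for K
  proof (rule ccontr)
    assume *: "\<not> (?a \<in> K \<or> ?b \<in> K)"
    then have "closed_in M K" using closed_in_swap[OF K(1)[unfolded N_def]] by blast
    then have "K = half_edges M" using connected_mapD[OF stuffed conn] K(2) by blast
    then show False using * BH by blast
  qed
  note Diff = closed_in_Diff[OF stuffedN closed_in_half_edges[OF stuffedN]]
  \<comment> \<open>The decisive use of the bound: 4 exceeds 2.\<close>
  have "\<not> connected_map N" using euler_char_le_2[OF stuffedN] eulerN by auto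
  moreover have "half_edges N \<noteq> {}" using aN by blast
  ultimately obtain K0 where K0: "closed_in N K0" "K0 \<noteq> {}" "K0 \<noteq> half_edges N"
    using connected_map_iff[OF stuffedN] by blast
  have K0': "half_edges N - K0 \<noteq> {}" using K0 closed_inD(1)[OF K0(1)] by blast
  \<comment> \<open>A proper closed set and its complement each contain one of the two points; the
    one with \<open>a\<close> is taken.\<close>
  obtain K where K: "closed_in N K" "?a \<in> K" "?b \<notin> K"
  proof (cases "?a \<in> K0")
    case True
    then have "?b \<notin> K0" using meets[OF Diff[OF K0(1)] K0'] by blast
    then show ?thesis using that K0 True by blast
  next
    case False
    then have "?b \<in> K0" using meets[OF K0(1,2)] by blast
    then show ?thesis using that[OF Diff[OF K0(1)]] aN False by blast
  qed
  have KH: "K \<subseteq> half_edges N" by (rule closed_inD(1)[OF K(1)])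
  have phiK: "(map_phi N ^^ j) x \<in> K \<longleftrightarrow> x \<in> K" for j x
    by (induction j) (simp_all add: closed_in_iff(3)[OF stuffedN K(1)])
  have rK: "r \<in> K" using phiK[of k r] pow[of k] K(2) by simp
  define K' where "K' = half_edges N - K"
  have cK': "closed_in N K'" unfolding K'_def by (rule Diff[OF K(1)])
  have bK': "?b \<in> K'" using aN K(3) by (simp add: K'_def)
  define M1 where "M1 = restrict_map_to K [r] N"
  define M2 where "M2 = restrict_map_to K' [?b] N"
  have rt: "set (roots N) \<inter> K = {r}" "set (roots N) \<inter> K' = {?b}" using rK K(3) bK' by (auto simp: ND K'_def)
  have st: "is_stuffed_map M1" "is_stuffed_map M2"
    unfolding M1_def M2_def
    by (rule is_stuffed_map_restrict[OF stuffedN K(1) rt(1)], rule is_stuffed_map_restrict[OF stuffedN cK' rt(2)])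
  have H: "half_edges M1 = K" "half_edges M2 = K'" "roots M1 = [r]" "roots M2 = [?b]" by (simp_all add: M1_def M2_def)
  have dis: "half_edges M1 \<inter> half_edges M2 = {}" unfolding H K'_def by blast
  have normN: "normalized_map N" using norm by (simp add: normalized_map_def ND)
  have un: "union_map M1 M2 = N"
    unfolding M1_def M2_def K'_def by (rule union_restrict_map[OF stuffedN K(1) normN]) (simp add: ND)
  have conn1: "connected_map M1"
    unfolding connected_map_iff[OF st(1)]
  proof (intro conjI allI impI)
    show "half_edges M1 \<noteq> {}" using H rK by blast
    fix J assume J: "closed_in M1 J \<and> J \<noteq> {}"
    then have JK: "J \<subseteq> K" using closed_inD(1)[of M1 J] H by simp
    then have cJ: "closed_in N J" using J closed_in_restrict[OF stuffedN K(1)] unfolding M1_def by blast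
    then have "?a \<in> J" using meets[OF cJ] J JK K(3) by blast
    then have "?a \<notin> K - J" "?b \<notin> K - J" using K(3) by auto
    then have "K - J = {}" using meets[OF closed_in_Diff[OF stuffedN K(1) cJ]] by blast
    then show "J = half_edges M1" using JK H by blast
  qed
  have conn2: "connected_map M2"
    unfolding connected_map_iff[OF st(2)]
  proof (intro conjI allI impI)
    show "half_edges M2 \<noteq> {}" using H bK' by blast
    fix J assume J: "closed_in M2 J \<and> J \<noteq> {}"
    then have JK: "J \<subseteq> K'" using closed_inD(1)[of M2 J] H by simp
    then have cJ: "closed_in N J" using J closed_in_restrict[OF stuffedN cK'] unfolding M2_def by blast
    have aK': "?a \<notin> K'" using K(2) by (simp add: K'_def)
    then have "?b \<in> J" using meets[OF cJ] J JK by blast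
    then have "?a \<notin> K' - J" "?b \<notin> K' - J" using aK' by auto
    then have "K' - J = {}" using meets[OF closed_in_Diff[OF stuffedN cK' cJ]] by blast
    then show "J = half_edges M2" using JK H by blast
  qed
  have "euler_char M1 + euler_char M2 = 4" using euler_char_union[OF st dis] un eulerN by simp
  \<comment> \<open>Two numbers that are at most 2 and add up to 4: both pieces are planar.\<close>
  then have eu: "euler_char M1 = 2" "euler_char M2 = 2"
    using euler_char_le_2[OF st(1) conn1] euler_char_le_2[OF st(2) conn2] by simp_all
  have orb: "orbit (map_phi M1) x = orbit (map_phi N) x" "orbit (map_sigma M1) x = orbit (map_sigma N) x" if "x \<in> K" for x
    unfolding M1_def restrict_map_to_simps
    using orbit_perm_restrict[OF that] closed_in_iff[OF stuffedN K(1)] by blast+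
  have orb2: "orbit (map_phi M2) ?b = orbit (map_phi N) ?b"
    unfolding M2_def restrict_map_to_simps
    using orbit_perm_restrict[OF bK'] closed_in_iff[OF stuffedN cK'] by blast
  have pow1: "(map_phi M1 ^^ j) r = (map_phi N ^^ j) r" for j
    by (induction j) (simp_all add: M1_def perm_restrict_def phiK rK)
  note so = swap_map_orbits(1)[OF finN phiN aN(1,2) ar bphi, of "[r]"] swap_map_orbits(3)[OF finN phiN aN(1,2) ar bphi]
  have orM: "orbit (map_phi M) r = orbit (map_phi N) r \<union> orbit (map_phi N) ?b"
    using so(1) MN by simp
  have orK: "orbit (map_phi N) r \<subseteq> K"
  proof
    fix x assume "x \<in> orbit (map_phi N) r"
    then show "x \<in> K" by induction (simp_all add: closed_in_iff(3)[OF stuffedN K(1)] rK)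
  qed
  have obK: "orbit (map_phi N) ?b \<inter> K = {}"
  proof -
    have "x \<notin> K" if "x \<in> orbit (map_phi N) ?b" for x
      using that by induction (simp_all add: closed_in_iff(3)[OF stuffedN K(1)] K(3))
    then show ?thesis by blast
  qed
  have fin: "finite (orbit (map_phi N) x)" for x by (rule finite_orbit[OF permutation_self_in_orbit[OF pN(1)]])
  have "card (orbit (map_phi M) r) = card (orbit (map_phi N) r) + card (orbit (map_phi N) ?b)"
    unfolding orM using orK obK by (intro card_Un_disjoint fin) blast
  then have l: "card (orbit (map_phi M1) r) + card (orbit (map_phi M2) ?b) = l"
    using r orb(1)[OF rK] orb2 by simp
  have l2: "0 < card (orbit (map_phi M2) ?b)" by (rule card_orbit_funpow(3)) (rule is_stuffed_mapD(14)[OF st(2)])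
  have l1: "k < card (orbit (map_phi M1) r)"
  proof -
    have "B ` {..k} \<subseteq> orbit (map_phi N) r"
      using pow funpow_in_orbit_self[OF pN(1), of _ r] by (metis atMost_iff image_subsetI)
    then have "card (B ` {..k}) \<le> card (orbit (map_phi N) r)" by (intro card_mono fin)
    moreover have "inj_on B {..k}" using Binj kl by (intro inj_onI) auto
    ultimately show ?thesis using orb(1)[OF rK] by (simp add: card_image)
  qed
  have simple1: "simple_upto (Suc k) M1"
    unfolding simple_upto_def boundary_half_edges_root[OF H(3)] H list.sel
  proof (intro allI impI ballI)
    fix j x assume j: "j < Suc k" and x: "x \<in> orbit (map_phi M1) r" "x \<in> orbit (map_sigma M1) ((map_phi M1 ^^ j) r)"
    have Bj: "(map_phi M1 ^^ j) r = B j" using pow1 pow j by simp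
    have xr: "x \<in> orbit (map_phi N) r" using x(1) orb(1)[OF rK] by simp
    then have xM: "x \<in> orbit (map_phi M) r" unfolding orM by blast
    have "B j \<in> K" using phiK[of j r] rK pow j by simp
    then have "x \<in> orbit (map_sigma N) (B j)" using x(2) orb(2) Bj by simp
    then have xs: "x \<in> orbit (map_sigma M) (B j)"
      using orbit_subset_transpose_comp[OF pN(2) bsig, of "B j"] MN by (metis subsetD swap_map_simps(2))
    show "x = (map_phi M1 ^^ j) r"
    proof (cases "j = k")
      case False
      then show ?thesis using sD[of j x] xM xs j Bj by simp
    next
      case True
      obtain m where m: "m < l" "x = B m" using xM bij unfolding bij_betw_def by blast
      then have mL: "m \<in> L" using xs True by (simp add: L_def)
      \<comment> \<open>Here the choice of the last visit enters: a visit after index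
        \<open>k\<close> has index at most \<open>i\<close>, so it lies on the boundary of the
        second piece.\<close>
      have "m \<le> k"
      proof (rule ccontr)
        assume "\<not> m \<le> k"
        then have "(map_phi N ^^ (m - k)) ?b = x" using pow2[of "m - k"] max[OF mL] m by simp
        then have "x \<in> orbit (map_phi N) ?b" using funpow_in_orbit_self[OF pN(1)] by blast
        then show False using xr orK obK by blast
      qed
      then have "m = k" using L_ge[OF mL] by simp
      then show ?thesis using m True Bj by simp
    qed
  qed
  have "of_kind \<kappa> M1" "of_kind \<kappa> M2"
    using kind unfolding of_kind_iff M1_def M2_def by (auto simp: ND)
  then have "M1 \<in> partial_disks \<kappa> (Suc k) (card (orbit (map_phi M1) r))" "M2 \<in> partial_disks \<kappa> 0 (card (orbit (map_phi M2) ?b))"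
    unfolding partial_disks_iff using st conn1 conn2 eu H simple1 by (auto simp: simple_upto_def)
  moreover have "normalized_map M1" "normalized_map M2" by (auto simp: normalized_map_def M1_def M2_def)
  moreover have "card (orbit (map_phi M1) r) = l - card (orbit (map_phi M2) ?b)"
    "card (orbit (map_phi M2) ?b) < l - k" using l l1 by simp_all
  ultimately have "(M1, M2) \<in> glue_pairs \<kappa> k l"
    using l2 dis unfolding glue_pairs_def by auto
  moreover have "M = glue_maps k M1 M2"
    unfolding glue_maps_def un H list.sel pow1 using pow[of k] MN by simp
  ultimately show ?thesis by blast
qed

theorem bij_betw_glue_maps:
  assumes "k < l"
  shows "bij_betw (\<lambda>(M, N). glue_maps k M N) (glue_pairs \<kappa> k l)
     {M \<in> partial_disks \<kappa> k l - partial_disks \<kappa> (Suc k) l. normalized_map M}"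
  unfolding bij_betw_def
proof (intro conjI inj_on_glue_maps equalityI subsetI)
  fix M assume "M \<in> (\<lambda>(M, N). glue_maps k M N) ` glue_pairs \<kappa> k l"
  then show "M \<in> {M \<in> partial_disks \<kappa> k l - partial_disks \<kappa> (Suc k) l. normalized_map M}"
    by (elim imageE) (auto simp: glue_maps_in(2) dest: glue_maps_in(1))
next
  fix M :: "'a stuffed_map" assume "M \<in> {M \<in> partial_disks \<kappa> k l - partial_disks \<kappa> (Suc k) l. normalized_map M}"
  then show "M \<in> (\<lambda>(M, N). glue_maps k M N) ` glue_pairs \<kappa> k l"
    using cut_map[of M \<kappa> k l] assms by blast
qed

section \<open>Counting labelled disks\<close>

lemma map_isoD:
  assumes "map_iso M M' \<theta>"
  shows "inj_on \<theta> (half_edges M)" "half_edges M' = \<theta> ` half_edges M"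
    "\<And>h. h \<in> half_edges M \<Longrightarrow> map_sigma M' (\<theta> h) = \<theta> (map_sigma M h)"
    "\<And>h. h \<in> half_edges M \<Longrightarrow> map_alpha M' (\<theta> h) = \<theta> (map_alpha M h)"
    "\<And>h. h \<in> half_edges M \<Longrightarrow> map_phi M' (\<theta> h) = \<theta> (map_phi M h)"
    "roots M' = map \<theta> (roots M)" "cells M' = (`) ((`) \<theta>) ` cells M"
    "\<And>f. f \<in> cells M \<Longrightarrow> cell_genus M' ((`) \<theta> ` f) = cell_genus M f"
  using assms unfolding map_iso_def bij_betw_def by simp_all

lemma map_iso_cong:
  assumes "is_stuffed_map M" "\<And>h. h \<in> half_edges M \<Longrightarrow> \<theta> h = \<theta>' h"
  shows "map_iso M M' \<theta> \<longleftrightarrow> map_iso M M' \<theta>'"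
proof -
  note M = is_stuffed_mapD[OF assms(1)]
  have c: "\<theta> ` c = \<theta>' ` c" if "f \<in> cells M" "c \<in> f" for f c
    using cells_subset(2)[OF assms(1) that(1)] that(2) assms(2) by (intro image_cong) auto
  have f: "(`) \<theta> ` f = (`) \<theta>' ` f" if "f \<in> cells M" for f
    by (rule image_cong[OF refl c[OF that]])
  then have cells: "(`) ((`) \<theta>) ` cells M = (`) ((`) \<theta>') ` cells M" by (rule image_cong[OF refl])
  have roots: "map \<theta> (roots M) = map \<theta>' (roots M)" using assms(2) M(9) by auto
  have bij: "bij_betw \<theta> (half_edges M) (half_edges M') \<longleftrightarrow> bij_betw \<theta>' (half_edges M) (half_edges M')"
    by (rule bij_betw_cong) (rule assms(2))
  have h: "\<theta> (map_sigma M h) = \<theta>' (map_sigma M h)" "\<theta> (map_alpha M h) = \<theta>' (map_alpha M h)"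
    "\<theta> (map_phi M h) = \<theta>' (map_phi M h)" "\<theta> h = \<theta>' h" if "h \<in> half_edges M" for h
    using that M(2-4) assms(2) by (simp_all add: permutes_in_image)
  show ?thesis
    unfolding map_iso_def roots cells bij using f h by simp
qed

lemma map_iso_id: "map_iso M M id"
  by (simp add: map_iso_def)

lemma map_iso_comp:
  assumes M: "is_stuffed_map M" and 1: "map_iso M M' \<theta>" and 2: "map_iso M' M'' \<eta>"
  shows "map_iso M M'' (\<eta> \<circ> \<theta>)"
proof -
  note a = map_isoD[OF 1] and b = map_isoD[OF 2]
  have im: "(`) (\<eta> \<circ> \<theta>) = (`) \<eta> \<circ> (`) \<theta>" by (simp add: fun_eq_iff image_comp)
  have im2: "(`) ((`) (\<eta> \<circ> \<theta>)) = (`) ((`) \<eta>) \<circ> (`) ((`) \<theta>)" by (simp add: fun_eq_iff im image_comp)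
  have "bij_betw (\<eta> \<circ> \<theta>) (half_edges M) (half_edges M'')"
    using 1 2 unfolding map_iso_def by (intro bij_betw_trans[of \<theta> _ "half_edges M'"]) simp_all
  moreover have "cell_genus M'' ((`) (\<eta> \<circ> \<theta>) ` f) = cell_genus M f" if "f \<in> cells M" for f
  proof -
    have "(`) (\<eta> \<circ> \<theta>) ` f = (`) \<eta> ` ((`) \<theta> ` f)" unfolding im by (rule image_comp[symmetric])
    moreover have "(`) \<theta> ` f \<in> cells M'" using that unfolding a(7) by (rule imageI)
    ultimately show ?thesis using a(8)[OF that] b(8) by simp
  qed
  moreover have "(`) ((`) (\<eta> \<circ> \<theta>)) ` cells M = cells M''"
    unfolding im2 b(7) a(7) by (simp add: image_comp)
  ultimately show ?thesis
    unfolding map_iso_def using a b by simp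
qed

lemma map_iso_inv:
  assumes M: "is_stuffed_map M" and 1: "map_iso M M' \<theta>"
  shows "map_iso M' M (inv_into (half_edges M) \<theta>)"
proof -
  note a = map_isoD[OF 1] and D = is_stuffed_mapD[OF M]
  let ?\<eta> = "inv_into (half_edges M) \<theta>"
  have inv: "?\<eta> (\<theta> h) = h" if "h \<in> half_edges M" for h by (rule inv_into_f_f[OF a(1) that])
  have c: "?\<eta> ` (\<theta> ` c) = c" if "c \<subseteq> half_edges M" for c
    using that inv by (force simp: image_image)
  have f: "(`) ?\<eta> ` ((`) \<theta> ` f) = f" if "f \<in> cells M" for f
  proof -
    have "?\<eta> ` (\<theta> ` x) = x" if "x \<in> f" for x
      using cells_subset(2)[OF M \<open>f \<in> cells M\<close>] that by (intro c) blast
    then show ?thesis by (simp add: image_image)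
  qed
  have "(`) ((`) ?\<eta>) ` cells M' = (\<lambda>f. (`) ?\<eta> ` ((`) \<theta> ` f)) ` cells M"
    unfolding a(7) by (simp add: image_image)
  also have "\<dots> = cells M" using f by simp
  finally have cells: "(`) ((`) ?\<eta>) ` cells M' = cells M" .
  have "cell_genus M ((`) ?\<eta> ` g) = cell_genus M' g" if "g \<in> cells M'" for g
  proof -
    obtain f' where "f' \<in> cells M" "g = (`) \<theta> ` f'" using \<open>g \<in> cells M'\<close> unfolding a(7) by blast
    then show ?thesis using f a(8) by simp
  qed
  moreover have "map ?\<eta> (roots M') = roots M"
    unfolding a(6) map_map using D(9) inv by (intro map_idI) auto
  moreover have "bij_betw ?\<eta> (half_edges M') (half_edges M)"
    using 1 unfolding map_iso_def by (blast intro: bij_betw_inv_into)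
  moreover have "?\<eta> (map_sigma M' h) = map_sigma M (?\<eta> h) \<and> ?\<eta> (map_alpha M' h) = map_alpha M (?\<eta> h) \<and>
    ?\<eta> (map_phi M' h) = map_phi M (?\<eta> h)" if "h \<in> half_edges M'" for h
  proof -
    obtain x where x: "x \<in> half_edges M" "h = \<theta> x" using \<open>h \<in> half_edges M'\<close> unfolding a(2) by blast
    then have "map_sigma M x \<in> half_edges M" "map_alpha M x \<in> half_edges M" "map_phi M x \<in> half_edges M"
      using D(2-4) by (simp_all add: permutes_in_image)
    then show ?thesis using x inv a(3-5) by simp
  qed
  ultimately show ?thesis unfolding map_iso_def using cells by blast
qed

lemma equiv_map_iso_rel: "equiv {M :: 'a stuffed_map. is_stuffed_map M} map_iso_rel"
proof (rule equivI)
  show "map_iso_rel \<subseteq> {M :: 'a stuffed_map. is_stuffed_map M} \<times> {M. is_stuffed_map M}"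
    by (auto simp: map_iso_rel_def)
  show "refl_on {M :: 'a stuffed_map. is_stuffed_map M} map_iso_rel"
    using map_iso_id by (auto simp: refl_on_def map_iso_rel_def)
  show "sym (map_iso_rel :: ('a stuffed_map \<times> 'a stuffed_map) set)"
    using map_iso_inv by (fastforce simp: sym_def map_iso_rel_def)
  show "trans (map_iso_rel :: ('a stuffed_map \<times> 'a stuffed_map) set)"
    using map_iso_comp by (fastforce simp: trans_def map_iso_rel_def)
qed

lemma orbit_image:
  assumes "p permutes H" "finite H" "h \<in> H" "\<And>x. x \<in> H \<Longrightarrow> p' (\<theta> x) = \<theta> (p x)"
  shows "orbit p' (\<theta> h) = \<theta> ` orbit p h"
proof -
  have "permutation p" using assms by (auto simp: permutation_permutes)
  then have "h \<in> orbit p h" by (rule permutation_self_in_orbit)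
  then show ?thesis
    by (rule orbit_inverse[symmetric]) (use permutes_orbit_subset[OF assms(1,3)] assms(4) in blast)
qed

lemma cycles_of_image:
  assumes "p permutes H" "finite H" "\<And>x. x \<in> H \<Longrightarrow> p' (\<theta> x) = \<theta> (p x)"
  shows "cycles_of p' (\<theta> ` H) = (`) \<theta> ` cycles_of p H"
  using orbit_image[where p' = p' and \<theta> = \<theta>, OF assms(1,2) _ assms(3)] by (force simp: cycles_of_def image_image)

lemma card_cycles_of_image:
  assumes "p permutes H" "finite H" "\<And>x. x \<in> H \<Longrightarrow> p' (\<theta> x) = \<theta> (p x)" "inj_on \<theta> H"
  shows "card (cycles_of p' (\<theta> ` H)) = card (cycles_of p H)"
proof -
  have "cycles_of p H \<subseteq> Pow H" using permutes_orbit_subset[OF assms(1)] by (auto simp: cycles_of_def)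
  then have "inj_on ((`) \<theta>) (cycles_of p H)"
    using inj_on_image_Pow[OF assms(4)] by (rule inj_on_subset[rotated])
  moreover have "cycles_of p' (\<theta> ` H) = (`) \<theta> ` cycles_of p H"
    by (rule cycles_of_image) (fact assms)+
  ultimately show ?thesis by (simp add: card_image)
qed

lemma cells_subset_Pow: "is_stuffed_map M \<Longrightarrow> cells M \<subseteq> Pow (Pow (half_edges M))"
  using cells_subset(2) by blast

lemma cell_image:
  assumes "is_stuffed_map M" "inj_on \<theta> (half_edges M)"
  shows "inj_on ((`) ((`) \<theta>)) (cells M)" "f \<in> cells M \<Longrightarrow> inj_on ((`) \<theta>) f"
    "f \<in> cells M \<Longrightarrow> c \<in> f \<Longrightarrow> inj_on \<theta> c"
proof -
  have inj: "inj_on ((`) \<theta>) (Pow (half_edges M))" by (rule inj_on_image_Pow[OF assms(2)])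
  show "inj_on ((`) ((`) \<theta>)) (cells M)"
    by (rule inj_on_subset[OF inj_on_image_Pow[OF inj] cells_subset_Pow[OF assms(1)]])
  show "inj_on ((`) \<theta>) f" if "f \<in> cells M"
    using cells_subset_Pow[OF assms(1)] that by (intro inj_on_subset[OF inj]) blast
  show "inj_on \<theta> c" if "f \<in> cells M" "c \<in> f"
    using cells_subset_Pow[OF assms(1)] that by (intro inj_on_subset[OF assms(2)]) blast
qed

lemma euler_char_iso:
  assumes M: "is_stuffed_map M" and iso: "map_iso M M' \<theta>"
  shows "euler_char M' = euler_char M"
proof -
  note a = map_isoD[OF iso] and D = is_stuffed_mapD[OF M] and c = cell_image[OF M map_isoD(1)[OF iso]]
  have "(\<Sum>f\<in>cells M'. 2 - 2 * int (cell_genus M' f) - int (card f)) =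
     (\<Sum>f\<in>cells M. 2 - 2 * int (cell_genus M f) - int (card f))"
    unfolding a(7) using a(8) c(2) by (subst sum.reindex[OF c(1)]) (simp add: card_image)
  then show ?thesis
    unfolding euler_char_def
    using card_cycles_of_image[where p' = "map_sigma M'" and \<theta> = \<theta>, OF D(2,1) a(3,1)] card_cycles_of_image[where p' = "map_alpha M'" and \<theta> = \<theta>, OF D(3,1) a(4,1)] a(2,6) by simp
qed

lemma weight_monomial_iso:
  assumes M: "is_stuffed_map M" and iso: "map_iso M M' \<theta>"
  shows "weight_monomial M' = weight_monomial M"
proof -
  note a = map_isoD[OF iso] and D = is_stuffed_mapD[OF M] and c = cell_image[OF M map_isoD(1)[OF iso]]
  have "image_mset card (mset_set ((`) \<theta> ` f)) = image_mset card (mset_set f)" if f: "f \<in> cells M" for f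
  proof -
    have "mset_set ((`) \<theta> ` f) = image_mset ((`) \<theta>) (mset_set f)"
      by (rule image_mset_mset_set[OF c(2)[OF f], symmetric])
    then have "image_mset card (mset_set ((`) \<theta> ` f)) = image_mset (\<lambda>x. card (\<theta> ` x)) (mset_set f)"
      by (simp add: image_mset.compositionality comp_def)
    also have "\<dots> = image_mset card (mset_set f)"
      using c(3)[OF f] cells_subset(4)[OF M f] by (intro image_mset_cong) (auto intro!: card_image)
    finally show ?thesis .
  qed
  note g = this
  have "mset_set (cells M') = image_mset ((`) ((`) \<theta>)) (mset_set (cells M))"
    unfolding a(7) by (rule image_mset_mset_set[OF c(1), symmetric])
  then show ?thesis
    unfolding weight_monomial_def using g a(8) finite_cells[OF M]
    by (simp add: image_mset.compositionality comp_def) (intro image_mset_cong, simp)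
qed

lemma of_kind_iso:
  assumes M: "is_stuffed_map M" and iso: "map_iso M M' \<theta>"
  shows "of_kind \<kappa> M' \<longleftrightarrow> of_kind \<kappa> M"
  using map_isoD(7,8)[OF iso] cell_image(2)[OF M map_isoD(1)[OF iso]]
  by (simp add: of_kind_iff card_image)

lemma connected_map_iso:
  assumes M: "is_stuffed_map M" and M': "is_stuffed_map M'" and iso: "map_iso M M' \<theta>" and c: "connected_map M"
  shows "connected_map M'"
  unfolding connected_map_iff[OF M']
proof (intro conjI allI impI)
  note a = map_isoD[OF iso] and D = is_stuffed_mapD[OF M]
  show "half_edges M' \<noteq> {}" using c a(2) by (simp add: connected_map_def)
  fix K' assume K': "closed_in M' K' \<and> K' \<noteq> {}"
  then have cK: "closed_in M' K'" by simp
  define K where "K = {h \<in> half_edges M. \<theta> h \<in> K'}"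
  have "closed_in M K"
  proof (rule closed_inI)
    show "K \<subseteq> half_edges M" by (auto simp: K_def)
    show "map_sigma M x \<in> K" "map_alpha M x \<in> K" if "x \<in> K" for x
      using that closed_inD(2,3)[OF cK, of "\<theta> x"] a(3,4)[of x] D(2,3) by (simp_all add: K_def permutes_in_image)
    show "y \<in> K" if f: "f \<in> cells M" "x \<in> \<Union>f" "x \<in> K" "y \<in> \<Union>f" for f x y
    proof -
      have "(`) \<theta> ` f \<in> cells M'" using f(1) a(7) by simp
      moreover have "\<theta> x \<in> \<Union>((`) \<theta> ` f)" "\<theta> y \<in> \<Union>((`) \<theta> ` f)" "\<theta> x \<in> K'"
        using f by (auto simp: K_def)
      ultimately have "\<theta> y \<in> K'" using closed_inD(4)[OF cK] by blast
      then show ?thesis using f cells_subset(2)[OF M f(1)] by (auto simp: K_def)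
    qed
  qed
  moreover have "K \<noteq> {}" using K' closed_inD(1)[OF cK] a(2) by (auto simp: K_def)
  ultimately have "K = half_edges M" by (rule connected_mapD[OF M c])
  then show "K' = half_edges M'" using closed_inD(1)[OF cK] a(2) by (auto simp: K_def)
qed

lemma partial_disks_iso:
  assumes M: "M \<in> partial_disks \<kappa> k l" and M': "is_stuffed_map M'" and iso: "map_iso M M' \<theta>"
  shows "M' \<in> partial_disks \<kappa> k l"
proof -
  have st: "is_stuffed_map M" and s: "simple_upto k M" using M unfolding partial_disks_iff by blast+
  note a = map_isoD[OF iso] and D = is_stuffed_mapD[OF st]
  obtain r where r: "roots M = [r]" "card (orbit (map_phi M) r) = l" using M unfolding partial_disks_iff by blast
  have rH: "r \<in> half_edges M" using D(9) r by simp
  have r': "roots M' = [\<theta> r]" by (simp add: a(6) r)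
  have orb: "orbit (map_phi M') (\<theta> r) = \<theta> ` orbit (map_phi M) r"
    by (rule orbit_image[where p' = "map_phi M'" and \<theta> = \<theta>, OF D(4,1) rH a(5)])
  have sub: "orbit (map_phi M) r \<subseteq> half_edges M" by (rule permutes_orbit_subset[OF D(4) rH])
  have "card (orbit (map_phi M') (\<theta> r)) = l"
    unfolding orb using inj_on_subset[OF a(1) sub] r by (simp add: card_image)
  moreover have in_H: "(map_phi M ^^ j) r \<in> half_edges M" for j
    by (induction j) (use rH D(4) in \<open>simp_all add: permutes_in_image\<close>)
  have pow: "(map_phi M' ^^ j) (\<theta> r) = \<theta> ((map_phi M ^^ j) r)" for j
    by (induction j) (simp_all add: a(5)[OF in_H])
  have "simple_upto k M'"
    unfolding simple_upto_def boundary_half_edges_root[OF r'] r' list.sel pow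
  proof (intro allI impI ballI)
    fix j x assume j: "j < k" and x: "x \<in> orbit (map_phi M') (\<theta> r)" "x \<in> orbit (map_sigma M') (\<theta> ((map_phi M ^^ j) r))"
    obtain y where y: "y \<in> orbit (map_phi M) r" "x = \<theta> y" using x(1) unfolding orb by blast
    have "x \<in> \<theta> ` orbit (map_sigma M) ((map_phi M ^^ j) r)"
      using x(2) orbit_image[where p' = "map_sigma M'" and \<theta> = \<theta>, OF D(2,1) in_H[of j] a(3)] by simp
    then obtain z where z: "z \<in> orbit (map_sigma M) ((map_phi M ^^ j) r)" "x = \<theta> z" by blast
    have "z \<in> half_edges M" using z(1) permutes_orbit_subset[OF D(2) in_H] by blast
    then have "y = z" using y z sub a(1) by (auto dest: inj_onD)
    then have "y = (map_phi M ^^ j) r"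
      using s j y z unfolding simple_upto_def boundary_half_edges_root[OF r(1)] by (simp add: r)
    then show "x = \<theta> ((map_phi M ^^ j) r)" using y by simp
  qed
  ultimately show ?thesis
    using M M' r' connected_map_iso[OF st M' iso] euler_char_iso[OF st iso] of_kind_iso[OF st iso]
    unfolding partial_disks_iff by auto
qed

section \<open>Relabelling a map along an injection\<close>

definition transport_perm :: "('a \<Rightarrow> 'b) \<Rightarrow> 'a set \<Rightarrow> ('a \<Rightarrow> 'a) \<Rightarrow> 'b \<Rightarrow> 'b" where
  "transport_perm \<theta> H p x = (if x \<in> \<theta> ` H then \<theta> (p (inv_into H \<theta> x)) else x)"

definition transport_map :: "('a \<Rightarrow> 'b) \<Rightarrow> 'a stuffed_map \<Rightarrow> 'b stuffed_map" where
  "transport_map \<theta> M = \<lparr>half_edges = \<theta> ` half_edges M,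
     map_sigma = transport_perm \<theta> (half_edges M) (map_sigma M),
     map_alpha = transport_perm \<theta> (half_edges M) (map_alpha M),
     map_phi = transport_perm \<theta> (half_edges M) (map_phi M),
     roots = map \<theta> (roots M),
     cells = (`) ((`) \<theta>) ` cells M,
     cell_genus = (\<lambda>f. if f \<in> (`) ((`) \<theta>) ` cells M
       then cell_genus M (inv_into (cells M) ((`) ((`) \<theta>)) f) else 0)\<rparr>"

lemma transport_perm_apply:
  assumes "inj_on \<theta> H" "h \<in> H"
  shows "transport_perm \<theta> H p (\<theta> h) = \<theta> (p h)"
  using assms by (simp add: transport_perm_def)

lemma transport_perm_permutes:
  assumes "inj_on \<theta> H" "p permutes H"
  shows "transport_perm \<theta> H p permutes \<theta> ` H"
proof (rule bij_imp_permutes)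
  have "inj_on (transport_perm \<theta> H p) (\<theta> ` H)"
  proof (rule inj_onI)
    fix x y assume "x \<in> \<theta> ` H" "y \<in> \<theta> ` H" and eq: "transport_perm \<theta> H p x = transport_perm \<theta> H p y"
    then obtain u v where uv: "u \<in> H" "v \<in> H" "x = \<theta> u" "y = \<theta> v" by blast
    then have "\<theta> (p u) = \<theta> (p v)" using eq assms(1) by (simp add: transport_perm_apply)
    then have "p u = p v" using assms uv by (auto dest: inj_onD simp: permutes_in_image)
    then show "x = y" using permutes_inj[OF assms(2)] uv by (auto dest: injD)
  qed
  moreover have "transport_perm \<theta> H p ` (\<theta> ` H) = \<theta> ` (p ` H)"
    using assms(1) by (force simp: image_image transport_perm_apply)
  ultimately show "bij_betw (transport_perm \<theta> H p) (\<theta> ` H) (\<theta> ` H)"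
    using permutes_image[OF assms(2)] by (simp add: bij_betw_def)
qed (simp add: transport_perm_def)

lemma map_iso_transport:
  assumes M: "is_stuffed_map M" and inj: "inj_on \<theta> (half_edges M)"
  shows "map_iso M (transport_map \<theta> M) \<theta>"
  using inj cell_image(1)[OF M inj] unfolding map_iso_def transport_map_def
  by (simp add: bij_betw_def transport_perm_apply)

lemma normalized_transport: "normalized_map (transport_map \<theta> M)"
  by (simp add: normalized_map_def transport_map_def)

text \<open>\<open>map_iso\<close> controls the three functions of \<open>M'\<close> on its
  half-edges only; the assumptions \<open>perm\<close> settle their values elsewhere.\<close>

lemma map_iso_stuffed:
  fixes M :: "'a stuffed_map" and M' :: "'b stuffed_map"
  assumes M: "is_stuffed_map M" and iso: "map_iso M M' \<theta>"
    and perm: "map_sigma M' permutes half_edges M'" "map_alpha M' permutes half_edges M'" "map_phi M' permutes half_edges M'"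
  shows "is_stuffed_map M'"
proof -
  note a = map_isoD[OF iso] and D = is_stuffed_mapD[OF M]
  let ?C = "cycles_of (map_phi M) (half_edges M)"
  have inH: "map_sigma M h \<in> half_edges M" "map_alpha M h \<in> half_edges M" "map_phi M h \<in> half_edges M"
    if "h \<in> half_edges M" for h using that D(2-4) by (simp_all add: permutes_in_image)
  have "map_sigma M' (map_alpha M' (map_phi M' x)) = x" for x
  proof (cases "x \<in> half_edges M'")
    case True
    then obtain h where h: "h \<in> half_edges M" "x = \<theta> h" using a(2) by blast
    then show ?thesis using a(3-5) inH D(5) by (simp add: fun_eq_iff)
  qed (use perm in \<open>simp add: permutes_not_in\<close>)
  then have comp: "map_sigma M' \<circ> map_alpha M' \<circ> map_phi M' = id" by (simp add: fun_eq_iff)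
  have al: "map_alpha M' (map_alpha M' x) = x \<and> map_alpha M' x \<noteq> x" if x: "x \<in> half_edges M'" for x
  proof -
    obtain h where h: "h \<in> half_edges M" "x = \<theta> h" using a(2) x by blast
    then show ?thesis using a(4)[OF h(1)] a(4)[OF inH(2)[OF h(1)]] D(6,7)[OF h(1)] inj_onD[OF a(1) _ inH(2)[OF h(1)] h(1)] by auto
  qed
  have injC: "inj_on ((`) \<theta>) ?C"
    by (rule inj_on_subset[OF inj_on_image_Pow[OF a(1)]])
      (use permutes_orbit_subset[OF D(4)] in \<open>auto simp: cycles_of_def\<close>)
  have C': "cycles_of (map_phi M') (half_edges M') = (`) \<theta> ` ?C"
    unfolding a(2) by (rule cycles_of_image[where p' = "map_phi M'" and \<theta> = \<theta>, OF D(4,1) a(5)])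
  have B': "boundaries M' = map ((`) \<theta>) (boundaries M)"
    using orbit_image[where p' = "map_phi M'" and \<theta> = \<theta>, OF D(4,1) _ a(5)] D(9) unfolding boundaries_def a(6) by (simp add: subset_iff)
  have B: "set (boundaries M) \<subseteq> ?C" by (rule boundaries_subset[OF M])
  have diff: "cycles_of (map_phi M') (half_edges M') - set (boundaries M') = (`) \<theta> ` (?C - set (boundaries M))"
    unfolding C' B' using B by (simp add: inj_on_image_set_diff[OF injC])
  have "partition_on ((`) \<theta> ` (?C - set (boundaries M))) ((`) ((`) \<theta>) ` cells M - {{}})"
    by (rule partition_on_inj_image[OF D(11) inj_on_subset[OF injC]]) blast
  moreover have "(`) ((`) \<theta>) ` cells M - {{}} = cells M'"
    using cells_subset(3)[OF M] unfolding a(7) by auto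
  moreover have "distinct (boundaries M')"
    unfolding B' using D(10) inj_on_subset[OF injC B] by (simp add: distinct_map)
  moreover have "finite (half_edges M')" "roots M' \<noteq> []" "set (roots M') \<subseteq> half_edges M'"
    using D(1,8,9) a(2,6) by auto
  ultimately show ?thesis
    unfolding is_stuffed_map_def diff using perm comp al by simp
qed

lemma is_stuffed_map_transport:
  assumes M: "is_stuffed_map M" and inj: "inj_on \<theta> (half_edges M)"
  shows "is_stuffed_map (transport_map \<theta> M)"
proof (rule map_iso_stuffed[OF M map_iso_transport[OF M inj]])
  note D = is_stuffed_mapD[OF M]
  show "map_sigma (transport_map \<theta> M) permutes half_edges (transport_map \<theta> M)"
    "map_alpha (transport_map \<theta> M) permutes half_edges (transport_map \<theta> M)"
    "map_phi (transport_map \<theta> M) permutes half_edges (transport_map \<theta> M)"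
    using transport_perm_permutes[OF inj] D(2-4) by (simp_all add: transport_map_def)
qed

text \<open>On the image of \<theta> everything is prescribed by \<open>M\<close>; elsewhere the
  permutations are the identity and the genus is 0.\<close>

lemma normalized_iso_unique:
  fixes T T' :: "'b stuffed_map"
  assumes "is_stuffed_map T" "is_stuffed_map T'" "map_iso M T \<theta>" "map_iso M T' \<theta>" "normalized_map T" "normalized_map T'"
  shows "T = T'"
proof -
  note a = map_isoD[OF assms(3)] and b = map_isoD[OF assms(4)]
  note D = is_stuffed_mapD[OF assms(1)] and D' = is_stuffed_mapD[OF assms(2)]
  have H: "half_edges T = half_edges T'" using a(2) b(2) by simp
  have ext: "p = q" if "p permutes half_edges T" "q permutes half_edges T" "\<And>h. h \<in> half_edges M \<Longrightarrow> p (\<theta> h) = q (\<theta> h)" for p q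
  proof
    fix x show "p x = q x"
      by (cases "x \<in> half_edges T") (use that a(2) in \<open>auto simp: permutes_not_in\<close>)
  qed
  have C: "cells T = cells T'" using a(7) b(7) by simp
  show ?thesis
  proof (rule stuffed_map.equality)
    show "map_sigma T = map_sigma T'" using D(2) D'(2) a(3) b(3) H by (intro ext) auto
    show "map_alpha T = map_alpha T'" using D(3) D'(3) a(4) b(4) H by (intro ext) auto
    show "map_phi T = map_phi T'" using D(4) D'(4) a(5) b(5) H by (intro ext) auto
    show "cell_genus T = cell_genus T'"
    proof
      fix f show "cell_genus T f = cell_genus T' f"
      proof (cases "f \<in> cells T")
        case True
        then have "f \<in> (`) ((`) \<theta>) ` cells M" by (simp only: a(7))
        then obtain g where g: "f = (`) \<theta> ` g" "g \<in> cells M" by (rule imageE)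
        show ?thesis unfolding g(1) a(8)[OF g(2)] b(8)[OF g(2)] ..
      qed (use assms(5,6) C in \<open>simp add: normalized_map_def\<close>)
    qed
  qed (use H C a(6) b(6) in simp_all)
qed

text \<open>An isomorphism of \<open>M\<close> to itself preserves the list of roots and commutes
  with \<phi>, so it fixes every boundary pointwise.\<close>

lemma automorphisms_eq:
  assumes M: "is_stuffed_map M"
  shows "automorphisms M = {\<rho>. \<rho> permutes half_edges M \<and> map_iso M M \<rho>}"
proof -
  note D = is_stuffed_mapD[OF M]
  have "\<rho> h = h" if iso: "map_iso M M \<rho>" and h: "h \<in> boundary_half_edges M" for \<rho> h
  proof -
    note a = map_isoD[OF iso]
    obtain r where r: "r \<in> set (roots M)" "h \<in> orbit (map_phi M) r"
      using h unfolding boundary_half_edges_def boundaries_def by auto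
    have "\<rho> r = r" using a(6) r(1) by (metis map_eq_conv map_ident)
    have rH: "r \<in> half_edges M" using r D(9) by blast
    from r(2) show ?thesis
    proof induction
      case base
      show ?case using a(5)[OF rH] \<open>\<rho> r = r\<close> by simp
    next
      case (step y)
      then have "y \<in> half_edges M" using permutes_orbit_subset[OF D(4) rH] by blast
      then show ?case using a(5)[of y] step by simp
    qed
  qed
  then show ?thesis unfolding automorphisms_def by blast
qed

text \<open>Orbit-stabilizer: the bijections from the half-edges of \<open>M\<close> to \<open>S\<close> that transport \<open>M\<close> to a
  given map form a coset of the automorphism group.\<close>

lemma card_labellings:
  fixes M :: "'a stuffed_map"
  assumes M: "is_stuffed_map M" and S: "finite S" "card S = card (half_edges M)"
  shows "card {T. (M, T) \<in> map_iso_rel \<and> half_edges T = S \<and> normalized_map T} * card (automorphisms M) = fact (card S)"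
    "finite {T. (M, T) \<in> map_iso_rel \<and> half_edges T = S \<and> normalized_map T}"
proof -
  note D = is_stuffed_mapD[OF M]
  let ?H = "half_edges M" and ?T = "{T. (M, T) \<in> map_iso_rel \<and> half_edges T = S \<and> normalized_map T}"
  let ?P = "{p. p permutes ?H}"
  obtain \<theta> where \<theta>: "bij_betw \<theta> ?H S" using D(1) S by (metis finite_same_card_bij)
  define g where "g p = transport_map (\<theta> \<circ> p) M" for p
  have inj: "inj_on (\<theta> \<circ> p) ?H" and im: "(\<theta> \<circ> p) ` ?H = S" if "p \<in> ?P" for p
  proof -
    have "bij_betw (\<theta> \<circ> p) ?H S" using that \<theta> by (auto intro: bij_betw_trans permutes_imp_bij)
    then show "inj_on (\<theta> \<circ> p) ?H" "(\<theta> \<circ> p) ` ?H = S" by (auto simp: bij_betw_def)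
  qed
  have iso: "map_iso M (g p) (\<theta> \<circ> p)" if "p \<in> ?P" for p
    unfolding g_def by (rule map_iso_transport[OF M inj[OF that]])
  have st: "is_stuffed_map (g p)" if "p \<in> ?P" for p
    unfolding g_def by (rule is_stuffed_map_transport[OF M inj[OF that]])
  have gT: "g p \<in> ?T" if "p \<in> ?P" for p
    using iso[OF that] st[OF that] M im[OF that] map_isoD(2)[OF iso[OF that]] normalized_transport[of "\<theta> \<circ> p" M]
    by (auto simp: map_iso_rel_def g_def)
  have g_eq: "g p = T \<longleftrightarrow> map_iso M T (\<theta> \<circ> p)" if "p \<in> ?P" "T \<in> ?T" for p T
  proof
    show "g p = T \<Longrightarrow> map_iso M T (\<theta> \<circ> p)" using iso[OF that(1)] by blast
    show "map_iso M T (\<theta> \<circ> p) \<Longrightarrow> g p = T"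
      using that(2) by (intro normalized_iso_unique[OF st[OF that(1)] _ iso[OF that(1)]])
        (auto simp: map_iso_rel_def g_def normalized_transport)
  qed
  have surj: "\<exists>p\<in>?P. g p = T" if T: "T \<in> ?T" for T
  proof -
    obtain \<eta> where \<eta>: "map_iso M T \<eta>" using T by (auto simp: map_iso_rel_def)
    have bij: "bij_betw \<eta> ?H S" using \<eta> T by (auto simp: map_iso_def)
    \<comment> \<open>Any isomorphism \<eta> onto \<open>T\<close> differs from the reference
      bijection \<theta> by a permutation of the half-edges, extended here by the identity.\<close>
    define p where "p = perm_restrict (inv_into ?H \<theta> \<circ> \<eta>) ?H"
    have "bij_betw (inv_into ?H \<theta> \<circ> \<eta>) ?H ?H"
      by (rule bij_betw_trans[OF bij bij_betw_inv_into[OF \<theta>]])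
    then have "p permutes ?H"
      unfolding p_def by (intro bij_imp_permutes) (auto simp: perm_restrict_def cong: bij_betw_cong)
    then have p: "p \<in> ?P" by simp
    have "\<eta> h = (\<theta> \<circ> p) h" if "h \<in> ?H" for h
      using that bij_betw_inv_into_right[OF \<theta>, of "\<eta> h"] bij
      by (auto simp: p_def perm_restrict_def bij_betw_def)
    then have "map_iso M T (\<theta> \<circ> p)" using map_iso_cong[OF M, of \<eta> "\<theta> \<circ> p" T] \<eta> by blast
    then show ?thesis using g_eq[OF p T] p by blast
  qed
  have "?T = g ` ?P" using gT surj by blast
  moreover have finP: "finite ?P" using D(1) by (rule finite_permutations)
  ultimately show finT: "finite ?T" by simp
  have fiber: "card {p \<in> ?P. g p = T} = card (automorphisms M)" if T: "T \<in> ?T" for T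
  proof -
    obtain p where p: "p \<in> ?P" "g p = T" using surj[OF T] by blast
    have isoT: "map_iso M T (\<theta> \<circ> p)" using p iso by blast
    have "bij_betw (\<lambda>\<rho>. p \<circ> \<rho>) (automorphisms M) {p \<in> ?P. g p = T}"
      unfolding bij_betw_def
    proof (intro conjI equalityI subsetI)
      have "inj p" using p(1) by (auto dest: permutes_inj)
      then show "inj_on (\<lambda>\<rho>. p \<circ> \<rho>) (automorphisms M)"
        by (auto simp: inj_on_def fun_eq_iff dest: injD)
    next
      fix q assume "q \<in> (\<lambda>\<rho>. p \<circ> \<rho>) ` automorphisms M"
      then obtain \<rho> where \<rho>: "\<rho> permutes ?H" "map_iso M M \<rho>" "q = p \<circ> \<rho>"
        unfolding automorphisms_eq[OF M] by blast
      have q: "q \<in> ?P" using \<rho> p(1) by (simp add: permutes_compose)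
      have "map_iso M T (\<theta> \<circ> p \<circ> \<rho>)" by (rule map_iso_comp[OF M \<rho>(2) isoT])
      then show "q \<in> {p \<in> ?P. g p = T}" using q g_eq[OF q T] \<rho>(3) by (simp add: comp_assoc)
    next
      fix q assume "q \<in> {p \<in> ?P. g p = T}"
      then have q: "q \<in> ?P" "map_iso M T (\<theta> \<circ> q)" using g_eq T by auto
      define \<rho> where "\<rho> = inv p \<circ> q"
      have \<rho>: "\<rho> permutes ?H" using p(1) q(1) by (simp add: \<rho>_def permutes_compose permutes_inv)
      have qp: "q = p \<circ> \<rho>" using p(1) unfolding \<rho>_def by (simp add: comp_assoc[symmetric] permutes_inv_o)
      have "map_iso M M (inv_into ?H (\<theta> \<circ> p) \<circ> (\<theta> \<circ> q))"
        by (rule map_iso_comp[OF M q(2) map_iso_inv[OF M isoT]])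
      moreover have "(inv_into ?H (\<theta> \<circ> p) \<circ> (\<theta> \<circ> q)) h = \<rho> h" if "h \<in> ?H" for h
      proof -
        have "\<rho> h \<in> ?H" using that \<rho> by (simp add: permutes_in_image)
        then show ?thesis using inv_into_f_f[OF inj[OF p(1)], of "\<rho> h"] by (simp add: qp)
      qed
      ultimately have "map_iso M M \<rho>" using map_iso_cong[OF M] by blast
      then have "\<rho> \<in> automorphisms M" using \<rho> by (simp add: automorphisms_eq[OF M])
      then show "q \<in> (\<lambda>\<rho>. p \<circ> \<rho>) ` automorphisms M" using qp by blast
    qed
    then show ?thesis by (rule bij_betw_same_card[symmetric])
  qed
  have "fact (card S) = card ?P" using card_permutations[OF S(2)[symmetric] D(1)] S(2) by simp
  also have "\<dots> = (\<Sum>T\<in>?T. card {p \<in> ?P. g p = T})"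
    using sum.group[OF finP finT, of g "\<lambda>_. 1 :: nat"] gT by (simp add: image_subset_iff)
  also have "\<dots> = card ?T * card (automorphisms M)" using fiber by simp
  finally show "card ?T * card (automorphisms M) = fact (card S)" by simp
qed

text \<open>The total length of the inner cycles of any map with this monomial.\<close>

definition monomial_weight :: "weight_var multiset \<Rightarrow> nat" where
  "monomial_weight m = (\<Sum>v\<in>#m. \<Sum>\<^sub># (snd v))"

lemma monomial_weight_add: "monomial_weight (m + m') = monomial_weight m + monomial_weight m'"
  by (simp add: monomial_weight_def)

text \<open>The cycles of \<phi> partition the half-edges into the boundary and the cycles of the
  cells. So all maps contributing to one coefficient can be labelled by the same set.\<close>

lemma card_half_edges:
  assumes "M \<in> partial_disks \<kappa> k l"
  shows "card (half_edges M) = l + monomial_weight (weight_monomial M)"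
proof -
  have M: "is_stuffed_map M" using assms unfolding partial_disks_iff by blast
  obtain r where r: "roots M = [r]" "card (orbit (map_phi M) r) = l" using assms unfolding partial_disks_iff by blast
  note D = is_stuffed_mapD[OF M]
  let ?C = "cycles_of (map_phi M) (half_edges M)" and ?O = "orbit (map_phi M) r"
  have fin: "finite ?C" by (rule finite_cycles_of[OF D(1)])
  have O: "?O \<in> ?C" using D(9) r by (auto simp: cycles_of_def)
  have fino: "finite c" if "c \<in> ?C" for c
    using that permutes_orbit_subset[OF D(4)] D(1) by (auto simp: cycles_of_def intro: finite_subset)
  have "monomial_weight (weight_monomial M) = (\<Sum>f\<in>cells M. \<Sum>c\<in>f. card c)"
    unfolding monomial_weight_def weight_monomial_def
    by (simp add: image_mset.compositionality comp_def sum_unfold_sum_mset)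
  also have "\<dots> = (\<Sum>c\<in>?C - {?O}. card c)"
  proof -
    have P: "partition_on (?C - {?O}) (cells M)" using D(11) r by (simp add: boundaries_def)
    then have U: "?C - {?O} = \<Union>(cells M)" by (rule partition_onD1)
    show ?thesis unfolding U
      by (subst sum.Union_disjoint) (use cells_subset(4)[OF M] partition_on_diff_disjnt[OF P] in auto)
  qed
  finally have "l + monomial_weight (weight_monomial M) = (\<Sum>c\<in>?C. card c)"
    using sum.remove[OF fin O, of card] r(2) by simp
  also have "\<dots> = card (half_edges M)"
    by (rule product_partition[OF partition_on_cycles_of[OF D(4,1)], symmetric]) (rule fino)
  finally show ?thesis ..
qed

definition labelled_disks :: "map_kind \<Rightarrow> nat \<Rightarrow> nat \<Rightarrow> weight_var multiset \<Rightarrow> nat set \<Rightarrow> nat stuffed_map set" where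
  "labelled_disks \<kappa> k l m S =
     {M \<in> partial_disks \<kappa> k l. weight_monomial M = m \<and> half_edges M = S \<and> normalized_map M}"

lemma finite_labelled_disks:
  assumes S: "finite S"
  shows "finite (labelled_disks \<kappa> k l m S)"
proof -
  let ?P = "{p. p permutes S}" and ?F = "Pow (Pow S)"
  \<comment> \<open>The genus of a cell occurs as a first component in the monomial and
    normalization makes all other values 0; this leaves finitely many genus functions.\<close>
  let ?G = "{g. \<forall>f. (f \<in> ?F \<longrightarrow> g f \<in> insert 0 (fst ` set_mset m)) \<and> (f \<notin> ?F \<longrightarrow> g f = (0 :: nat))}"
  let ?mk = "\<lambda>(s, a, p, r, c, g). \<lparr>half_edges = S, map_sigma = s, map_alpha = a, map_phi = p, roots = [r], cells = c, cell_genus = g\<rparr>"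
  have "labelled_disks \<kappa> k l m S \<subseteq> ?mk ` (?P \<times> ?P \<times> ?P \<times> S \<times> Pow ?F \<times> ?G)"
  proof
    fix M assume "M \<in> labelled_disks \<kappa> k l m S"
    then have M: "M \<in> partial_disks \<kappa> k l" "weight_monomial M = m" "half_edges M = S" "normalized_map M"
      by (simp_all add: labelled_disks_def)
    have st: "is_stuffed_map M" using M(1) unfolding partial_disks_iff by blast
    note D = is_stuffed_mapD[OF st]
    obtain r where r: "roots M = [r]" using M(1) unfolding partial_disks_iff by blast
    have c: "cells M \<subseteq> ?F" using cells_subset_Pow[OF st] M(3) by simp
    have "cell_genus M f \<in> insert 0 (fst ` set_mset m)" for f
    proof (cases "f \<in> cells M")
      case True
      then have "(cell_genus M f, image_mset card (mset_set f)) \<in># m"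
        unfolding M(2)[symmetric] weight_monomial_def using finite_cells[OF st] by simp
      then show ?thesis by force
    qed (use M(4) in \<open>simp add: normalized_map_def\<close>)
    then have G: "cell_genus M \<in> ?G" using c M(4) unfolding normalized_map_def by blast
    have M_eq: "M = ?mk (map_sigma M, map_alpha M, map_phi M, r, cells M, cell_genus M)"
      using M(3) r by (intro stuffed_map.equality) simp_all
    have "r \<in> S" using D(9) r M(3) by simp
    with G have "(map_sigma M, map_alpha M, map_phi M, r, cells M, cell_genus M) \<in> ?P \<times> ?P \<times> ?P \<times> S \<times> Pow ?F \<times> ?G"
      using D(2-4) c unfolding M(3) by (intro SigmaI) (simp_all only: mem_Collect_eq Pow_iff)
    then show "M \<in> ?mk ` (?P \<times> ?P \<times> ?P \<times> S \<times> Pow ?F \<times> ?G)"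
      by (subst M_eq) (rule imageI)
  qed
  moreover have "finite ?G" using S by (intro finite_set_of_finite_funs) auto
  then have "finite (?mk ` (?P \<times> ?P \<times> ?P \<times> S \<times> Pow ?F \<times> ?G))"
    using S by (intro finite_imageI finite_cartesian_product finite_permutations) auto
  ultimately show ?thesis by (rule finite_subset)
qed

lemma Abs_mpower_series_mcoeff [simp]: "mcoeff (Abs_mpower_series f) = f"
  by (simp add: Abs_mpower_series_inverse)

text \<open>By orbit-stabilizer an isomorphism class with automorphism group A contributes n!/|A|
  labelled maps, where n is the size of \<open>S\<close>. Summing 1/|A| over the classes gives the
  labelled count divided by n!.\<close>

theorem mcoeff_partial_disks:
  assumes S: "finite S" "card S = l + monomial_weight m"
  shows "mcoeff (generating_series (partial_disks \<kappa> k l)) m = of_nat (card (labelled_disks \<kappa> k l m S)) / fact (card S)"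
proof -
  let ?X = "{M \<in> partial_disks \<kappa> k l. weight_monomial M = m} :: nat stuffed_map set"
  let ?L = "labelled_disks \<kappa> k l m S"
  let ?R = "map_iso_rel :: (nat stuffed_map \<times> nat stuffed_map) set"
  note E = equiv_map_iso_rel[where 'a = nat]
  have st: "is_stuffed_map M" if "M \<in> ?X" for M using that by (simp add: partial_disks_iff)
  have closed: "M' \<in> ?X" if M: "M \<in> ?X" and rel: "(M, M') \<in> ?R" for M M'
  proof -
    obtain \<theta> where \<theta>: "map_iso M M' \<theta>" "is_stuffed_map M'" using rel by (auto simp: map_iso_rel_def)
    then show ?thesis
      using M partial_disks_iso[of M \<kappa> k l M' \<theta>] weight_monomial_iso[OF st[OF M] \<theta>(1)] by simp
  qed
  have L: "?L = {T \<in> ?X. half_edges T = S \<and> normalized_map T}" by (auto simp: labelled_disks_def)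
  have sub: "{T. (M, T) \<in> ?R \<and> half_edges T = S \<and> normalized_map T} = {T \<in> ?L. ?R `` {T} = ?R `` {M}}" if M: "M \<in> ?X" for M
  proof -
    have "?R `` {T} = ?R `` {M} \<longleftrightarrow> (M, T) \<in> ?R" if "T \<in> ?X" for T
      using eq_equiv_class_iff[OF E, of M T] st[OF M] st[OF that] by auto
    then show ?thesis using closed[OF M] unfolding L by blast
  qed
  have card_H: "card S = card (half_edges M)" if "M \<in> ?X" for M
    using that card_half_edges[of M \<kappa> k l] S(2) by simp
  have lab: "card {T \<in> ?L. ?R `` {T} = ?R `` {M}} * card (automorphisms M) = fact (card S)" if M: "M \<in> ?X" for M
    using card_labellings(1)[OF st[OF M] S(1) card_H[OF M]] unfolding sub[OF M] .
  \<comment> \<open>Every class has a member labelled by \<open>S\<close>, since its labelled count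
    times |Aut| is a factorial and hence nonzero. In particular there are finitely many
    classes.\<close>
  have quot: "?X // ?R = (\<lambda>T. ?R `` {T}) ` ?L"
  proof (intro equalityI subsetI)
    fix C assume "C \<in> ?X // ?R"
    then obtain M where M: "M \<in> ?X" "C = ?R `` {M}" by (auto simp: quotient_def)
    have "card {T \<in> ?L. ?R `` {T} = ?R `` {M}} \<noteq> 0" using lab[OF M(1)] by (metis fact_nonzero mult_0)
    then obtain T where "T \<in> ?L" "?R `` {T} = ?R `` {M}" by (metis (mono_tags, lifting) card.empty empty_Collect_eq)
    then show "C \<in> (\<lambda>T. ?R `` {T}) ` ?L" using M by blast
  next
    fix C assume "C \<in> (\<lambda>T. ?R `` {T}) ` ?L"
    then show "C \<in> ?X // ?R" unfolding L by (auto intro: quotientI)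
  qed
  have finL: "finite ?L" by (rule finite_labelled_disks[OF S(1)])
  then have finQ: "finite (?X // ?R)" unfolding quot by simp
  have summand: "1 / of_nat (card (automorphisms (SOME M. M \<in> C))) = (of_nat (card {T \<in> ?L. ?R `` {T} = C}) / fact (card S) :: rat)"
    if C: "C \<in> ?X // ?R" for C
  proof -
    obtain M0 where M0: "M0 \<in> ?X" "C = ?R `` {M0}" using C by (auto simp: quotient_def)
    then have "M0 \<in> C" using equiv_class_self[OF E, of M0] st by simp
    then have M: "(SOME M. M \<in> C) \<in> C" by (rule someI)
    define M where "M = (SOME M. M \<in> C)"
    have rel: "(M0, M) \<in> ?R" using M M0(2) by (simp add: M_def)
    have MX: "M \<in> ?X" by (rule closed[OF M0(1) rel])
    have "C = ?R `` {M}" unfolding M0(2) by (rule equiv_class_eq[OF E rel])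
    then have l: "card {T \<in> ?L. ?R `` {T} = C} * card (automorphisms M) = fact (card S)" using lab[OF MX] by simp
    have "of_nat (card {T \<in> ?L. ?R `` {T} = C} * card (automorphisms M)) = (of_nat (fact (card S)) :: rat)"
      by (simp only: l)
    then have "of_nat (card {T \<in> ?L. ?R `` {T} = C}) * of_nat (card (automorphisms M)) = (fact (card S) :: rat)"
      by (simp only: of_nat_mult of_nat_fact)
    moreover from l have "card (automorphisms M) \<noteq> 0" by (metis fact_nonzero mult_0_right)
    ultimately show ?thesis unfolding M_def[symmetric] by (simp add: field_simps)
  qed
  have "mcoeff (generating_series (partial_disks \<kappa> k l)) m = (\<Sum>C\<in>?X // ?R. 1 / of_nat (card (automorphisms (SOME M. M \<in> C))))"
    by (simp add: generating_series_def)
  also have "\<dots> = (\<Sum>C\<in>?X // ?R. of_nat (card {T \<in> ?L. ?R `` {T} = C})) / fact (card S)"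
    unfolding sum_divide_distrib by (rule sum.cong[OF refl summand])
  also have "(\<Sum>C\<in>?X // ?R. of_nat (card {T \<in> ?L. ?R `` {T} = C})) = (of_nat (card ?L) :: rat)"
  proof -
    have "card ?L = (\<Sum>C\<in>?X // ?R. card {T \<in> ?L. ?R `` {T} = C})"
      using sum.group[OF finL finQ, of "\<lambda>T. ?R `` {T}" "\<lambda>_. 1 :: nat"] by (simp add: quot)
    then show ?thesis by (simp only: of_nat_sum)
  qed
  finally show ?thesis .
qed

section \<open>The functional equation\<close>

definition disk_pairs :: "map_kind \<Rightarrow> nat \<Rightarrow> nat \<Rightarrow> nat \<Rightarrow> nat \<Rightarrow> weight_var multiset \<Rightarrow> weight_var multiset \<Rightarrow>
    nat set \<Rightarrow> (nat stuffed_map \<times> nat stuffed_map) set" where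
  "disk_pairs \<kappa> k1 l1 k2 l2 m1 m2 S = {(M, N). M \<in> partial_disks \<kappa> k1 l1 \<and> N \<in> partial_disks \<kappa> k2 l2 \<and>
     weight_monomial M = m1 \<and> weight_monomial N = m2 \<and> normalized_map M \<and> normalized_map N \<and>
     half_edges M \<inter> half_edges N = {} \<and> half_edges M \<union> half_edges N = S}"

lemma card_labelled_disks:
  assumes "finite S" "card S = l + monomial_weight m"
  shows "of_nat (card (labelled_disks \<kappa> k l m S)) = mcoeff (generating_series (partial_disks \<kappa> k l)) m * fact (card S)"
  by (simp add: mcoeff_partial_disks[OF assms])

text \<open>The product rule for exponential generating functions: the labels of the first disk form
  a subset of prescribed size, and the binomial coefficient counting these subsets cancels against
  the factorials.\<close>

lemma card_disk_pairs:
  assumes S: "finite S" "card S = (l1 + monomial_weight m1) + (l2 + monomial_weight m2)"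
  shows "of_nat (card (disk_pairs \<kappa> k1 l1 k2 l2 m1 m2 S)) =
      mcoeff (generating_series (partial_disks \<kappa> k1 l1)) m1 * mcoeff (generating_series (partial_disks \<kappa> k2 l2)) m2 * fact (card S)"
    "finite (disk_pairs \<kappa> k1 l1 k2 l2 m1 m2 S)"
proof -
  let ?n1 = "l1 + monomial_weight m1" and ?n2 = "l2 + monomial_weight m2"
  let ?A = "{A. A \<subseteq> S \<and> card A = ?n1}"
  let ?P = "\<lambda>A. labelled_disks \<kappa> k1 l1 m1 A \<times> labelled_disks \<kappa> k2 l2 m2 (S - A)"
  let ?c1 = "mcoeff (generating_series (partial_disks \<kappa> k1 l1)) m1" and ?c2 = "mcoeff (generating_series (partial_disks \<kappa> k2 l2)) m2"
  have eq: "disk_pairs \<kappa> k1 l1 k2 l2 m1 m2 S = (\<Union>A\<in>?A. ?P A)"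
  proof (intro equalityI subsetI)
    fix x assume "x \<in> disk_pairs \<kappa> k1 l1 k2 l2 m1 m2 S"
    then obtain M N where x: "x = (M, N)" and M: "M \<in> partial_disks \<kappa> k1 l1" "weight_monomial M = m1" "normalized_map M"
      and N: "N \<in> partial_disks \<kappa> k2 l2" "weight_monomial N = m2" "normalized_map N"
      and H: "half_edges M \<inter> half_edges N = {}" "half_edges M \<union> half_edges N = S"
      unfolding disk_pairs_def by blast
    have "half_edges N = S - half_edges M" using H by blast
    then have "x \<in> ?P (half_edges M)" using M N by (simp add: x labelled_disks_def)
    moreover have "half_edges M \<in> ?A" using card_half_edges[OF M(1)] M(2) H(2) by auto
    ultimately show "x \<in> (\<Union>A\<in>?A. ?P A)" by blast
  next
    fix x assume "x \<in> (\<Union>A\<in>?A. ?P A)"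
    then show "x \<in> disk_pairs \<kappa> k1 l1 k2 l2 m1 m2 S" by (auto simp: labelled_disks_def disk_pairs_def)
  qed
  have finA: "finite ?A" using S(1) by simp
  have finP: "finite (?P A)" if "A \<in> ?A" for A
    using that S(1) by (intro finite_cartesian_product finite_labelled_disks) (auto intro: finite_subset)
  show "finite (disk_pairs \<kappa> k1 l1 k2 l2 m1 m2 S)" unfolding eq using finA finP by blast
  have "card (disk_pairs \<kappa> k1 l1 k2 l2 m1 m2 S) = (\<Sum>A\<in>?A. card (?P A))"
    unfolding eq using finA finP by (intro card_UN_disjoint) (auto simp: labelled_disks_def)
  then have "of_nat (card (disk_pairs \<kappa> k1 l1 k2 l2 m1 m2 S)) = (\<Sum>A\<in>?A. of_nat (card (?P A)) :: rat)"
    by simp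
  also have "\<dots> = (\<Sum>A\<in>?A. ?c1 * fact ?n1 * (?c2 * fact ?n2))"
  proof (rule sum.cong[OF refl])
    fix A assume A: "A \<in> ?A"
    then have fin: "finite A" "finite (S - A)" using S(1) finite_subset by auto
    have "card (S - A) = ?n2" using A S fin by (simp add: card_Diff_subset)
    then show "of_nat (card (?P A)) = ?c1 * fact ?n1 * (?c2 * fact ?n2)"
      using A card_labelled_disks[OF fin(1), of l1 m1 \<kappa> k1] card_labelled_disks[OF fin(2), of l2 m2 \<kappa> k2]
      by (simp add: card_cartesian_product)
  qed
  also have "\<dots> = of_nat (card S choose ?n1) * (?c1 * fact ?n1 * (?c2 * fact ?n2))"
    using n_subsets[OF S(1)] by simp
  also have "\<dots> = ?c1 * ?c2 * (of_nat (card S choose ?n1) * fact ?n1 * fact ?n2)"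
    by (simp add: algebra_simps)
  also have "of_nat (card S choose ?n1) * fact ?n1 * fact ?n2 = (fact (card S) :: rat)"
  proof -
    have "card S - ?n1 = ?n2" using S(2) by simp
    then have "fact ?n1 * fact ?n2 * (card S choose ?n1) = (fact (card S) :: nat)"
      using binomial_fact_lemma[of ?n1 "card S"] S(2) by simp
    then have "of_nat (fact ?n1 * fact ?n2 * (card S choose ?n1)) = (fact (card S) :: rat)"
      by (metis of_nat_fact)
    then show ?thesis by (simp add: algebra_simps)
  qed
  finally show "of_nat (card (disk_pairs \<kappa> k1 l1 k2 l2 m1 m2 S)) = ?c1 * ?c2 * fact (card S)" .
qed

lemma mcoeff_add [simp]: "mcoeff (f + g) m = mcoeff f m + mcoeff g m"
  by (simp add: plus_mpower_series.rep_eq)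

lemma mcoeff_sum: "mcoeff (sum f A) m = (\<Sum>x\<in>A. mcoeff (f x) m)"
  by (induction A rule: infinite_finite_induct) (simp_all add: zero_mpower_series.rep_eq)

lemma partial_disks_Suc_subset: "partial_disks \<kappa> (Suc k) l \<subseteq> partial_disks \<kappa> k l"
  by (auto simp: partial_disks_def simple_upto_def)

text \<open>Labelled on a common set \<open>S\<close>, the disks of the left-hand side are either
  simple at index \<open>k\<close> as well or glued from a unique pair. Dividing the counts by the
  factorial of the size of \<open>S\<close> gives the identity of coefficients.\<close>

theorem partial_disks_recurrence:
  assumes kl: "k < l"
  shows "generating_series (partial_disks \<kappa> k l) = generating_series (partial_disks \<kappa> (Suc k) l) +
     (\<Sum>i\<in>{0<..<l - k}. generating_series (partial_disks \<kappa> 0 i) * generating_series (partial_disks \<kappa> (Suc k) (l - i)))"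
proof (rule mpower_series_eqI)
  fix m :: "weight_var multiset"
  let ?F = "\<lambda>k l. mcoeff (generating_series (partial_disks \<kappa> k l))"
  define S where "S = {..<l + monomial_weight m}"
  have S: "finite S" "card S = l + monomial_weight m" by (simp_all add: S_def)
  let ?I = "{0<..<l - k}" and ?Sp = "{(a, b). a + b = m}"
  let ?Q = "{(M, N) \<in> glue_pairs \<kappa> k l. half_edges M \<union> half_edges N = S \<and> weight_monomial M + weight_monomial N = m}"
  let ?D = "{M \<in> partial_disks \<kappa> k l - partial_disks \<kappa> (Suc k) l. normalized_map M \<and> half_edges M = S \<and> weight_monomial M = m}"
  \<comment> \<open>The monomial \<open>m1\<close> belongs to the second disk, of length
    \<open>i\<close>, because that disk is the first factor in the products of the
    statement.\<close>
  let ?P = "\<lambda>(i, m1, m2). disk_pairs \<kappa> (Suc k) (l - i) 0 i m2 m1 S"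
  have split: "labelled_disks \<kappa> k l m S = labelled_disks \<kappa> (Suc k) l m S \<union> ?D"
    "labelled_disks \<kappa> (Suc k) l m S \<inter> ?D = {}"
    using partial_disks_Suc_subset[of \<kappa> k l] by (auto simp: labelled_disks_def)
  have "bij_betw (\<lambda>(M, N). glue_maps k M N) ?Q ?D"
  proof (rule bij_betw_subset[OF bij_betw_glue_maps[OF kl]])
    note b = bij_betw_glue_maps[OF kl, of \<kappa>, where 'a = nat]
    show "(\<lambda>(M, N). glue_maps k M N) ` ?Q = ?D"
    proof (intro equalityI subsetI)
      fix x assume "x \<in> (\<lambda>(M, N). glue_maps k M N) ` ?Q"
      then obtain M N where "(M, N) \<in> glue_pairs \<kappa> k l" "half_edges M \<union> half_edges N = S"
        "weight_monomial M + weight_monomial N = m" "x = glue_maps k M N" by auto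
      then show "x \<in> ?D" using glue_maps_in[of M N \<kappa> k l] by simp
    next
      fix x assume x: "x \<in> ?D"
      then have "x \<in> (\<lambda>(M, N). glue_maps k M N) ` glue_pairs \<kappa> k l"
        using b unfolding bij_betw_def by blast
      then obtain M N where MN: "(M, N) \<in> glue_pairs \<kappa> k l" "x = glue_maps k M N" by auto
      have "(M, N) \<in> ?Q" using x MN glue_maps_in(3,4)[OF MN(1)] by simp
      then show "x \<in> (\<lambda>(M, N). glue_maps k M N) ` ?Q"
        by (rule image_eqI[rotated]) (simp add: MN(2))
    qed
  qed blast
  then have card_D: "card ?D = card ?Q" by (rule bij_betw_same_card[symmetric])
  have Q: "?Q = (\<Union>x\<in>?I \<times> ?Sp. ?P x)"
  proof (intro equalityI subsetI)
    fix x assume "x \<in> ?Q"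
    then obtain M N where MN: "x = (M, N)" "(M, N) \<in> glue_pairs \<kappa> k l" "half_edges M \<union> half_edges N = S"
        "weight_monomial M + weight_monomial N = m" by blast
    then obtain i where i: "0 < i" "i < l - k" "M \<in> partial_disks \<kappa> (Suc k) (l - i)" "N \<in> partial_disks \<kappa> 0 i"
      "normalized_map M" "normalized_map N" "half_edges M \<inter> half_edges N = {}"
      unfolding glue_pairs_def by blast
    have "x \<in> ?P (i, weight_monomial N, weight_monomial M)" using MN i by (simp add: disk_pairs_def)
    moreover have "(i, weight_monomial N, weight_monomial M) \<in> ?I \<times> ?Sp" using MN(4) i by (simp add: add.commute)
    ultimately show "x \<in> (\<Union>x\<in>?I \<times> ?Sp. ?P x)" by (rule UN_I[rotated])
  next
    fix x assume "x \<in> (\<Union>x\<in>?I \<times> ?Sp. ?P x)"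
    then obtain i m1 m2 where "i \<in> ?I" "m1 + m2 = m" "x \<in> disk_pairs \<kappa> (Suc k) (l - i) 0 i m2 m1 S" by auto
    then show "x \<in> ?Q" unfolding disk_pairs_def glue_pairs_def by (auto simp: add.commute)
  qed
  have size: "card S = (l - i + monomial_weight m2) + (i + monomial_weight m1)" if "i \<in> ?I" "m1 + m2 = m" for i m1 m2
    using that S(2) monomial_weight_add[of m1 m2] by auto
  have fin: "finite (?P x)" if "x \<in> ?I \<times> ?Sp" for x
    using that card_disk_pairs(2)[OF S(1) size] by auto
  have finI: "finite (?I \<times> ?Sp)" using finite_mset_splittings[of m] by simp
  \<comment> \<open>A pair determines its index: \<open>i\<close> is the boundary length of the
    second disk, and the monomials are those of the two disks.\<close>
  have dis: "?P x \<inter> ?P y = {}" if "x \<noteq> y" for x y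
  proof -
    have "i = j" if "N \<in> partial_disks \<kappa> 0 i" "N \<in> partial_disks \<kappa> 0 j" for N :: "nat stuffed_map" and i j
      using that unfolding partial_disks_iff by auto
    then show ?thesis using that by (cases x; cases y) (fastforce simp: disk_pairs_def)
  qed
  have "of_nat (card ?Q) = (\<Sum>x\<in>?I \<times> ?Sp. of_nat (card (?P x)) :: rat)"
    unfolding Q using finI fin dis by (subst card_UN_disjoint) auto
  also have "\<dots> = (\<Sum>(i, m1, m2)\<in>?I \<times> ?Sp. ?F 0 i m1 * ?F (Suc k) (l - i) m2 * fact (card S))"
  proof (rule sum.cong[OF refl])
    fix x assume "x \<in> ?I \<times> ?Sp"
    then obtain i m1 m2 where x: "x = (i, m1, m2)" "i \<in> ?I" "m1 + m2 = m" by auto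
    show "of_nat (card (?P x)) = (case x of (i, m1, m2) \<Rightarrow> ?F 0 i m1 * ?F (Suc k) (l - i) m2 * fact (card S))"
      using card_disk_pairs(1)[OF S(1) size[OF x(2,3)], of \<kappa> "Suc k" 0] x(1) by (simp add: mult.commute)
  qed
  also have "\<dots> = (\<Sum>i\<in>?I. \<Sum>(m1, m2)\<in>?Sp. ?F 0 i m1 * ?F (Suc k) (l - i) m2 * fact (card S))"
    by (simp add: sum.cartesian_product)
  also have "\<dots> = (\<Sum>i\<in>?I. mcoeff (generating_series (partial_disks \<kappa> 0 i) * generating_series (partial_disks \<kappa> (Suc k) (l - i))) m) * fact (card S)"
    by (simp add: times_mpower_series.rep_eq sum_distrib_right case_prod_unfold)
  finally have cQ: "of_nat (card ?Q) = \<dots>" .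
  have "?F k l m * fact (card S) = of_nat (card (labelled_disks \<kappa> k l m S))"
    by (rule card_labelled_disks[OF S, symmetric])
  also have "\<dots> = of_nat (card (labelled_disks \<kappa> (Suc k) l m S)) + of_nat (card ?D)"
  proof -
    have "finite ?D"
      by (rule finite_subset[OF _ finite_labelled_disks[OF S(1), of \<kappa> k l m]]) (auto simp: labelled_disks_def)
    then have "card (labelled_disks \<kappa> k l m S) = card (labelled_disks \<kappa> (Suc k) l m S) + card ?D"
      unfolding split(1) by (rule card_Un_disjoint[OF finite_labelled_disks[OF S(1)] _ split(2)])
    then show ?thesis by (simp only: of_nat_add)
  qed
  also have "\<dots> = ?F (Suc k) l m * fact (card S) + of_nat (card ?Q)"
    unfolding card_D by (simp add: card_labelled_disks[OF S])
  finally have "?F k l m * fact (card S) = (?F (Suc k) l m +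
     (\<Sum>i\<in>?I. mcoeff (generating_series (partial_disks \<kappa> 0 i) * generating_series (partial_disks \<kappa> (Suc k) (l - i))) m)) * fact (card S)"
    unfolding cQ by (simp add: algebra_simps)
  then show "?F k l m = mcoeff (generating_series (partial_disks \<kappa> (Suc k) l) +
     (\<Sum>i\<in>?I. generating_series (partial_disks \<kappa> 0 i) * generating_series (partial_disks \<kappa> (Suc k) (l - i)))) m"
    by (simp add: mcoeff_sum)
qed

lemma ordinary_disk_series_eq: "ordinary_disk_series \<kappa> l = generating_series (partial_disks \<kappa> 0 l)"
  by (simp add: ordinary_disk_series_def partial_disks_def simple_upto_def)

text \<open>The first \<open>l\<close> iterates of \<phi> exhaust a boundary of length
  \<open>l\<close>, so the condition then concerns all pairs of boundary half-edges.\<close>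

lemma fully_simple_disk_series_eq: "fully_simple_disk_series \<kappa> l = generating_series (partial_disks \<kappa> l l)"
proof -
  have "fully_simple M \<longleftrightarrow> simple_upto l M" if M: "is_disk M" "boundary_lengths M = [l]" for M :: "nat stuffed_map"
  proof -
    have st: "is_stuffed_map M" using M(1) by (simp add: is_disk_def)
    note D = is_stuffed_mapD[OF st]
    obtain r where r: "roots M = [r]" using M(1) by (auto simp: is_disk_def length_Suc_conv)
    have l: "card (orbit (map_phi M) r) = l" using M(2) r by (simp add: boundary_lengths_def boundaries_def)
    have "orbit (map_phi M) r = (\<lambda>j. (map_phi M ^^ j) r) ` {..<l}"
      using card_orbit_funpow(1)[OF D(14), of r] unfolding l bij_betw_def by simp
    then have "simple_upto l M \<longleftrightarrow> (\<forall>y\<in>orbit (map_phi M) r. \<forall>x\<in>orbit (map_phi M) r. x \<in> orbit (map_sigma M) y \<longrightarrow> x = y)"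
      unfolding simple_upto_def boundary_half_edges_root[OF r] r list.sel by auto
    then show ?thesis
      unfolding fully_simple_def boundary_half_edges_root[OF r] inj_on_def orbit_eq_orbit_iff[OF D(12)] by blast
  qed
  then show ?thesis unfolding fully_simple_disk_series_def partial_disks_def
    by (intro arg_cong[of _ _ generating_series]) blast
qed

text \<open>
  The exponent counts the boundary half-edges after the first \<open>k\<close>.  The degenerate disk with
  empty boundary is not a map: it is added by hand.
\<close>

definition tail_series :: "map_kind \<Rightarrow> nat \<Rightarrow> (weight_var, rat) mpower_series fps" where
  "tail_series \<kappa> k = Abs_fps (\<lambda>j. if k = 0 \<and> j = 0 then 1 else generating_series (partial_disks \<kappa> k (k + j)))"

text \<open>The indeterminate is 1/x. The constant 1 added for the empty boundary produces the
  leading term of W.\<close>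

lemma W_series_eq: "W_series \<kappa> = fps_X * tail_series \<kappa> 0"
proof (rule fps_ext)
  fix n
  show "fps_nth (W_series \<kappa>) n = fps_nth (fps_X * tail_series \<kappa> 0) n"
    by (cases n) (auto simp: W_series_def tail_series_def ordinary_disk_series_eq)
qed

text \<open>The recurrence in generating form: the constant term is the case \<open>l = k\<close>,
  in which no boundary half-edge is left to inspect, and the convolution with W collects all cases
  \<open>l > k\<close>.\<close>

lemma tail_series_step:
  "tail_series \<kappa> k = fps_const (fps_nth (tail_series \<kappa> k) 0) + W_series \<kappa> * tail_series \<kappa> (Suc k)"
proof (rule fps_ext)
  fix n
  show "fps_nth (tail_series \<kappa> k) n =
    fps_nth (fps_const (fps_nth (tail_series \<kappa> k) 0) + W_series \<kappa> * tail_series \<kappa> (Suc k)) n"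
  proof (cases n)
    case 0
    then show ?thesis by (simp add: W_series_eq mult.assoc)
  next
    case (Suc j)
    let ?F = "\<lambda>k l. generating_series (partial_disks \<kappa> k l)"
    have "fps_nth (W_series \<kappa> * tail_series \<kappa> (Suc k)) n = fps_nth (tail_series \<kappa> 0 * tail_series \<kappa> (Suc k)) j"
      by (simp add: W_series_eq mult.assoc Suc)
    also have "\<dots> = (\<Sum>i=0..j. fps_nth (tail_series \<kappa> 0) i * ?F (Suc k) (k + Suc j - i))"
      unfolding fps_mult_nth by (rule sum.cong[OF refl]) (simp add: tail_series_def Suc_diff_le)
    \<comment> \<open>The term \<open>i = 0\<close> carries the added constant 1 and yields the
      disks that need no cut. With \<open>l = k + Suc j\<close> the range \<open>i \<le> j\<close>
      is \<open>i < l - k\<close>.\<close>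
    also have "\<dots> = ?F (Suc k) (k + Suc j) + (\<Sum>i\<in>{0<..j}. fps_nth (tail_series \<kappa> 0) i * ?F (Suc k) (k + Suc j - i))"
      by (subst sum.head) (simp_all add: tail_series_def)
    also have "(\<Sum>i\<in>{0<..j}. fps_nth (tail_series \<kappa> 0) i * ?F (Suc k) (k + Suc j - i)) =
       (\<Sum>i\<in>{0<..<k + Suc j - k}. ?F 0 i * ?F (Suc k) (k + Suc j - i))"
      by (rule sum.cong) (auto simp: tail_series_def)
    also have "?F (Suc k) (k + Suc j) + \<dots> = ?F k (k + Suc j)"
      by (rule partial_disks_recurrence[symmetric]) simp
    finally show ?thesis by (simp add: Suc tail_series_def)
  qed
qed

lemma tail_series_iterate:
  "tail_series \<kappa> 0 = (\<Sum>i<n. fps_const (fps_nth (tail_series \<kappa> i) 0) * W_series \<kappa> ^ i) + W_series \<kappa> ^ n * tail_series \<kappa> n"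
proof (induction n)
  case (Suc n)
  have "W_series \<kappa> ^ n * tail_series \<kappa> n =
    fps_const (fps_nth (tail_series \<kappa> n) 0) * W_series \<kappa> ^ n + W_series \<kappa> ^ Suc n * tail_series \<kappa> (Suc n)"
    by (subst tail_series_step) (simp add: algebra_simps)
  then show ?case by (subst Suc.IH) (simp add: add.assoc)
qed simp

text \<open>W has no constant term, so after \<open>Suc n\<close> iterations the remainder is
  divisible by \<open>fps_X ^ Suc n\<close> and does not affect coefficient
  \<open>n\<close>.\<close>

lemma tail_series_compose: "Abs_fps (\<lambda>k. fps_nth (tail_series \<kappa> k) 0) oo W_series \<kappa> = tail_series \<kappa> 0"
proof (rule fps_ext)
  fix n
  have "W_series \<kappa> ^ Suc n * tail_series \<kappa> (Suc n) = fps_X ^ Suc n * (tail_series \<kappa> 0 ^ Suc n * tail_series \<kappa> (Suc n))"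
    unfolding W_series_eq power_mult_distrib by (simp only: mult.assoc)
  then have 0: "fps_nth (W_series \<kappa> ^ Suc n * tail_series \<kappa> (Suc n)) n = 0"
    by (simp only: fps_X_power_mult_nth) simp
  have "fps_nth (tail_series \<kappa> 0) n = (\<Sum>i<Suc n. fps_nth (fps_const (fps_nth (tail_series \<kappa> i) 0) * W_series \<kappa> ^ i) n)"
    by (subst tail_series_iterate[of _ "Suc n"]) (simp only: fps_add_nth fps_sum_nth 0 add_0_right)
  then show "fps_nth (Abs_fps (\<lambda>k. fps_nth (tail_series \<kappa> k) 0) oo W_series \<kappa>) n = fps_nth (tail_series \<kappa> 0) n"
    by (simp add: fps_compose_nth lessThan_Suc_atMost atLeast0AtMost)
qed

theorem proposition1p1:
  fixes \<kappa> :: map_kind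
  shows "fls_compose_monic (X_series \<kappa>) (W_series \<kappa>) = fls_X_inv"
proof -
  \<comment> \<open>X(w) is 1/w times the series of the constant terms, the one of index 0 being the
    added 1.\<close>
  have X: "fls_nth (X_series \<kappa>) n = (if n < -1 then 0 else fps_nth (tail_series \<kappa> (nat (n + 1))) 0)" for n
  proof -
    consider "n < -1" | "n = -1" | "0 \<le> n" by linarith
    then show ?thesis
    proof cases
      case 3
      then have "nat (n + 1) = Suc (nat n)" by simp
      then show ?thesis using 3 by (simp add: X_series_def tail_series_def fully_simple_disk_series_eq)
    qed (simp_all add: X_series_def tail_series_def)
  qed
  have sub: "fls_subdegree (X_series \<kappa>) = -1"
    by (rule fls_subdegree_eqI) (simp_all add: X tail_series_def)
  have base: "fls_base_factor_to_fps (X_series \<kappa>) = Abs_fps (\<lambda>k. fps_nth (tail_series \<kappa> k) 0)"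
    by (rule fps_ext) (simp only: fls_base_factor_to_fps_nth sub X, simp)
  let ?inv = "fls_right_inverse (fps_to_fls (W_series \<kappa>)) 1"
  have "subdegree (W_series \<kappa>) = 1" by (rule subdegreeI) (simp_all add: W_series_eq tail_series_def)
  then have "fps_to_fls (W_series \<kappa>) * ?inv = 1"
    by (intro fls_right_inverse_monic) (simp add: W_series_eq tail_series_def)
  then have inv: "fls_X * (fps_to_fls (tail_series \<kappa> 0) * ?inv) = 1"
    by (simp add: W_series_eq fls_times_fps_to_fls mult.assoc)
  \<comment> \<open>Subdegree -1 contributes exactly one factor 1/W. As W is
    \<open>tail_series \<kappa> 0\<close> divided by x, the quotient is x, written
    \<open>fls_X_inv\<close>.\<close>
  have "fls_compose_monic (X_series \<kappa>) (W_series \<kappa>) = fps_to_fls (tail_series \<kappa> 0) * ?inv"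
    unfolding fls_compose_monic_def base tail_series_compose sub by simp
  also have "\<dots> = fls_X_inv * (fls_X * (fps_to_fls (tail_series \<kappa> 0) * ?inv))"
    by (simp add: fls_X_inv_times_conv_shift fls_X_times_conv_shift)
  also have "\<dots> = fls_X_inv" by (simp only: inv mult_1_right)
  finally show ?thesis .
qed

end
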